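(* Let $\mathcal{H}$ be a real Hilbert space, let $D\subset\mathcal{H}$ be a nonempty closed convex set, and let $T\colon D\to D$ be a nonexpansive operator with $\operatorname{Fix}T\neq\emptyset$. Let $(T_t)_{t>0}$ be a family of nonexpansive operators from $D$ into $D$, let $\varepsilon\colon[0,\infty)\to(0,\infty)$, let $y(\cdot)\colon[0,\infty)\to D$, and let $y\in D$. Assume: (a) $\varepsilon$ is absolutely continuous and nonincreasing, $\lim_{t\to+\infty}\varepsilon(t)=0$ and $\int_0^{+\infty}\varepsilon(s)\,ds=+\infty$; (b) $t\mapsto y(t)$ is locally absolutely continuous, $y(t)\to y$ and $\|\dot y(t)\|\to 0$ as $t\to+\infty$; (c) for all $x\in D$ the map $t\mapsto T_t(x)$ belongs to $L^1_{\mathrm{loc}}(\mathbb{R}_+;\mathcal{H})$; (d) $\lim_{t\to+\infty}\psi(t)/\varepsilon(t)=0$, where $$\psi(t):=2\|y(t)-y\|+w\big(t,\mathcal{F}(\varepsilon(t),y)\big)+\|\dot y(t)\|-\frac{\dot\varepsilon(t)}{\varepsilon(t)}\Big(2\|y(t)-y\|+d_{\operatorname{Fix}T}(y)\Big),$$ with $w(t,x):=\|T_t(x)-T(x)\|$ and $\mathcal{F}$ the map associated with $T$ (see context). Let $x_0\in D$. Then the unique solution $x(\cdot)\in \operatorname{AC}_{\mathrm{loc}}(\mathbb{R}_+;\mathcal{H})$ (with values in $D$) of $$-\dot x(t)=x(t)-T_t(x(t))+\varepsilon(t)\big(x(t)-y(t)\big)\ \text{ for a.e. } t\ge 0,\qquad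 x(0)=x_0,$$ converges strongly to $\operatorname{proj}_{\operatorname{Fix}T}(y)$ as $t\to+\infty$.
   Context: An operator $T\colon D\to D$ is nonexpansive if $\|T(x)-T(x')\|\le\|x-x'\|$ for all $x,x'\in D$. $\operatorname{Fix}T$ is its set of fixed points (closed and convex). $d_S$ is the distance to a nonempty closed convex set $S$, and $\operatorname{proj}_S$ is the metric projection onto $S$. For $\epsilon>0$ and $u\in D$, $\mathcal{F}(\epsilon,u)\in D$ denotes the unique point $z\in D$ satisfying $\epsilon z+z-T(z)=\epsilon u$ (existence and uniqueness hold since $T$ is nonexpansive). Dots denote derivatives in $t$, which exist for a.e. $t$; $\operatorname{AC}_{\mathrm{loc}}$ denotes locally absolutely continuous functions; $L^1_{\mathrm{loc}}(\mathbb{R}_+;\mathcal{H})$ is in the sense of Bochner. Limits as $t\to+\infty$ of quantities defined only for a.e. $t$ are essential limits (for every $\gamma>0$ there is $t_\gamma$ such that the quantity is within $\gamma$ of the limit for a.e. $t\ge t_\gamma$). *)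

theory Defs
  imports "HOL-Analysis.Analysis"
begin

definition nonexpansive_on :: "'a::real_normed_vector set \<Rightarrow> ('a \<Rightarrow> 'a) \<Rightarrow> bool" where
  "nonexpansive_on D T \<longleftrightarrow> T ` D \<subseteq> D \<and> (\<forall>x\<in>D. \<forall>x'\<in>D. norm (T x - T x') \<le> norm (x - x'))"

definition Fix :: "'a set \<Rightarrow> ('a \<Rightarrow> 'a) \<Rightarrow> 'a set" where
  "Fix D T = {x \<in> D. T x = x}"

text \<open>
  The library's \<open>closest_point\<close> requires a Heine-Borel space, which excludes
  infinite-dimensional Hilbert spaces.
\<close>

definition metric_proj :: "'a::metric_space set \<Rightarrow> 'a \<Rightarrow> 'a" where
  "metric_proj S u = (THE p. p \<in> S \<and> (\<forall>q\<in>S. dist u p \<le> dist u q))"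

definition reg_point :: "'a::real_vector set \<Rightarrow> ('a \<Rightarrow> 'a) \<Rightarrow> real \<Rightarrow> 'a \<Rightarrow> 'a" where
  "reg_point D T e u = (THE z. z \<in> D \<and> e *\<^sub>R z + z - T z = e *\<^sub>R u)"

text \<open>
  Absolute continuity on a (possibly unbounded) real interval \<open>I\<close>; a pair \<open>(a, b)\<close> in \<open>P\<close>
  stands for the interval with endpoints \<open>a\<close> and \<open>b\<close>.
\<close>

definition abs_continuous_on :: "real set \<Rightarrow> (real \<Rightarrow> 'a::real_normed_vector) \<Rightarrow> bool" where
  "abs_continuous_on I f \<longleftrightarrow>
     (\<forall>e>0. \<exists>d>0. \<forall>P. finite P \<and> (\<forall>(a, b)\<in>P. a < b \<and> {a..b} \<subseteq> I) \<and>
        pairwise (\<lambda>(a, b) (a', b'). disjnt {a<..<b} {a'<..<b'}) P \<and> (\<Sum>(a, b)\<in>P. b - a) < d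
        \<longrightarrow> (\<Sum>(a, b)\<in>P. norm (f b - f a)) < e)"

definition loc_abs_continuous :: "(real \<Rightarrow> 'a::real_normed_vector) \<Rightarrow> bool" where
  "loc_abs_continuous f \<longleftrightarrow> (\<forall>b\<ge>0. abs_continuous_on {0..b} f)"

text \<open>
  The library's \<open>integrable\<close> requires a second countable range, that is, a separable Hilbert
  space. The definition below does not: it asks for integrable simple functions converging to
  \<open>f\<close> almost everywhere (strong measurability) and in the mean.
\<close>

definition bochner_integrable :: "'b measure \<Rightarrow> ('b \<Rightarrow> 'a::real_normed_vector) \<Rightarrow> bool" where
  "bochner_integrable M f \<longleftrightarrow>
     (\<exists>s. (\<forall>i. Bochner_Integration.simple_bochner_integrable M (s i)) \<and>
          (AE x in M. (\<lambda>i. s i x) \<longlonglongrightarrow> f x) \<and>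
          (\<lambda>i. \<integral>\<^sup>+x. ennreal (norm (f x - s i x)) \<partial>M) \<longlonglongrightarrow> 0)"

definition loc_bochner_integrable :: "(real \<Rightarrow> 'a::real_normed_vector) \<Rightarrow> bool" where
  "loc_bochner_integrable f \<longleftrightarrow> (\<forall>b\<ge>0. bochner_integrable (lebesgue_on {0..b}) f)"

definition ess_tendsto :: "(real \<Rightarrow> real) \<Rightarrow> real \<Rightarrow> bool" where
  "ess_tendsto f l \<longleftrightarrow> (\<forall>\<gamma>>0. \<exists>t\<^sub>0. AE t in lebesgue. t \<ge> t\<^sub>0 \<longrightarrow> \<bar>f t - l\<bar> \<le> \<gamma>)"

definition psi ::
  "'a::real_normed_vector set \<Rightarrow> ('a \<Rightarrow> 'a) \<Rightarrow> (real \<Rightarrow> 'a \<Rightarrow> 'a) \<Rightarrow> (real \<Rightarrow> real) \<Rightarrow>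
    (real \<Rightarrow> 'a) \<Rightarrow> 'a \<Rightarrow> real \<Rightarrow> real" where
  "psi D T Tt \<epsilon> y yinf t =
     2 * norm (y t - yinf)
     + (let z = reg_point D T (\<epsilon> t) yinf in norm (Tt t z - T z))
     + norm (vector_derivative y (at t))
     - vector_derivative \<epsilon> (at t) / \<epsilon> t * (2 * norm (y t - yinf) + infdist yinf (Fix D T))"

text \<open>Only the values of a solution on \<open>[0, \<infinity>)\<close> matter.\<close>

definition is_solution ::
  "'a::real_normed_vector set \<Rightarrow> (real \<Rightarrow> 'a \<Rightarrow> 'a) \<Rightarrow> (real \<Rightarrow> real) \<Rightarrow> (real \<Rightarrow> 'a) \<Rightarrow> 'a \<Rightarrow>
    (real \<Rightarrow> 'a) \<Rightarrow> bool" where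
  "is_solution D Tt \<epsilon> y x0 x \<longleftrightarrow>
     loc_abs_continuous x \<and> (\<forall>t\<ge>0. x t \<in> D) \<and> x 0 = x0 \<and>
     (AE t in lebesgue. t \<ge> 0 \<longrightarrow>
        x differentiable (at t) \<and>
        - vector_derivative x (at t) = x t - Tt t (x t) + \<epsilon> t *\<^sub>R (x t - y t))"

end

theory Submission
  imports Defs
begin

text \<open>
  Let \<open>z(t)\<close> be the point of \<open>D\<close> with \<open>\<epsilon>(t) z + z - T z = \<epsilon>(t) y\<close>. As \<open>e\<close> decreases to \<open>0\<close>, the squared
  distances from \<open>y\<close> to the regularized fixed points increase, are bounded by the squared distance
  from \<open>y\<close> to any fixed point of \<open>T\<close>, and their increments dominate the squared distances between
  the regularized fixed points themselves. This Cauchy property makes \<open>z(t)\<close> converge to the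
  projection of \<open>y\<close> on the fixed point set (\<open>reg_tendsto\<close>).

  It remains to see that the solution \<open>x\<close> follows \<open>z\<close>. Subtracting the equation of \<open>z(t)\<close> from that of
  \<open>x(t)\<close> and using that \<open>T\<^sub>t\<close> is nonexpansive, one finds for almost every \<open>t\<close> that the upper right
  derivative of \<open>\<parallel>x - z\<parallel>\<close> is at most
  \<open>- \<epsilon> \<parallel>x - z\<parallel> + \<parallel>T\<^sub>t z - T z\<parallel> + \<epsilon> \<parallel>y(t) - y\<parallel> + \<bar>\<epsilon>'\<bar> / \<epsilon> \<sqdot> d(y)\<close>,
  where \<open>d(y)\<close> is the distance from \<open>y\<close> to the fixed points and the last term bounds the speed of \<open>z\<close>.
  The hypotheses on \<open>\<psi>\<close> and on \<open>y(t)\<close> say that all but the first term are \<open>o(\<epsilon>)\<close>, and since \<open>\<epsilon>\<close> is not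
  integrable this forces \<open>\<parallel>x - z\<parallel>\<close> to \<open>0\<close> (\<open>right_dini_convergence\<close>).

  All differential inequalities rest on one fact: a real absolutely continuous function whose upper
  right derivative is at most \<open>0\<close> almost everywhere is nonincreasing
  (\<open>abs_continuous_on_nonincreasing\<close>). It is applied to norms, for which one-sided bounds come from
  explicit Euler steps and from the Lipschitz dependence of \<open>z(t)\<close> on \<open>\<epsilon>(t)\<close>. Vector-valued integrals
  are replaced by primitives: a primitive of \<open>g\<close> is an absolutely continuous \<open>G\<close> with \<open>G' = g\<close> almost
  everywhere. A limit theorem for primitives (\<open>has_primitive_limit\<close>) reduces the existence of
  primitives of Bochner integrable functions, and of \<open>t \<mapsto> T\<^sub>t(u(t))\<close> for continuous \<open>u\<close>, to the
  differentiation of scalar integrals (\<open>AE_primitive_has_derivative\<close>, by Vitali's covering theorem and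
  Henstock's lemma). This covers nonseparable Hilbert spaces.

  A solution is found by Picard iteration for \<open>T\<^sub>t\<close> composed with the projection onto \<open>D\<close>; its distance
  to \<open>D\<close> satisfies the same kind of one-sided inequality, so it never leaves \<open>D\<close>. Finally, the
  hypothesis on \<open>\<psi>\<close> gives information about \<open>\<epsilon>\<close> only where \<open>\<epsilon>\<close> is differentiable; this is almost everywhere,
  because a monotone absolutely continuous function is the integral of a
  Radon-Nikodym density (\<open>AE_differentiable_mono_abs_continuous\<close>).
\<close>

section \<open>Absolutely continuous functions on an interval\<close>

text \<open>
  The finite systems of nonoverlapping intervals over which absolute continuity sums increments.
\<close>

definition interval_family :: "real set \<Rightarrow> (real \<times> real) set \<Rightarrow> bool" where
  "interval_family I P \<longleftrightarrow> finite P \<and> (\<forall>(a, b)\<in>P. a < b \<and> {a..b} \<subseteq> I) \<and>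
     pairwise (\<lambda>(a, b) (a', b'). disjnt {a<..<b} {a'<..<b'}) P"

lemma abs_continuous_on_alt:
  "abs_continuous_on I f \<longleftrightarrow>
     (\<forall>e>0. \<exists>d>0. \<forall>P. interval_family I P \<and> (\<Sum>(a, b)\<in>P. b - a) < d
        \<longrightarrow> (\<Sum>(a, b)\<in>P. norm (f b - f a)) < e)"
  unfolding abs_continuous_on_def interval_family_def by (simp add: conj_assoc)

lemma interval_family_mono: "interval_family I P \<Longrightarrow> I \<subseteq> J \<Longrightarrow> interval_family J P"
  unfolding interval_family_def by fast

lemma abs_continuous_on_subset: "abs_continuous_on I f \<Longrightarrow> J \<subseteq> I \<Longrightarrow> abs_continuous_on J f"
  unfolding abs_continuous_on_alt using interval_family_mono by meson

text \<open>
  Most closure properties of absolute continuity (sums, differences, norms, Lipschitz images) are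
  instances of this comparison of increments.
\<close>

lemma abs_continuous_on_dominated:
  assumes "abs_continuous_on I g" "abs_continuous_on I h" "C \<ge> 0"
    and le: "\<And>s t. s < t \<Longrightarrow> {s..t} \<subseteq> I \<Longrightarrow>
               norm (f t - f s) \<le> C * (norm (g t - g s) + norm (h t - h s))"
  shows "abs_continuous_on I f"
  unfolding abs_continuous_on_alt
proof (intro allI impI)
  fix e :: real assume "e > 0"
  define e' where "e' = e / (2 * (C + 1))"
  have "e' > 0" using \<open>e > 0\<close> \<open>C \<ge> 0\<close> by (simp add: e'_def)
  obtain d1 where d1: "d1 > 0" "\<And>P. interval_family I P \<Longrightarrow> (\<Sum>(a, b)\<in>P. b - a) < d1
      \<Longrightarrow> (\<Sum>(a, b)\<in>P. norm (g b - g a)) < e'"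
    using assms(1) \<open>e' > 0\<close> unfolding abs_continuous_on_alt by blast
  obtain d2 where d2: "d2 > 0" "\<And>P. interval_family I P \<Longrightarrow> (\<Sum>(a, b)\<in>P. b - a) < d2
      \<Longrightarrow> (\<Sum>(a, b)\<in>P. norm (h b - h a)) < e'"
    using assms(2) \<open>e' > 0\<close> unfolding abs_continuous_on_alt by blast
  have "(\<Sum>(a, b)\<in>P. norm (f b - f a)) < e"
    if P: "interval_family I P" "(\<Sum>(a, b)\<in>P. b - a) < min d1 d2" for P
  proof -
    have "(\<Sum>(a, b)\<in>P. norm (f b - f a))
        \<le> (\<Sum>(a, b)\<in>P. C * (norm (g b - g a) + norm (h b - h a)))"
      using P(1) le by (intro sum_mono) (auto simp: interval_family_def)
    also have "\<dots> = C * ((\<Sum>(a, b)\<in>P. norm (g b - g a)) + (\<Sum>(a, b)\<in>P. norm (h b - h a)))"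
      by (simp add: sum_distrib_left sum.distrib case_prod_beta distrib_left)
    also have "\<dots> \<le> C * (2 * e')"
      using d1(2)[OF P(1)] d2(2)[OF P(1)] P(2) \<open>C \<ge> 0\<close> by (intro mult_left_mono) auto
    also have "\<dots> < e"
      using \<open>e > 0\<close> \<open>C \<ge> 0\<close> by (simp add: e'_def field_simps)
    finally show ?thesis .
  qed
  then show "\<exists>d>0. \<forall>P. interval_family I P \<and> (\<Sum>(a, b)\<in>P. b - a) < d
        \<longrightarrow> (\<Sum>(a, b)\<in>P. norm (f b - f a)) < e"
    using d1(1) d2(1) by (intro exI[of _ "min d1 d2"]) auto
qed

lemma abs_continuous_on_id: "abs_continuous_on I (\<lambda>t::real. t)"
  unfolding abs_continuous_on_alt
proof (intro allI impI)
  fix e :: real assume "e > 0"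
  have "(\<Sum>(a, b)\<in>P. norm (b - a)) = (\<Sum>(a, b)\<in>P. b - a)" if "interval_family I P" for P
    using that by (intro sum.cong) (auto simp: interval_family_def)
  then show "\<exists>d>0. \<forall>P. interval_family I P \<and> (\<Sum>(a, b)\<in>P. b - a) < d
        \<longrightarrow> (\<Sum>(a, b)\<in>P. norm (b - a)) < e"
    using \<open>e > 0\<close> by (intro exI[of _ e]) auto
qed

lemma abs_continuous_on_lipschitz:
  assumes "C \<ge> 0" "\<And>s t. s < t \<Longrightarrow> {s..t} \<subseteq> I \<Longrightarrow> norm (f t - f s) \<le> C * (t - s)"
  shows "abs_continuous_on I f"
proof (rule abs_continuous_on_dominated[OF abs_continuous_on_id abs_continuous_on_id assms(1)])
  fix s t :: real assume st: "s < t" "{s..t} \<subseteq> I"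
  have "C * (t - s) \<le> C * (norm (t - s) + norm (t - s))"
    using st assms(1) by (intro mult_left_mono) auto
  then show "norm (f t - f s) \<le> C * (norm (t - s) + norm (t - s))"
    using assms(2)[OF st] by linarith
qed

lemma abs_continuous_on_add:
  assumes "abs_continuous_on I f" "abs_continuous_on I g"
  shows "abs_continuous_on I (\<lambda>t. f t + g t)"
  by (rule abs_continuous_on_dominated[OF assms, of 1])
     (auto simp: add_diff_add intro: norm_triangle_ineq)

lemma abs_continuous_on_diff:
  assumes "abs_continuous_on I f" "abs_continuous_on I g"
  shows "abs_continuous_on I (\<lambda>t. f t - g t)"
proof (rule abs_continuous_on_dominated[OF assms, of 1])
  fix s t
  show "norm (f t - g t - (f s - g s)) \<le> 1 * (norm (f t - f s) + norm (g t - g s))"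
    using norm_triangle_ineq4[of "f t - f s" "g t - g s"] by (simp add: algebra_simps)
qed simp

lemma abs_continuous_on_const: "abs_continuous_on I (\<lambda>t. c)"
  by (rule abs_continuous_on_lipschitz[of 0]) auto

lemma abs_continuous_on_dominated1:
  assumes "abs_continuous_on I g" "C \<ge> 0"
    and "\<And>s t. s < t \<Longrightarrow> {s..t} \<subseteq> I \<Longrightarrow> norm (f t - f s) \<le> C * norm (g t - g s)"
  shows "abs_continuous_on I f"
  using abs_continuous_on_dominated[OF assms(1) abs_continuous_on_const[of _ "0::real"] assms(2), of f] assms(3)
  by simp

lemma abs_continuous_on_norm:
  assumes "abs_continuous_on I f"
  shows "abs_continuous_on I (\<lambda>t. norm (f t))"
  by (rule abs_continuous_on_dominated1[OF assms, of 1]) (auto simp: norm_triangle_ineq3)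

lemma abs_continuous_on_imp_continuous_on:
  assumes ac: "abs_continuous_on I f" and I: "is_interval I"
  shows "continuous_on I f"
  unfolding continuous_on_iff
proof (intro ballI allI impI)
  fix x e :: real assume "x \<in> I" "e > 0"
  then obtain d where d: "d > 0" "\<And>P. interval_family I P \<Longrightarrow> (\<Sum>(a, b)\<in>P. b - a) < d
      \<Longrightarrow> (\<Sum>(a, b)\<in>P. norm (f b - f a)) < e"
    using ac unfolding abs_continuous_on_alt by blast
  have *: "norm (f t - f s) < e" if "s \<in> I" "t \<in> I" "s < t" "t - s < d" for s t
  proof -
    have "{s..t} \<subseteq> I"
      using that(1,2) I unfolding is_interval_1 by (meson atLeastAtMost_iff subsetI)
    then show ?thesis
      using d(2)[of "{(s, t)}"] that by (simp add: interval_family_def)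
  qed
  have "dist (f x') (f x) < e" if "x' \<in> I" "dist x' x < d" for x'
  proof (cases x x' rule: linorder_cases)
    case less
    then show ?thesis using *[of x x'] that \<open>x \<in> I\<close> by (simp add: dist_norm)
  next
    case equal
    then show ?thesis using \<open>e > 0\<close> by simp
  next
    case greater
    then show ?thesis
      using *[of x' x] that \<open>x \<in> I\<close> by (simp add: dist_norm norm_minus_commute)
  qed
  then show "\<exists>d>0. \<forall>x'\<in>I. dist x' x < d \<longrightarrow> dist (f x') (f x) < e"
    using d(1) by blast
qed

section \<open>Monotonicity from one-sided derivatives almost everywhere\<close>

lemma interval_family_length_le_measure:
  assumes P: "interval_family I P" and U: "U \<in> lmeasurable"
    and sub: "\<And>c d. (c, d) \<in> P \<Longrightarrow> {c<..<d} \<subseteq> U"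
  shows "(\<Sum>(c, d)\<in>P. d - c) \<le> measure lebesgue U"
proof -
  let ?A = "\<lambda>p::real \<times> real. {fst p<..<snd p}"
  have fin: "finite P" using P by (simp add: interval_family_def)
  have "disjoint_family_on ?A P"
    using P by (simp add: interval_family_def disjoint_family_on_def pairwise_def disjnt_def split_beta)
  moreover have "emeasure lebesgue (?A p) \<noteq> \<infinity>" for p
    using fmeasurableD2[OF lmeasurable_box[where 'a = real, unfolded box_real]]
    by (metis infinity_ennreal_def)
  ultimately have "measure lebesgue (\<Union>p\<in>P. ?A p) = (\<Sum>p\<in>P. measure lebesgue (?A p))"
    using fin by (intro measure_finite_Union) auto
  also have "\<dots> = (\<Sum>(c, d)\<in>P. d - c)"
    using P by (intro sum.cong) (auto simp: interval_family_def)
  finally have "(\<Sum>(c, d)\<in>P. d - c) = measure lebesgue (\<Union>p\<in>P. ?A p)" by simp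
  also have "\<dots> \<le> measure lebesgue U"
  proof (rule measure_mono_fmeasurable[OF _ _ U])
    show "(\<Union>p\<in>P. ?A p) \<subseteq> U" using sub by fastforce
    show "(\<Union>p\<in>P. ?A p) \<in> sets lebesgue" using fin by (intro sets.finite_UN) auto
  qed
  finally show ?thesis .
qed

text \<open>
  Outer regularity: absolute continuity makes the total increment of a function over such a cover
  negligible, which is how exceptional null sets are disposed of.
\<close>

lemma null_set_small_open_cover:
  fixes N :: "real set" and e :: real
  assumes "N \<in> null_sets lebesgue" "e > 0"
  obtains U where "open U" "N \<subseteq> U" "U \<in> lmeasurable" "measure lebesgue U < e"
proof -
  have "negligible N" using assms(1) by (simp add: negligible_iff_null_sets)
  then have N: "N \<in> lmeasurable" "measure lebesgue N = 0"
    by (auto intro: negligible_imp_measurable negligible_imp_measure0)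
  obtain U where U: "open U" "N \<subseteq> U" "U - N \<in> lmeasurable" "emeasure lebesgue (U - N) < ennreal e"
    using sets_lebesgue_outer_open[OF _ assms(2)] N(1) by blast
  have eq: "U = N \<union> (U - N)" using U(2) by blast
  have "U \<in> lmeasurable" using fmeasurable.Un[OF N(1) U(3)] eq by simp
  moreover have "measure lebesgue (U - N) < e"
    using U(3,4) assms(2) by (simp add: emeasure_eq_measure2 ennreal_less_iff)
  then have "measure lebesgue U < e"
    using measure_Un_le[of N lebesgue "U - N"] N U(3) eq by (simp add: fmeasurableD)
  ultimately show ?thesis using that U(1,2) by blast
qed

text \<open>
  A continuous induction along \<open>{a..b}\<close>. Fix \<open>e > 0\<close> and cover the points where the derivative bound
  may fail by a small open set \<open>U\<close>. Moving right from a good point costs at most \<open>e\<close> times the length;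
  moving right from a point of \<open>U\<close> one records the increment over an interval inside \<open>U\<close>. Absolute
  continuity bounds the sum of all recorded increments by \<open>e\<close>. The argument
  moves to the right only, whence the one-sided derivatives.
\<close>

lemma abs_continuous_on_nonincreasing:
  fixes \<phi> :: "real \<Rightarrow> real"
  assumes ac: "abs_continuous_on {a..b} \<phi>" and ab: "a \<le> b"
    and der: "AE t in lebesgue. t \<in> {a<..<b} \<longrightarrow>
        (\<forall>\<kappa>>0. \<forall>\<^sub>F s in at_right t. \<phi> s - \<phi> t \<le> \<kappa> * (s - t))"
  shows "\<phi> b \<le> \<phi> a"
proof (rule field_le_epsilon)
  fix e0 :: real assume "e0 > 0"
  define e where "e = e0 / (b - a + 2)"
  have "e > 0" using \<open>e0 > 0\<close> ab by (simp add: e_def)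
  have cont: "continuous_on {a..b} \<phi>"
    by (rule abs_continuous_on_imp_continuous_on[OF ac]) (simp add: is_interval_cc)
  obtain \<delta> where \<delta>: "\<delta> > 0" "\<And>P. interval_family {a..b} P \<Longrightarrow> (\<Sum>(c, d)\<in>P. d - c) < \<delta>
      \<Longrightarrow> (\<Sum>(c, d)\<in>P. norm (\<phi> d - \<phi> c)) < e"
    using ac \<open>e > 0\<close> unfolding abs_continuous_on_alt by blast
  obtain N where N: "N \<in> null_sets lebesgue"
    "\<And>t. t \<in> {a<..<b} - N \<Longrightarrow> \<forall>\<kappa>>0. \<forall>\<^sub>F s in at_right t. \<phi> s - \<phi> t \<le> \<kappa> * (s - t)"
    using der by (auto simp: eventually_ae_filter)
  have "insert a N \<in> null_sets lebesgue"
    using N(1) by (simp flip: negligible_iff_null_sets)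
  then obtain U where U: "open U" "insert a N \<subseteq> U" "U \<in> lmeasurable" "measure lebesgue U < \<delta>"
    by (rule null_set_small_open_cover[OF _ \<open>\<delta> > 0\<close>])
  \<comment> \<open>the slack \<open>\<kappa>\<close> makes \<open>Q\<close> closed under limits from the left\<close>
  define Q where "Q t \<longleftrightarrow> (\<forall>\<kappa>>0. \<exists>P. interval_family {a..t} P \<and> (\<forall>(c, d)\<in>P. {c..d} \<subseteq> U) \<and>
      \<phi> t - \<phi> a \<le> e * (t - a) + \<kappa> + (\<Sum>(c, d)\<in>P. norm (\<phi> d - \<phi> c)))" for t
  define S where "S = {t \<in> {a..b}. Q t}"
  have "a \<in> S"
    unfolding S_def Q_def using ab
    by (auto intro!: exI[of _ "{}"] simp: interval_family_def)
  have bdd: "bdd_above S" unfolding S_def by (rule bdd_aboveI[of _ b]) auto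
  define \<tau> where "\<tau> = Sup S"
  have "a \<le> \<tau>" unfolding \<tau>_def by (rule cSup_upper[OF \<open>a \<in> S\<close> bdd])
  moreover have "\<tau> \<le> b"
    unfolding \<tau>_def using \<open>a \<in> S\<close> by (intro cSup_least) (auto simp: S_def)
  ultimately have \<tau>: "a \<le> \<tau>" "\<tau> \<le> b" .
  have "Q \<tau>"
    unfolding Q_def
  proof (intro allI impI)
    fix \<kappa> :: real assume "\<kappa> > 0"
    have "\<tau> \<in> {a..b}" using \<tau> by simp
    then obtain d where d: "d > 0" "\<And>t. t \<in> {a..b} \<Longrightarrow> dist t \<tau> < d \<Longrightarrow> dist (\<phi> t) (\<phi> \<tau>) < \<kappa>/2"
      using cont \<open>\<kappa> > 0\<close> unfolding continuous_on_iff by (metis half_gt_zero)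
    have "\<exists>t\<in>S. \<tau> - d < t"
      using d(1) \<open>a \<in> S\<close> bdd unfolding \<tau>_def by (subst less_cSup_iff[symmetric]) auto
    then obtain t where t: "t \<in> S" "\<tau> - d < t" by blast
    have tt: "t \<le> \<tau>" using cSup_upper[OF t(1) bdd] by (simp add: \<tau>_def)
    have "dist (\<phi> t) (\<phi> \<tau>) < \<kappa>/2" using t tt by (intro d(2)) (auto simp: S_def dist_real_def)
    then have *: "\<phi> \<tau> \<le> \<phi> t + \<kappa>/2" unfolding dist_real_def by linarith
    obtain P where P: "interval_family {a..t} P" "\<forall>(c, d)\<in>P. {c..d} \<subseteq> U"
      "\<phi> t - \<phi> a \<le> e * (t - a) + \<kappa>/2 + (\<Sum>(c, d)\<in>P. norm (\<phi> d - \<phi> c))"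
      using t(1) half_gt_zero[OF \<open>\<kappa> > 0\<close>] unfolding S_def Q_def by blast
    have "e * (t - a) \<le> e * (\<tau> - a)" using \<open>e > 0\<close> tt by simp
    then have "\<phi> \<tau> - \<phi> a \<le> e * (\<tau> - a) + \<kappa> + (\<Sum>(c, d)\<in>P. norm (\<phi> d - \<phi> c))"
      using * P(3) by linarith
    moreover have "interval_family {a..\<tau>} P"
      using P(1) tt by (intro interval_family_mono[OF P(1)]) auto
    ultimately show "\<exists>P. interval_family {a..\<tau>} P \<and> (\<forall>(c, d)\<in>P. {c..d} \<subseteq> U) \<and>
      \<phi> \<tau> - \<phi> a \<le> e * (\<tau> - a) + \<kappa> + (\<Sum>(c, d)\<in>P. norm (\<phi> d - \<phi> c))"
      using P(2) by blast
  qed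
  have "\<tau> = b"
  proof (rule ccontr)
    assume "\<tau> \<noteq> b"
    then have "\<tau> < b" using \<tau> by simp
    \<comment> \<open>\<open>Q\<close> extends beyond \<open>\<tau>\<close>, through \<open>U\<close> or by the derivative bound\<close>
    have "\<exists>s. \<tau> < s \<and> s \<le> b \<and> Q s"
    proof (cases "\<tau> \<in> U")
      case True
      then obtain r where r: "r > 0" "ball \<tau> r \<subseteq> U" using U(1) openE by blast
      define s where "s = min b (\<tau> + r/2)"
      have s: "\<tau> < s" "s \<le> b" "{\<tau>..s} \<subseteq> U"
        using r \<open>\<tau> < b\<close> by (auto simp: s_def subset_eq dist_real_def)
      have "Q s"
        unfolding Q_def
      proof (intro allI impI)
        fix \<kappa> :: real assume "\<kappa> > 0"
        then obtain P where P: "interval_family {a..\<tau>} P" "\<forall>(c, d)\<in>P. {c..d} \<subseteq> U"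
          "\<phi> \<tau> - \<phi> a \<le> e * (\<tau> - a) + \<kappa> + (\<Sum>(c, d)\<in>P. norm (\<phi> d - \<phi> c))"
          using \<open>Q \<tau>\<close> unfolding Q_def by blast
        have *: "d \<le> \<tau>" if "(c, d) \<in> P" for c d
        proof -
          have "c < d" "{c..d} \<subseteq> {a..\<tau>}" using that P(1) by (auto simp: interval_family_def)
          then show ?thesis by simp
        qed
        have new: "(\<tau>, s) \<notin> P" using *[of \<tau> s] s(1) by auto
        have dj: "disjnt {c<..<d} {\<tau><..<s}" if "(c, d) \<in> P" for c d
          using *[OF that] by (auto simp: disjnt_def)
        have "interval_family {a..s} P"
          using s(1) by (intro interval_family_mono[OF P(1)]) auto
        then have "interval_family {a..s} (insert (\<tau>, s) P)"
          using s(1) \<tau>(1) dj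
          by (auto simp: interval_family_def pairwise_insert disjnt_sym)
        moreover have "e * (\<tau> - a) \<le> e * (s - a)" using \<open>e > 0\<close> s by simp
        then have "\<phi> s - \<phi> a \<le> e * (s - a) + \<kappa> + (\<Sum>(c, d)\<in>insert (\<tau>, s) P. norm (\<phi> d - \<phi> c))"
          using P new by (simp add: interval_family_def)
        ultimately show "\<exists>P. interval_family {a..s} P \<and> (\<forall>(c, d)\<in>P. {c..d} \<subseteq> U) \<and>
          \<phi> s - \<phi> a \<le> e * (s - a) + \<kappa> + (\<Sum>(c, d)\<in>P. norm (\<phi> d - \<phi> c))"
          using P(2) s(3) by (intro exI[of _ "insert (\<tau>, s) P"]) auto
      qed
      then show ?thesis using s by blast
    next
      case False
      then have "\<tau> \<in> {a<..<b} - N" using U(2) \<tau> \<open>\<tau> < b\<close> by (auto simp: less_le)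
      then have "\<forall>\<^sub>F s in at_right \<tau>. \<phi> s - \<phi> \<tau> \<le> e * (s - \<tau>)"
        using N(2) \<open>e > 0\<close> by blast
      moreover have "\<forall>\<^sub>F s in at_right \<tau>. s \<in> {\<tau><..<b}"
        by (rule eventually_at_right_real[OF \<open>\<tau> < b\<close>])
      ultimately have "\<forall>\<^sub>F s in at_right \<tau>. \<phi> s - \<phi> \<tau> \<le> e * (s - \<tau>) \<and> s \<in> {\<tau><..<b}"
        by (rule eventually_conj)
      then obtain s where s: "\<phi> s - \<phi> \<tau> \<le> e * (s - \<tau>)" "\<tau> < s" "s < b"
        using eventually_happens[of _ "at_right \<tau>"] trivial_limit_at_right_real[of \<tau>] by auto
      have "Q s"
        unfolding Q_def
      proof (intro allI impI)
        fix \<kappa> :: real assume "\<kappa> > 0"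
        then obtain P where P: "interval_family {a..\<tau>} P" "\<forall>(c, d)\<in>P. {c..d} \<subseteq> U"
          "\<phi> \<tau> - \<phi> a \<le> e * (\<tau> - a) + \<kappa> + (\<Sum>(c, d)\<in>P. norm (\<phi> d - \<phi> c))"
          using \<open>Q \<tau>\<close> unfolding Q_def by blast
        have "e * (s - a) = e * (s - \<tau>) + e * (\<tau> - a)" by (simp add: algebra_simps)
        then have "\<phi> s - \<phi> a \<le> e * (s - a) + \<kappa> + (\<Sum>(c, d)\<in>P. norm (\<phi> d - \<phi> c))"
          using P(3) s(1) by linarith
        moreover have "interval_family {a..s} P"
          using s(2) by (intro interval_family_mono[OF P(1)]) auto
        ultimately show "\<exists>P. interval_family {a..s} P \<and> (\<forall>(c, d)\<in>P. {c..d} \<subseteq> U) \<and>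
          \<phi> s - \<phi> a \<le> e * (s - a) + \<kappa> + (\<Sum>(c, d)\<in>P. norm (\<phi> d - \<phi> c))"
          using P(2) by blast
      qed
      then show ?thesis using s by auto
    qed
    then obtain s where "\<tau> < s" "s \<le> b" "Q s" by blast
    then have "s \<in> S" using \<tau> by (auto simp: S_def)
    then show False using cSup_upper[OF _ bdd] \<open>\<tau> < s\<close> by (force simp: \<tau>_def)
  qed
  then obtain P where P: "interval_family {a..b} P" "\<forall>(c, d)\<in>P. {c..d} \<subseteq> U"
    "\<phi> b - \<phi> a \<le> e * (b - a) + e + (\<Sum>(c, d)\<in>P. norm (\<phi> d - \<phi> c))"
    using \<open>Q \<tau>\<close> \<open>e > 0\<close> unfolding Q_def by blast
  have "(\<Sum>(c, d)\<in>P. d - c) \<le> measure lebesgue U"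
    using P(2) by (intro interval_family_length_le_measure[OF P(1) U(3)]) fastforce
  then have "(\<Sum>(c, d)\<in>P. norm (\<phi> d - \<phi> c)) < e"
    using \<delta>(2)[OF P(1)] U(4) by simp
  then have "\<phi> b - \<phi> a \<le> e * (b - a + 2)" using P(3) by (simp add: algebra_simps)
  also have "\<dots> = e0" using ab by (simp add: e_def)
  finally show "\<phi> b \<le> \<phi> a + e0" by simp
qed

lemma has_vector_derivative_at_iff_eventually:
  "(f has_vector_derivative f') (at t) \<longleftrightarrow>
     (\<forall>\<kappa>>0. \<forall>\<^sub>F s in at t. norm (f s - f t - (s - t) *\<^sub>R f') \<le> \<kappa> * \<bar>s - t\<bar>)"
  unfolding has_vector_derivative_def has_derivative_within_alt2
  by (auto intro: bounded_linear_scaleR_left)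

lemma has_vector_derivative_eventually_at_right:
  assumes "(f has_vector_derivative f') (at t)" "\<kappa> > 0"
  shows "\<forall>\<^sub>F s in at_right t. norm (f s - f t - (s - t) *\<^sub>R f') \<le> \<kappa> * (s - t)"
proof -
  have "\<forall>\<^sub>F s in at_right t. norm (f s - f t - (s - t) *\<^sub>R f') \<le> \<kappa> * \<bar>s - t\<bar>"
    using assms unfolding has_vector_derivative_at_iff_eventually
    by (meson at_le filter_leD subset_UNIV)
  then show ?thesis
    using eventually_at_right_less[of t] by eventually_elim simp
qed

text \<open>
  The mean value inequality with an almost everywhere derivative, obtained by applying the monotonicity
  criterion to \<open>t \<mapsto> norm (W t - W a) - R t\<close>.
\<close>

lemma norm_increment_le_abs_continuous:
  fixes W :: "real \<Rightarrow> 'a::real_normed_vector" and R :: "real \<Rightarrow> real"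
  assumes W: "abs_continuous_on {a..b} W" and R: "abs_continuous_on {a..b} R" and "a \<le> b"
    and der: "AE t in lebesgue. t \<in> {a<..<b} \<longrightarrow>
      (\<exists>w r. (W has_vector_derivative w) (at t) \<and> (R has_vector_derivative r) (at t) \<and> norm w \<le> r)"
  shows "norm (W b - W a) \<le> R b - R a"
proof -
  let ?\<phi> = "\<lambda>t. norm (W t - W a) - R t"
  have "?\<phi> b \<le> ?\<phi> a"
  proof (rule abs_continuous_on_nonincreasing[OF _ \<open>a \<le> b\<close>])
    show "abs_continuous_on {a..b} ?\<phi>"
      by (intro abs_continuous_on_diff abs_continuous_on_norm W R abs_continuous_on_const)
    show "AE t in lebesgue. t \<in> {a<..<b} \<longrightarrow>
        (\<forall>\<kappa>>0. \<forall>\<^sub>F s in at_right t. ?\<phi> s - ?\<phi> t \<le> \<kappa> * (s - t))"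
      using der
    proof (rule eventually_mono, intro impI allI)
      fix t \<kappa> :: real
      assume "t \<in> {a<..<b} \<longrightarrow> (\<exists>w r. (W has_vector_derivative w) (at t) \<and>
        (R has_vector_derivative r) (at t) \<and> norm w \<le> r)" "t \<in> {a<..<b}" "\<kappa> > 0"
      then obtain w r where wr: "(W has_vector_derivative w) (at t)"
        "(R has_vector_derivative r) (at t)" "norm w \<le> r" by blast
      show "\<forall>\<^sub>F s in at_right t. ?\<phi> s - ?\<phi> t \<le> \<kappa> * (s - t)"
        using has_vector_derivative_eventually_at_right[OF wr(1) half_gt_zero[OF \<open>\<kappa> > 0\<close>]]
          has_vector_derivative_eventually_at_right[OF wr(2) half_gt_zero[OF \<open>\<kappa> > 0\<close>]]
          eventually_at_right_less[of t]
      proof eventually_elim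
        case (elim s)
        have "norm (W s - W a) \<le> norm (W t - W a) + norm (W s - W t)"
          using norm_triangle_ineq[of "W t - W a" "W s - W t"] by simp
        moreover have "norm (W s - W t) \<le> norm (W s - W t - (s - t) *\<^sub>R w) + norm ((s - t) *\<^sub>R w)"
          using norm_triangle_ineq[of "W s - W t - (s - t) *\<^sub>R w" "(s - t) *\<^sub>R w"] by simp
        moreover have "norm ((s - t) *\<^sub>R w) \<le> (s - t) * r"
          using elim(3) wr(3) by (simp add: mult_left_mono)
        moreover have "norm (W s - W t - (s - t) *\<^sub>R w) \<le> \<kappa>/2 * (s - t)" using elim \<open>\<kappa> > 0\<close> by simp
        moreover have "- (\<kappa>/2 * (s - t)) \<le> R s - R t - (s - t) * r"
          using elim(2) unfolding real_norm_def real_scaleR_def by linarith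
        moreover have "\<kappa> * (s - t) = \<kappa>/2 * (s - t) + \<kappa>/2 * (s - t)" by simp
        ultimately show ?case by linarith
      qed
    qed
  qed
  then show ?thesis by simp
qed

section \<open>Almost everywhere differentiability of real functions\<close>

lemma cball_midpoint_real: "cball ((x + s)/2) (\<bar>s - x\<bar>/2) = {min x s..max x (s::real)}"
  by (auto simp: cball_eq_atLeastAtMost min_def max_def field_simps abs_if)

text \<open>
  Let \<open>E k\<close> be the set of points at which difference quotients of the integral miss \<open>f\<close> by more than
  \<open>1/(k + 1)\<close> at arbitrarily small scales. The intervals witnessing this form a Vitali cover, so disjoint
  ones exhaust \<open>E k\<close> up to a null set. Finitely many of them are a fine tagged partial division, and
  Henstock's lemma bounds the sum of the corresponding errors; since each error is at least a
  \<open>1/(k + 1)\<close> fraction of the length of its interval, the total length is as small as desired.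
\<close>

lemma AE_primitive_has_derivative:
  fixes f :: "real \<Rightarrow> real"
  assumes f: "f integrable_on {a..b}"
  shows "AE t in lebesgue. t \<in> {a<..<b} \<longrightarrow>
           ((\<lambda>x. integral {a..x} f) has_vector_derivative f t) (at t)"
proof -
  define F where "F x = integral {a..x} f" for x
  define E where "E k = {x \<in> {a<..<b}. \<forall>d>0. \<exists>s. s \<noteq> x \<and> \<bar>s - x\<bar> < d \<and>
      \<bar>s - x\<bar> < (real k + 1) * \<bar>F s - F x - (s - x) * f x\<bar>}" for k :: nat
  have diff: "F v - F u = integral {u..v} f" if "a \<le> u" "u \<le> v" "v \<le> b" for u v
  proof -
    have "f integrable_on {a..v}" using integrable_on_subinterval[OF f] that by auto
    from Henstock_Kurzweil_Integration.integral_combine[OF that(1,2) this]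
    show ?thesis by (simp add: F_def)
  qed
  have neg: "negligible (E k)" for k
    unfolding negligible_outer_le
  proof (intro allI impI)
    fix e :: real assume "e > 0"
    define e' where "e' = e / (real k + 1)"
    have "e' > 0" using \<open>e > 0\<close> by (simp add: e'_def)
    obtain \<gamma> where \<gamma>: "gauge \<gamma>"
      "\<And>p. p tagged_partial_division_of (cbox a b) \<Longrightarrow> \<gamma> fine p \<Longrightarrow>
         (\<Sum>(x, K)\<in>p. norm (measure lborel K *\<^sub>R f x - integral K f)) < e'"
      using Henstock_lemma[of f a b e'] f \<open>e' > 0\<close> by (auto simp: box_real)
    define J where "J = (\<lambda>(x::real, s). {min x s..max x s})"
    define K where "K = {(x, s). x \<in> E k \<and> s \<noteq> x \<and> J (x, s) \<subseteq> \<gamma> x \<and> J (x, s) \<subseteq> {a..b} \<and>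
        \<bar>s - x\<bar> < (real k + 1) * \<bar>F s - F x - (s - x) * f x\<bar>}"
    have ball: "cball ((\<lambda>(x, s). (x + s)/2) i) ((\<lambda>(x, s). \<bar>s - x\<bar>/2) i) = J i" for i
      by (auto simp: J_def cball_midpoint_real split: prod.splits)
    obtain C where C: "countable C" "C \<subseteq> K" "pairwise (\<lambda>i j. disjnt (J i) (J j)) C"
      "negligible (E k - (\<Union>i\<in>C. J i))"
    proof (rule Vitali_covering_theorem_cballs[of K "\<lambda>(x, s). \<bar>s - x\<bar>/2" "E k" "\<lambda>(x, s). (x + s)/2",
          unfolded ball])
      show "0 < (case i of (x, s) \<Rightarrow> \<bar>s - x\<bar>/2)" if "i \<in> K" for i
        using that by (auto simp: K_def)
      fix x d :: real assume x: "x \<in> E k" "0 < d"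
      then have xab: "a < x" "x < b" by (auto simp: E_def)
      have "open (\<gamma> x)" "x \<in> \<gamma> x" using \<gamma>(1) by (auto simp: gauge_def)
      then obtain \<rho> where \<rho>: "\<rho> > 0" "ball x \<rho> \<subseteq> \<gamma> x" using openE by blast
      define d' where "d' = Min {d, \<rho>, x - a, b - x}"
      have "d' > 0" using x \<rho> xab by (auto simp: d'_def)
      then obtain s where s: "s \<noteq> x" "\<bar>s - x\<bar> < d'"
        "\<bar>s - x\<bar> < (real k + 1) * \<bar>F s - F x - (s - x) * f x\<bar>"
        using x(1) unfolding E_def by blast
      have s': "\<bar>s - x\<bar> < d" "\<bar>s - x\<bar> < \<rho>" "\<bar>s - x\<bar> < x - a" "\<bar>s - x\<bar> < b - x"
        using s(2) by (auto simp: d'_def)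
      have "J (x, s) \<subseteq> ball x \<rho>" "J (x, s) \<subseteq> {a..b}"
        using s'(2-4) by (auto simp: J_def dist_real_def)
      then have "(x, s) \<in> K" using x s \<rho> by (auto simp: K_def)
      then show "\<exists>i. i \<in> K \<and> x \<in> J i \<and> (case i of (x, s) \<Rightarrow> \<bar>s - x\<bar>/2) < d"
        using s'(1) by (intro exI[of _ "(x, s)"]) (auto simp: J_def)
    qed auto
    have len: "measure lebesgue (J i) = \<bar>snd i - fst i\<bar>" for i
      by (auto simp: J_def min_def max_def split: prod.splits)
    have fin: "measure lebesgue (\<Union>i\<in>C'. J i) \<le> e" if C': "C' \<subseteq> C" "finite C'" for C'
    proof -
      define p where "p = (\<lambda>i. (fst i, J i)) ` C'"
      have CK: "i \<in> K" if "i \<in> C'" for i using that C' C(2) by blast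
      have inj: "inj_on (\<lambda>i. (fst i, J i)) C'"
      proof (rule inj_onI)
        fix i j assume "i \<in> C'" "j \<in> C'" and eq: "(fst i, J i) = (fst j, J j)"
        moreover have "J i \<noteq> {}" by (auto simp: J_def split: prod.splits)
        then have "\<not> disjnt (J i) (J j)" using eq by (simp add: disjnt_def)
        ultimately show "i = j" using C(3) C'(1) unfolding pairwise_def by blast
      qed
      have "p tagged_partial_division_of (cbox a b)"
        unfolding tagged_partial_division_of_def
      proof (intro conjI allI impI)
        show "finite p" using C'(2) by (simp add: p_def)
        fix x k assume "(x, k) \<in> p"
        then obtain i where i: "i \<in> C'" "x = fst i" "k = J i" by (auto simp: p_def)
        show "x \<in> k" using i by (auto simp: J_def split: prod.splits)
        show "k \<subseteq> cbox a b" using CK[OF i(1)] i by (auto simp: K_def)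
        show "\<exists>a b. k = cbox a b" using i by (auto simp: J_def split: prod.splits)
      next
        fix x1 k1 x2 k2
        assume "(x1, k1) \<in> p \<and> (x2, k2) \<in> p \<and> (x1, k1) \<noteq> (x2, k2)"
        then obtain i j where ij: "i \<in> C'" "j \<in> C'" "k1 = J i" "k2 = J j" "i \<noteq> j"
          by (auto simp: p_def)
        then have "disjnt k1 k2" using C(3) C'(1) unfolding pairwise_def by blast
        then show "interior k1 \<inter> interior k2 = {}"
          using interior_subset by (fastforce simp: disjnt_def)
      qed
      moreover have "\<gamma> fine p"
        unfolding fine_def using CK by (fastforce simp: p_def K_def)
      ultimately have "(\<Sum>(x, K)\<in>p. norm (measure lborel K *\<^sub>R f x - integral K f)) < e'"
        by (rule \<gamma>(2))
      also have "(\<Sum>(x, K)\<in>p. norm (measure lborel K *\<^sub>R f x - integral K f))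
          = (\<Sum>i\<in>C'. norm (measure lborel (J i) *\<^sub>R f (fst i) - integral (J i) f))"
        unfolding p_def by (subst sum.reindex[OF inj]) (simp add: o_def)
      also have "\<dots> = (\<Sum>i\<in>C'. \<bar>F (snd i) - F (fst i) - (snd i - fst i) * f (fst i)\<bar>)"
      proof (rule sum.cong[OF refl])
        fix i assume "i \<in> C'"
        then have "i \<in> K" using CK by blast
        obtain x s where xs: "i = (x, s)" by force
        have sub: "{min x s..max x s} \<subseteq> {a..b}" "x \<noteq> s"
          using \<open>i \<in> K\<close> by (auto simp: K_def J_def xs)
        show "norm (measure lborel (J i) *\<^sub>R f (fst i) - integral (J i) f)
            = \<bar>F (snd i) - F (fst i) - (snd i - fst i) * f (fst i)\<bar>"
        proof (cases "x \<le> s")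
          case True
          then have "F s - F x = integral {x..s} f" using sub by (intro diff) auto
          then show ?thesis using True by (simp add: xs J_def)
        next
          case False
          then have "F x - F s = integral {s..x} f" using sub by (intro diff) auto
          then have "F s - F x = - integral {s..x} f" by simp
          then show ?thesis using False by (simp add: xs J_def abs_minus_commute algebra_simps)
        qed
      qed
      finally have *: "(\<Sum>i\<in>C'. \<bar>F (snd i) - F (fst i) - (snd i - fst i) * f (fst i)\<bar>) < e'" .
      have "measure lebesgue (\<Union>i\<in>C'. J i) \<le> (\<Sum>i\<in>C'. measure lebesgue (J i))"
        using C'(2) by (intro measure_UNION_le) (auto simp: J_def split: prod.splits)
      also have "\<dots> \<le> (\<Sum>i\<in>C'. (real k + 1) * \<bar>F (snd i) - F (fst i) - (snd i - fst i) * f (fst i)\<bar>)"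
        unfolding len using CK by (intro sum_mono) (force simp: K_def)
      also have "\<dots> \<le> (real k + 1) * e'"
        using * by (simp add: sum_distrib_left[symmetric])
      finally show ?thesis by (simp add: e'_def)
    qed
    have Jm: "J i \<in> lmeasurable" for i by (auto simp: J_def split: prod.splits)
    have T: "(\<Union>i\<in>C. J i) \<in> lmeasurable" "measure lebesgue (\<Union>i\<in>C. J i) \<le> e"
      using fmeasurable_UN_bound[OF C(1) Jm fin] measure_UN_bound[OF C(1) Jm fin] by blast+
    let ?N = "E k - (\<Union>i\<in>C. J i)"
    have N: "?N \<in> lmeasurable" "measure lebesgue ?N = 0"
      using C(4) negligible_imp_measurable negligible_imp_measure0 by blast+
    show "\<exists>T. E k \<subseteq> T \<and> T \<in> lmeasurable \<and> measure lebesgue T \<le> e"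
    proof (intro exI conjI)
      show "E k \<subseteq> (\<Union>i\<in>C. J i) \<union> ?N" by blast
      show "(\<Union>i\<in>C. J i) \<union> ?N \<in> lmeasurable" using T N by (intro fmeasurable.Un) auto
      show "measure lebesgue ((\<Union>i\<in>C. J i) \<union> ?N) \<le> e"
        using measure_Un_le[of "\<Union>i\<in>C. J i" lebesgue ?N] T N by (auto simp: fmeasurableD)
    qed
  qed
  have "negligible (\<Union>k. E k)" using neg by (intro negligible_countable_Union) auto
  then have null: "(\<Union>k. E k) \<in> null_sets lebesgue" by (simp add: negligible_iff_null_sets)
  show ?thesis
  proof (rule AE_I'[OF null], rule subsetI, rule ccontr)
    fix t assume t: "t \<in> {t \<in> space lebesgue. \<not> (t \<in> {a<..<b} \<longrightarrow>
        ((\<lambda>x. integral {a..x} f) has_vector_derivative f t) (at t))}" "t \<notin> (\<Union>k. E k)"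
    have "(F has_vector_derivative f t) (at t)"
      unfolding has_vector_derivative_at_iff_eventually
    proof (intro allI impI)
      fix \<kappa> :: real assume "\<kappa> > 0"
      then obtain k :: nat where k: "1 / \<kappa> < real k + 1"
        using reals_Archimedean2[of "1/\<kappa>"] by (metis add.commute less_add_one order_less_trans)
      from t have "t \<notin> E k" "t \<in> {a<..<b}" by auto
      then obtain d where d: "d > 0" "\<And>s. s \<noteq> t \<Longrightarrow> \<bar>s - t\<bar> < d \<Longrightarrow>
          (real k + 1) * \<bar>F s - F t - (s - t) * f t\<bar> \<le> \<bar>s - t\<bar>"
        unfolding E_def by (simp add: not_less) (metis not_less)
      show "\<forall>\<^sub>F s in at t. norm (F s - F t - (s - t) *\<^sub>R f t) \<le> \<kappa> * \<bar>s - t\<bar>"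
        unfolding eventually_at
      proof (intro exI[of _ d] conjI ballI impI d(1))
        fix s assume "s \<noteq> t \<and> dist s t < d"
        then have *: "(real k + 1) * \<bar>F s - F t - (s - t) * f t\<bar> \<le> \<bar>s - t\<bar>"
          using d(2) by (simp add: dist_real_def)
        have "1 \<le> \<kappa> * (real k + 1)" using k \<open>\<kappa> > 0\<close> by (simp add: field_simps)
        then have "\<bar>F s - F t - (s - t) * f t\<bar> \<le> \<kappa> * (real k + 1) * \<bar>F s - F t - (s - t) * f t\<bar>"
          by (metis abs_ge_zero mult.commute mult.right_neutral mult_left_mono)
        also have "\<dots> \<le> \<kappa> * \<bar>s - t\<bar>" using * \<open>\<kappa> > 0\<close> by (simp add: mult.assoc)
        finally show "norm (F s - F t - (s - t) *\<^sub>R f t) \<le> \<kappa> * \<bar>s - t\<bar>" by simp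
      qed
    qed
    then show False using t(1) by (simp add: F_def[abs_def])
  qed
qed

text \<open>
  Induction on the number of intervals, splitting off the rightmost one.
\<close>

lemma sum_increments_le:
  fixes R :: "real \<Rightarrow> real"
  assumes "mono_on {a..b} R" "a \<le> b" "interval_family {a..b} P"
  shows "(\<Sum>(c, d)\<in>P. R d - R c) \<le> R b - R a"
  using assms
proof (induction "card P" arbitrary: b P)
  case 0
  then have "P = {}" by (simp add: interval_family_def)
  then show ?case using 0 by (auto dest: mono_onD)
next
  case (Suc n)
  have fin: "finite P" using Suc.prems by (simp add: interval_family_def)
  then have "Max (fst ` P) \<in> fst ` P" using Suc(2) by (intro Max_in) auto
  then obtain c d where cd: "(c, d) \<in> P" "c = Max (fst ` P)" by auto
  have max: "c' \<le> c" if "(c', d') \<in> P" for c' d'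
    unfolding cd(2) using that fin by (intro Max_ge) force+
  have cd': "c < d" "a \<le> c" "d \<le> b"
  proof -
    have "c < d \<and> {c..d} \<subseteq> {a..b}" using Suc.prems(3) cd(1) by (auto simp: interval_family_def)
    then show "c < d" "a \<le> c" "d \<le> b" by auto
  qed
  have left: "{c'..d'} \<subseteq> {a..c}" "c' < d'" if p: "(c', d') \<in> P - {(c, d)}" for c' d'
  proof -
    have *: "c' < d'" "{c'..d'} \<subseteq> {a..b}"
      using Suc.prems(3) p by (auto simp: interval_family_def)
    then have le: "c' \<le> c" using max p by blast
    have "pairwise (\<lambda>(a, b) (a', b'). disjnt {a<..<b} {a'<..<b'}) P"
      using Suc.prems(3) by (simp add: interval_family_def)
    from pairwiseD[OF this, of "(c', d')" "(c, d)"] have "disjnt {c'<..<d'} {c<..<d}"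
      using p cd(1) by auto
    then have "(c + min d' d) / 2 \<notin> {c'<..<d'} \<inter> {c<..<d}"
      by (simp add: disjnt_def)
    then have "d' \<le> c" using le *(1) cd' by (auto simp: min_def split: if_splits)
    then show "{c'..d'} \<subseteq> {a..c}" "c' < d'" using * by auto
  qed
  have "interval_family {a..c} (P - {(c, d)})"
    using left Suc.prems(3) unfolding interval_family_def
    by (auto intro: pairwise_subset)
  moreover have "n = card (P - {(c, d)})" using Suc(2) cd(1) fin by simp
  moreover have "mono_on {a..c} R"
    using Suc.prems(1) cd' by (auto intro: mono_on_subset)
  ultimately have IH: "(\<Sum>(c, d)\<in>P - {(c, d)}. R d - R c) \<le> R c - R a"
    using Suc(1) cd' by blast
  have "R d \<le> R b" using cd' by (intro mono_onD[OF Suc.prems(1)]) auto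
  then show ?case using IH cd(1) fin by (simp add: sum.remove[of P "(c, d)"])
qed

text \<open>
  Truncate \<open>f\<close> at height \<open>n\<close>: the truncation has a Lipschitz primitive, and the remainder has a
  nondecreasing primitive whose total increase is small for large \<open>n\<close> by dominated convergence.
\<close>

lemma abs_continuous_on_primitive:
  fixes f :: "real \<Rightarrow> real"
  assumes f: "f integrable_on {a..b}" and nonneg: "\<And>x. x \<in> {a..b} \<Longrightarrow> 0 \<le> f x" and ab: "a \<le> b"
  shows "abs_continuous_on {a..b} (\<lambda>x. integral {a..x} f)"
  unfolding abs_continuous_on_alt
proof (intro allI impI)
  fix e :: real assume "e > 0"
  define g where "g n x = min (f x) (real n)" for n x
  have g: "g n integrable_on {a..b}" for n
    using absolutely_integrable_min_1[of "{a..b}" f "\<lambda>_. real n"]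
      nonnegative_absolutely_integrable_1[OF f nonneg] f
    by (auto simp: g_def[abs_def] absolutely_integrable_on_def)
  have "(\<lambda>n. integral {a..b} (g n)) \<longlonglongrightarrow> integral {a..b} f"
  proof (rule dominated_convergence(2)[OF g f])
    show "norm (g n x) \<le> f x" if "x \<in> {a..b}" for n x
      using nonneg[OF that] by (simp add: g_def)
    show "(\<lambda>n. g n x) \<longlonglongrightarrow> f x" if "x \<in> {a..b}" for x
    proof (rule tendsto_eventually)
      obtain N :: nat where "f x \<le> real N" using real_arch_simple by blast
      then show "\<forall>\<^sub>F n in sequentially. g n x = f x"
        unfolding eventually_sequentially by (intro exI[of _ N]) (auto simp: g_def)
    qed
  qed
  then have "\<forall>\<^sub>F n in sequentially. dist (integral {a..b} (g n)) (integral {a..b} f) < e/2"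
    using \<open>e > 0\<close> by (intro tendstoD) auto
  then obtain n where n: "dist (integral {a..b} (g n)) (integral {a..b} f) < e/2"
    using eventually_happens'[OF sequentially_bot] by blast
  define r where "r x = f x - g n x" for x
  have r: "r integrable_on {a..b}" unfolding r_def[abs_def] by (intro integrable_diff f g)
  have r0: "0 \<le> r x" for x by (simp add: r_def g_def)
  define R where "R x = integral {a..x} r" for x
  have sub: "h integrable_on {u..v}" if "h integrable_on {a..b}" "a \<le> u" "v \<le> b" for h :: "real \<Rightarrow> real" and u v
    using integrable_on_subinterval[OF that(1)] that by auto
  have comb: "integral {a..v} h - integral {a..u} h = integral {u..v} h"
    if "h integrable_on {a..b}" "a \<le> u" "u \<le> v" "v \<le> b" for h :: "real \<Rightarrow> real" and u v
    using Henstock_Kurzweil_Integration.integral_combine[OF that(2,3) sub[OF that(1) order_refl that(4)]] by simp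
  have monoR: "mono_on {a..b} R"
  proof (rule mono_onI)
    fix u v assume uv: "u \<in> {a..b}" "v \<in> {a..b}" "u \<le> v"
    then have "R v - R u = integral {u..v} r" unfolding R_def by (intro comb[OF r]) auto
    moreover have "0 \<le> integral {u..v} r" using uv r0 by (intro integral_nonneg sub[OF r]) auto
    ultimately show "R u \<le> R v" by simp
  qed
  have incr: "norm (integral {a..v} f - integral {a..u} f) \<le> R v - R u + real n * (v - u)"
    if "u < v" "{u..v} \<subseteq> {a..b}" for u v
  proof -
    have uv: "a \<le> u" "u \<le> v" "v \<le> b" using that by auto
    have "0 \<le> integral {u..v} f" using uv nonneg by (intro integral_nonneg sub[OF f]) auto
    moreover have "integral {u..v} f = integral {u..v} r + integral {u..v} (g n)"
      using integral_add[OF sub[OF r] sub[OF g], OF uv(1,3) uv(1,3), of n] by (simp add: r_def)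
    moreover have "integral {u..v} (g n) \<le> integral {u..v} (\<lambda>_. real n)"
      using uv by (intro integral_le sub[OF g]) (auto simp: g_def)
    moreover have "R v - R u = integral {u..v} r" unfolding R_def by (rule comb[OF r uv])
    ultimately show ?thesis using comb[OF f uv] uv by (simp add: mult.commute)
  qed
  define d where "d = e / (2 * (real n + 1))"
  have "d > 0" using \<open>e > 0\<close> by (simp add: d_def)
  have "(\<Sum>(u, v)\<in>P. norm (integral {a..v} f - integral {a..u} f)) < e"
    if P: "interval_family {a..b} P" "(\<Sum>(u, v)\<in>P. v - u) < d" for P
  proof -
    have "(\<Sum>(u, v)\<in>P. norm (integral {a..v} f - integral {a..u} f))
        \<le> (\<Sum>(u, v)\<in>P. R v - R u + real n * (v - u))"
      using P(1) incr by (intro sum_mono) (auto simp: interval_family_def)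
    also have "\<dots> = (\<Sum>(u, v)\<in>P. R v - R u) + real n * (\<Sum>(u, v)\<in>P. v - u)"
      by (simp add: case_prod_beta sum.distrib sum_distrib_left)
    also have "\<dots> \<le> (R b - R a) + real n * d"
      using sum_increments_le[OF monoR ab P(1)] P(2) by (intro add_mono mult_left_mono) auto
    also have "R b - R a = integral {a..b} f - integral {a..b} (g n)"
      unfolding R_def r_def[abs_def] using f g by (simp add: integral_diff)
    also have "\<dots> < e/2" using n by (simp add: dist_real_def abs_if split: if_splits)
    also have "real n * d \<le> e/2" using \<open>e > 0\<close> by (simp add: d_def field_simps)
    finally show ?thesis by simp
  qed
  then show "\<exists>d>0. \<forall>P. interval_family {a..b} P \<and> (\<Sum>(u, v)\<in>P. v - u) < d \<longrightarrow>
      (\<Sum>(u, v)\<in>P. norm (integral {a..v} f - integral {a..u} f)) < e"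
    using \<open>d > 0\<close> by blast
qed

text \<open>
  Extended by constants, \<open>F\<close> is the distribution function of a Stieltjes measure. Absolute continuity of
  \<open>F\<close> says that this measure vanishes on Lebesgue null sets, so by the Radon-Nikodym theorem \<open>F\<close> is the
  integral of a density, and integrals are differentiable almost everywhere.
\<close>

lemma AE_differentiable_mono_abs_continuous:
  fixes F :: "real \<Rightarrow> real"
  assumes ac: "abs_continuous_on {a..b} F" and mono: "mono_on {a..b} F" and ab: "a < b"
  shows "AE t in lebesgue. t \<in> {a<..<b} \<longrightarrow> F differentiable (at t)"
proof -
  define c where "c x = max a (min b x)" for x
  define G where "G x = F (c x)" for x
  have c: "c x \<in> {a..b}" "x \<le> y \<Longrightarrow> c x \<le> c y" for x y using ab by (auto simp: c_def)
  have G: "G x \<le> G y" if "x \<le> y" for x y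
    unfolding G_def using that c by (intro mono_onD[OF mono])
  have GF: "G x = F x" if "x \<in> {a..b}" for x using that by (simp add: G_def c_def)
  have "continuous_on UNIV G"
    unfolding G_def[abs_def]
  proof (rule continuous_on_compose2[of "{a..b}" F])
    show "continuous_on {a..b} F"
      by (rule abs_continuous_on_imp_continuous_on[OF ac]) (simp add: is_interval_cc)
    show "continuous_on UNIV c" unfolding c_def[abs_def] by (intro continuous_intros)
  qed (use c in auto)
  then have cont: "continuous (at_right x) G" for x
    using continuous_on_eq_continuous_at[of UNIV G] continuous_at_imp_continuous_at_within by auto
  define \<mu> where "\<mu> = interval_measure G"
  have \<mu>: "emeasure \<mu> {x<..y} = ennreal (G y - G x)" if "x \<le> y" for x y
    unfolding \<mu>_def using emeasure_interval_measure_Ioc[OF that, of G] G cont by blast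
  have sets: "sets \<mu> = sets borel" by (simp add: \<mu>_def)
  have "absolutely_continuous lborel \<mu>"
    unfolding absolutely_continuous_def
  proof
    fix N :: "real set" assume N: "N \<in> null_sets lborel"
    then have Nb: "N \<in> sets borel" by auto
    \<comment> \<open>\<open>G\<close> is constant outside \<open>{a..b}\<close>\<close>
    have "{..a} \<union> {b<..} \<in> null_sets \<mu>"
    proof -
      have "{a - real n<..a} \<in> null_sets \<mu>" "{b<..b + real n} \<in> null_sets \<mu>" for n
        using ab by (auto simp: null_sets_def sets \<mu> G_def c_def)
      then have "(\<Union>n. {a - real n<..a}) \<union> (\<Union>n. {b<..b + real n}) \<in> null_sets \<mu>"
        by (intro null_sets.Un null_sets_UN)
      moreover have "(\<Union>n. {a - real n<..a}) = {..a}"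
      proof safe
        fix x assume "x \<le> a"
        obtain n :: nat where "a - x < real n" using reals_Archimedean2 by blast
        then show "x \<in> (\<Union>n. {a - real n<..a})" using \<open>x \<le> a\<close> by (auto intro!: exI[of _ n])
      qed auto
      moreover have "(\<Union>n. {b<..b + real n}) = {b<..}"
      proof safe
        fix x assume "x > b"
        obtain n :: nat where "x - b < real n" using reals_Archimedean2 by blast
        then show "x \<in> (\<Union>n. {b<..b + real n})" using \<open>x > b\<close> by (auto intro!: exI[of _ n])
      qed auto
      ultimately show ?thesis by simp
    qed
    moreover have "N \<inter> {a<..b} \<in> null_sets \<mu>"
    proof -
      have small: "emeasure \<mu> (N \<inter> {a<..b}) \<le> ennreal e" if "e > 0" for e
      proof -
        obtain d where d: "d > 0" "\<And>P. interval_family {a..b} P \<Longrightarrow> (\<Sum>(c, d)\<in>P. d - c) < d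
            \<Longrightarrow> (\<Sum>(c, d)\<in>P. norm (F d - F c)) < e"
          using ac \<open>e > 0\<close> unfolding abs_continuous_on_alt by blast
        have "N \<in> null_sets lebesgue" using N by (simp add: null_sets_completionI)
        then obtain U where U: "open U" "N \<subseteq> U" "U \<in> lmeasurable" "measure lebesgue U < d"
          by (rule null_set_small_open_cover[OF _ d(1)])
        have g1: "gauge (\<lambda>x. if x \<in> U then U else UNIV)" using U(1) by (simp add: gauge_def)
        have g2: "N \<inter> {a<..b} \<subseteq> cbox a b" "box a b \<noteq> {}" using ab by auto
        obtain \<D> where D: "countable \<D>" "\<Union>\<D> \<subseteq> cbox a b"
          "\<And>K. K \<in> \<D> \<Longrightarrow> interior K \<noteq> {} \<and> (\<exists>c d. K = cbox c d)"
          "pairwise (\<lambda>A B. interior A \<inter> interior B = {}) \<D>"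
          "\<And>K. K \<in> \<D> \<Longrightarrow> \<exists>x \<in> N \<inter> {a<..b} \<inter> K. K \<subseteq> (if x \<in> U then U else UNIV)"
          "N \<inter> {a<..b} \<subseteq> \<Union>\<D>"
          by (rule covering_lemma[OF g2 g1], rule that) (assumption | blast)+
        define E where "E K = (Inf K, Sup K)" for K :: "real set"
        have K: "K = {fst (E K)..snd (E K)}" "fst (E K) < snd (E K)" "K \<subseteq> U" "K \<subseteq> {a..b}"
          if "K \<in> \<D>" for K
        proof -
          obtain c d where cd: "K = {c..d}" "interior K \<noteq> {}" using D(3)[OF \<open>K \<in> \<D>\<close>] by auto
          then have "c < d" by auto
          then show "K = {fst (E K)..snd (E K)}" "fst (E K) < snd (E K)" using cd by (auto simp: E_def)
          obtain x where "x \<in> N" "K \<subseteq> (if x \<in> U then U else UNIV)"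
            using D(5)[OF \<open>K \<in> \<D>\<close>] by blast
          moreover have "x \<in> U" using U(2) \<open>x \<in> N\<close> by blast
          ultimately show "K \<subseteq> U" by simp
          show "K \<subseteq> {a..b}" using D(2) that by auto
        qed
        have fin: "(\<Sum>K\<in>\<C>. emeasure \<mu> K) \<le> ennreal e" if C: "\<C> \<subseteq> \<D>" "finite \<C>" for \<C>
        proof -
          have CD: "K \<in> \<D>" if "K \<in> \<C>" for K using C that by blast
          have inj: "inj_on E \<C>" using K(1) CD by (metis inj_onI)
          have fam: "interval_family {a..b} (E ` \<C>)"
            unfolding interval_family_def
          proof (intro conjI)
            show "finite (E ` \<C>)" using C by simp
            show "\<forall>(c, d)\<in>E ` \<C>. c < d \<and> {c..d} \<subseteq> {a..b}"
              using K(1,2,4)[OF CD] by (metis (no_types, lifting) case_prod_beta imageE)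
            have "disjnt {fst (E K)<..<snd (E K)} {fst (E L)<..<snd (E L)}"
              if "K \<in> \<C>" "L \<in> \<C>" "K \<noteq> L" for K L
            proof -
              have "interior K \<inter> interior L = {}"
                using D(4) CD that unfolding pairwise_def by blast
              then show ?thesis
                using K(1)[OF CD[OF that(1)]] K(1)[OF CD[OF that(2)]]
                by (metis disjnt_def interior_atLeastAtMost_real)
            qed
            then show "pairwise (\<lambda>(a, b) (a', b'). disjnt {a<..<b} {a'<..<b'}) (E ` \<C>)"
              by (fastforce simp: pairwise_def split_beta)
          qed
          have mK: "emeasure \<mu> K = ennreal (norm (F (snd (E K)) - F (fst (E K))))" if "K \<in> \<C>" for K
          proof -
            let ?c = "fst (E K)" and ?d = "snd (E K)"
            have cd: "?c < ?d" "{?c..?d} \<subseteq> {a..b}" using K[OF CD[OF that]] by auto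
            have "emeasure \<mu> {?c..?d} = ennreal (G ?d - G ?c)"
              unfolding \<mu>_def using cd G \<open>continuous_on UNIV G\<close>
              by (intro emeasure_interval_measure_Icc) auto
            also have "G ?d - G ?c = norm (F ?d - F ?c)"
              using cd GF G[of ?c ?d] by auto
            finally show ?thesis using K(1)[OF CD[OF that]] by simp
          qed
          have "{c<..<d} \<subseteq> U" if "(c, d) \<in> E ` \<C>" for c d
          proof -
            obtain L where L: "L \<in> \<C>" "(c, d) = E L" using \<open>(c, d) \<in> E ` \<C>\<close> by blast
            then have "L = {c..d}" "L \<subseteq> U" using K(1,3)[OF CD[OF L(1)]] by (metis fst_conv snd_conv)+
            then show ?thesis by auto
          qed
          from interval_family_length_le_measure[OF fam U(3) this]
          have "(\<Sum>p\<in>E ` \<C>. snd p - fst p) \<le> measure lebesgue U"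
            by (simp add: case_prod_beta)
          then have "(\<Sum>(c, d)\<in>E ` \<C>. norm (F d - F c)) < e"
            using U(4) by (intro d(2) fam) (simp add: case_prod_beta)
          then have "(\<Sum>K\<in>\<C>. norm (F (snd (E K)) - F (fst (E K)))) < e"
            by (simp add: sum.reindex[OF inj] case_prod_beta)
          moreover have "(\<Sum>K\<in>\<C>. emeasure \<mu> K) = ennreal (\<Sum>K\<in>\<C>. norm (F (snd (E K)) - F (fst (E K))))"
            using mK by (subst sum_ennreal[symmetric]) auto
          ultimately show ?thesis by (simp add: ennreal_leI)
        qed
        have Dsets: "K \<in> sets \<mu>" if "K \<in> \<D>" for K using K(1)[OF that] sets by (metis atLeastAtMost_borel)
        have "emeasure \<mu> (N \<inter> {a<..b}) \<le> emeasure \<mu> (\<Union>\<D>)"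
          using D(1,6) Dsets by (intro emeasure_mono sets.countable_Union) auto
        also have "\<dots> \<le> ennreal e"
        proof (cases "\<D> = {}")
          case False
          define A where "A = from_nat_into \<D>"
          have A: "A n \<in> \<D>" for n unfolding A_def by (rule from_nat_into[OF False])
          have "\<Union>\<D> = (\<Union>n. A n)" unfolding A_def using D(1) False by (simp add: range_from_nat_into)
          moreover have "(\<Union>n. A n) = (\<Union>n. \<Union>i<n. A i)" by (auto intro: lessI)
          moreover have "incseq (\<lambda>n. \<Union>i<n. A i)"
            unfolding incseq_def by (intro allI impI UN_mono) auto
          then have "emeasure \<mu> (\<Union>n. \<Union>i<n. A i) = (SUP n. emeasure \<mu> (\<Union>i<n. A i))"
            by (intro SUP_emeasure_incseq[symmetric]) (use A Dsets in \<open>auto intro!: sets.finite_UN\<close>)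
          moreover have "emeasure \<mu> (\<Union>i<n. A i) \<le> ennreal e" for n
          proof -
            have "(\<Union>i<n. A i) = (\<Union>K\<in>A ` {..<n}. K)" by auto
            also have "emeasure \<mu> \<dots> \<le> (\<Sum>K\<in>A ` {..<n}. emeasure \<mu> K)"
              using A Dsets by (intro emeasure_subadditive_finite) auto
            also have "\<dots> \<le> ennreal e" using A by (intro fin) auto
            finally show ?thesis .
          qed
          ultimately show ?thesis by (simp add: SUP_le_iff)
        qed simp
        finally show ?thesis .
      qed
      have "emeasure \<mu> (N \<inter> {a<..b}) \<le> 0"
        by (rule ennreal_le_epsilon) (simp add: small)
      then show ?thesis using Nb by (auto simp: null_sets_def sets)
    qed
    ultimately have "({..a} \<union> {b<..}) \<union> (N \<inter> {a<..b}) \<in> null_sets \<mu>" by (rule null_sets.Un)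
    then show "N \<in> null_sets \<mu>"
      by (rule null_sets_subset) (use Nb sets in auto)
  qed
  then obtain f where f: "f \<in> borel_measurable lborel" "density lborel f = \<mu>"
    using sigma_finite_measure.Radon_Nikodym[OF lborel.sigma_finite_measure_axioms, of \<mu>] sets by auto
  have int: "(\<integral>\<^sup>+x. f x * indicator {a<..x'} x \<partial>lborel) = ennreal (F x' - F a)" if "x' \<in> {a..b}" for x'
  proof -
    have "emeasure \<mu> {a<..x'} = (\<integral>\<^sup>+x. f x * indicator {a<..x'} x \<partial>lborel)"
      unfolding f(2)[symmetric] using f(1) by (intro emeasure_density) auto
    then show ?thesis using \<mu>[of a x'] GF[of a] GF[OF that] that ab by auto
  qed
  have "AE x in lborel. f x * indicator {a<..b} x \<noteq> \<infinity>"
    using f(1) int[of b] ab by (intro nn_integral_noteq_infinite) auto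
  then have ae: "AE x in lborel. x \<in> {a<..b} \<longrightarrow> f x = ennreal (enn2real (f x))"
    by (rule eventually_mono) (auto simp: indicator_def less_top)
  have hi: "((\<lambda>x. enn2real (f x)) has_integral (F x' - F a)) {a..x'}" if x': "x' \<in> {a..b}" for x'
  proof -
    let ?g = "\<lambda>x. indicator {a<..x'} x * enn2real (f x)"
    have "(\<integral>\<^sup>+x. ennreal (?g x) \<partial>lborel) = (\<integral>\<^sup>+x. f x * indicator {a<..x'} x \<partial>lborel)"
      using ae by (intro nn_integral_cong_AE, elim eventually_mono) (use x' in \<open>auto simp: indicator_def\<close>)
    then have "(?g has_integral (F x' - F a)) UNIV"
      using f(1) int[OF x'] mono_onD[OF mono, of a x'] x' ab
      by (intro nn_integral_has_integral) auto
    moreover have "?g = (\<lambda>x. if x \<in> {a<..x'} then enn2real (f x) else 0)"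
      by (auto simp: indicator_def)
    ultimately have "((\<lambda>x. if x \<in> {a<..x'} then enn2real (f x) else 0) has_integral (F x' - F a)) UNIV"
      by (simp only:)
    then have "((\<lambda>x. enn2real (f x)) has_integral (F x' - F a)) {a<..x'}"
      by (simp only: has_integral_restrict_UNIV)
    moreover have n1: "negligible {x \<in> {a<..x'} - {a..x'}. enn2real (f x) \<noteq> 0}"
      and n2: "negligible {x \<in> {a..x'} - {a<..x'}. enn2real (f x) \<noteq> 0}"
      by (rule negligible_subset[OF negligible_sing[of a]], force)+
    ultimately show ?thesis using has_integral_spike_set_eq[OF n1 n2] by blast
  qed
  have F: "F x = F a + integral {a..x} (\<lambda>x. enn2real (f x))" if "x \<in> {a..b}" for x
    using integral_unique[OF hi[OF that]] by simp
  have "(\<lambda>x. enn2real (f x)) integrable_on {a..b}" using hi[of b] ab by auto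
  from AE_primitive_has_derivative[OF this] show ?thesis
  proof (rule eventually_mono, intro impI)
    fix t assume "t \<in> {a<..<b} \<longrightarrow> ((\<lambda>x. integral {a..x} (\<lambda>x. enn2real (f x))) has_vector_derivative
        enn2real (f t)) (at t)" "t \<in> {a<..<b}"
    then have "((\<lambda>x. F a + integral {a..x} (\<lambda>x. enn2real (f x))) has_vector_derivative
        (0 + enn2real (f t))) (at t)"
      by (intro has_vector_derivative_add has_vector_derivative_const) auto
    then have "(F has_vector_derivative (0 + enn2real (f t))) (at t)"
    proof (rule has_vector_derivative_transform_within_open[where S = "{a<..<b}"])
      show "F a + integral {a..x} (\<lambda>x. enn2real (f x)) = F x" if "x \<in> {a<..<b}" for x
        using F[of x] that by simp
    qed (use \<open>t \<in> {a<..<b}\<close> in auto)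
    then show "F differentiable (at t)" by (rule differentiableI_vector)
  qed
qed

section \<open>Primitives of vector-valued functions\<close>

text \<open>
  This takes the place of the vector-valued integral: it requires no integration theory in the
  range of \<open>g\<close>.
\<close>

definition primitive_on :: "real \<Rightarrow> (real \<Rightarrow> 'a::real_normed_vector) \<Rightarrow> (real \<Rightarrow> 'a) \<Rightarrow> bool" where
  "primitive_on b g G \<longleftrightarrow> abs_continuous_on {0..b} G \<and>
     (AE t in lebesgue. t \<in> {0<..<b} \<longrightarrow> (G has_vector_derivative g t) (at t))"

lemma primitive_on_cong:
  assumes "primitive_on b g G" "\<And>t. t \<in> {0<..<b} \<Longrightarrow> g t = h t"
  shows "primitive_on b h G"
  using assms(1) unfolding primitive_on_def
  by (auto elim!: eventually_mono simp: assms(2))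

lemma primitive_on_add:
  assumes "primitive_on b g G" "primitive_on b h H"
  shows "primitive_on b (\<lambda>t. g t + h t) (\<lambda>t. G t + H t)"
proof -
  have "AE t in lebesgue. t \<in> {0<..<b} \<longrightarrow> ((\<lambda>t. G t + H t) has_vector_derivative (g t + h t)) (at t)"
    using assms[unfolded primitive_on_def, THEN conjunct2]
    by eventually_elim (blast intro: has_vector_derivative_add)
  then show ?thesis
    using assms by (auto simp: primitive_on_def intro: abs_continuous_on_add)
qed

lemma primitive_on_diff:
  assumes "primitive_on b g G" "primitive_on b h H"
  shows "primitive_on b (\<lambda>t. g t - h t) (\<lambda>t. G t - H t)"
proof -
  have "AE t in lebesgue. t \<in> {0<..<b} \<longrightarrow> ((\<lambda>t. G t - H t) has_vector_derivative (g t - h t)) (at t)"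
    using assms[unfolded primitive_on_def, THEN conjunct2]
    by eventually_elim (blast intro: has_vector_derivative_diff)
  then show ?thesis
    using assms by (auto simp: primitive_on_def intro: abs_continuous_on_diff)
qed

lemma primitive_on_const: "primitive_on b (\<lambda>t. c) (\<lambda>t. t *\<^sub>R c)"
proof -
  have "abs_continuous_on {0..b} (\<lambda>t. t *\<^sub>R c)"
    by (rule abs_continuous_on_lipschitz[of "norm c"])
       (auto simp: scaleR_left_diff_distrib[symmetric] mult.commute)
  then show ?thesis
    by (auto simp: primitive_on_def intro!: always_eventually derivative_eq_intros)
qed

lemma primitive_on_zero: "primitive_on b (\<lambda>t. 0) (\<lambda>t. 0)"
  using primitive_on_const[of b 0] by simp

lemma primitive_on_scaleR:
  assumes "primitive_on b h H"
  shows "primitive_on b (\<lambda>t. h t *\<^sub>R v) (\<lambda>t. H t *\<^sub>R v)"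
proof -
  have "abs_continuous_on {0..b} (\<lambda>t. H t *\<^sub>R v)"
    by (rule abs_continuous_on_dominated1[of _ H "norm v"])
       (use assms in \<open>auto simp: primitive_on_def scaleR_left_diff_distrib[symmetric] mult.commute\<close>)
  moreover have "AE t in lebesgue. t \<in> {0<..<b} \<longrightarrow> ((\<lambda>t. H t *\<^sub>R v) has_vector_derivative (h t *\<^sub>R v)) (at t)"
    using assms[unfolded primitive_on_def, THEN conjunct2]
    by eventually_elim (auto intro!: derivative_eq_intros simp: has_real_derivative_iff_has_vector_derivative)
  ultimately show ?thesis by (simp add: primitive_on_def)
qed

lemma has_primitive_sum:
  assumes "finite I" "\<And>i. i \<in> I \<Longrightarrow> \<exists>G. primitive_on b (g i) G"
  shows "\<exists>G. primitive_on b (\<lambda>t. \<Sum>i\<in>I. g i t) G"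
  using assms
proof (induction I rule: finite_induct)
  case empty
  then show ?case using primitive_on_zero by auto
next
  case (insert i I)
  then obtain G H where "primitive_on b (g i) G" "primitive_on b (\<lambda>t. \<Sum>i\<in>I. g i t) H" by blast
  from primitive_on_add[OF this] show ?case using insert by auto
qed

text \<open>
  The primitive of the restriction to a subinterval is \<open>G\<close> composed with the clamping of \<open>t\<close> to that
  subinterval. Clamping does not lengthen intervals, but may degenerate them; the degenerate ones are
  discarded in the proof of absolute continuity.
\<close>

lemma primitive_on_restrict:
  assumes G: "primitive_on b g G" and cd: "0 \<le> c" "c \<le> d" "d \<le> b"
  shows "primitive_on b (\<lambda>t. if t \<in> {c..<d} then g t else 0) (\<lambda>t. G (max c (min d t)))"
proof -
  let ?cl = "\<lambda>t. max c (min d t)"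
  have "abs_continuous_on {0..b} (\<lambda>t. G (?cl t))"
    unfolding abs_continuous_on_alt
  proof (intro allI impI)
    fix e :: real assume "e > 0"
    then obtain \<delta> where \<delta>: "\<delta> > 0" "\<And>P. interval_family {0..b} P \<Longrightarrow> (\<Sum>(c, d)\<in>P. d - c) < \<delta>
      \<Longrightarrow> (\<Sum>(c, d)\<in>P. norm (G d - G c)) < e"
      using G unfolding primitive_on_def abs_continuous_on_alt by blast
    have "(\<Sum>(s, t)\<in>P. norm (G (?cl t) - G (?cl s))) < e"
      if P: "interval_family {0..b} P" "(\<Sum>(s, t)\<in>P. t - s) < \<delta>" for P
    proof -
      define P1 where "P1 = {p \<in> P. ?cl (fst p) < ?cl (snd p)}"
      define E where "E p = (?cl (fst p), ?cl (snd p))" for p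
      have fin: "finite P" and P': "\<And>p. p \<in> P \<Longrightarrow> fst p < snd p \<and> {fst p..snd p} \<subseteq> {0..b}"
        and dj: "\<And>p q. p \<in> P \<Longrightarrow> q \<in> P \<Longrightarrow> p \<noteq> q \<Longrightarrow> disjnt {fst p<..<snd p} {fst q<..<snd q}"
        using P(1) by (auto simp: interval_family_def pairwise_def split_beta)
      have sub: "{fst (E p)<..<snd (E p)} \<subseteq> {fst p<..<snd p}" for p
        by (auto simp: E_def)
      have djE: "disjnt {fst (E p)<..<snd (E p)} {fst (E q)<..<snd (E q)}"
        if "p \<in> P1" "q \<in> P1" "p \<noteq> q" for p q
      proof -
        have "disjnt {fst p<..<snd p} {fst q<..<snd q}" using that by (intro dj) (auto simp: P1_def)
        then show ?thesis by (meson disjnt_subset1 disjnt_subset2 sub)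
      qed
      have inj: "inj_on E P1"
      proof (rule inj_onI, rule ccontr)
        fix p q assume pq: "p \<in> P1" "q \<in> P1" "E p = E q" "p \<noteq> q"
        have "fst (E p) < snd (E p)" using pq(1) by (simp add: P1_def E_def)
        then have "(fst (E p) + snd (E p)) / 2 \<in> {fst (E p)<..<snd (E p)}" by simp
        then show False using djE[OF pq(1,2,4)] pq(3) by (auto simp: disjnt_def)
      qed
      have "interval_family {0..b} (E ` P1)"
        unfolding interval_family_def
      proof (intro conjI)
        show "finite (E ` P1)" using fin by (simp add: P1_def)
        show "\<forall>(s, t)\<in>E ` P1. s < t \<and> {s..t} \<subseteq> {0..b}"
          using cd by (auto simp: P1_def E_def)
        show "pairwise (\<lambda>(a, b) (a', b'). disjnt {a<..<b} {a'<..<b'}) (E ` P1)"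
          using djE by (auto simp: pairwise_def split_beta)
      qed
      moreover have "(\<Sum>p\<in>E ` P1. snd p - fst p) < \<delta>"
      proof -
        have "(\<Sum>p\<in>E ` P1. snd p - fst p) = (\<Sum>p\<in>P1. ?cl (snd p) - ?cl (fst p))"
          by (subst sum.reindex[OF inj]) (simp add: E_def)
        also have "\<dots> \<le> (\<Sum>p\<in>P1. snd p - fst p)"
          using P' by (intro sum_mono) (force simp: P1_def)
        also have "\<dots> \<le> (\<Sum>p\<in>P. snd p - fst p)"
          using fin P' by (intro sum_mono2) (auto simp: P1_def less_imp_le)
        finally show ?thesis using P(2) by (simp add: split_beta)
      qed
      ultimately have "(\<Sum>p\<in>E ` P1. norm (G (snd p) - G (fst p))) < e"
        using \<delta>(2)[of "E ` P1"] by (simp add: split_beta)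
      moreover have "(\<Sum>p\<in>P. norm (G (?cl (snd p)) - G (?cl (fst p))))
          = (\<Sum>p\<in>P1. norm (G (?cl (snd p)) - G (?cl (fst p))))"
      proof (rule sum.mono_neutral_right[OF fin])
        show "\<forall>p\<in>P - P1. norm (G (?cl (snd p)) - G (?cl (fst p))) = 0"
        proof
          fix p assume p: "p \<in> P - P1"
          then have "fst p < snd p" using P' by blast
          then have "?cl (fst p) \<le> ?cl (snd p)" by (intro max.mono min.mono) auto
          then have "?cl (fst p) = ?cl (snd p)" using p by (auto simp: P1_def)
          then show "norm (G (?cl (snd p)) - G (?cl (fst p))) = 0" by simp
        qed
      qed (simp add: P1_def)
      moreover have "(\<Sum>p\<in>E ` P1. norm (G (snd p) - G (fst p)))
          = (\<Sum>p\<in>P1. norm (G (?cl (snd p)) - G (?cl (fst p))))"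
        by (subst sum.reindex[OF inj]) (simp add: E_def)
      ultimately show ?thesis by (simp add: split_beta)
    qed
    then show "\<exists>\<delta>>0. \<forall>P. interval_family {0..b} P \<and> (\<Sum>(s, t)\<in>P. t - s) < \<delta> \<longrightarrow>
        (\<Sum>(s, t)\<in>P. norm (G (?cl t) - G (?cl s))) < e"
      using \<delta>(1) by blast
  qed
  moreover have "AE t in lebesgue. t \<in> {0<..<b} \<longrightarrow>
      ((\<lambda>t. G (?cl t)) has_vector_derivative (if t \<in> {c..<d} then g t else 0)) (at t)"
  proof -
    have "AE t in lebesgue. t \<noteq> c \<and> t \<noteq> d"
      by (intro AE_conjI AE_completion AE_lborel_singleton)
    with G[unfolded primitive_on_def, THEN conjunct2] show ?thesis
    proof (eventually_elim, intro impI)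
      fix t assume t: "t \<in> {0<..<b} \<longrightarrow> (G has_vector_derivative g t) (at t)"
        "t \<noteq> c \<and> t \<noteq> d" "t \<in> {0<..<b}"
      show "((\<lambda>t. G (?cl t)) has_vector_derivative (if t \<in> {c..<d} then g t else 0)) (at t)"
      proof (cases "t \<in> {c<..<d}")
        case True
        have "((\<lambda>t. G (?cl t)) has_vector_derivative g t) (at t)"
        proof (rule has_vector_derivative_transform_within_open[where S = "{c<..<d}" and f = G])
          show "(G has_vector_derivative g t) (at t)" using t by blast
        qed (use True in auto)
        then show ?thesis using True by simp
      next
        case False
        then consider "t < c" | "d < t" using t(2) by force
        then have "((\<lambda>t. G (?cl t)) has_vector_derivative 0) (at t)"
        proof cases
          case 1
          show ?thesis
            by (rule has_vector_derivative_transform_within_open[where S = "{..<c}" and f = "\<lambda>_. G c"])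
               (use 1 cd in auto)
        next
          case 2
          show ?thesis
            by (rule has_vector_derivative_transform_within_open[where S = "{d<..}" and f = "\<lambda>_. G d"])
               (use 2 cd in auto)
        qed
        then show ?thesis using False t(2) by auto
      qed
    qed
  qed
  ultimately show ?thesis by (simp add: primitive_on_def)
qed

lemma primitive_on_increment_le:
  assumes G: "primitive_on b g G" and R: "primitive_on b r R"
    and le: "AE t in lebesgue. t \<in> {0<..<b} \<longrightarrow> norm (g t) \<le> r t"
    and st: "0 \<le> s" "s \<le> t" "t \<le> b"
  shows "norm (G t - G s) \<le> R t - R s"
proof (rule norm_increment_le_abs_continuous)
  show "abs_continuous_on {s..t} G" "abs_continuous_on {s..t} R"
    using G R st by (auto simp: primitive_on_def intro: abs_continuous_on_subset)
  show "AE \<tau> in lebesgue. \<tau> \<in> {s<..<t} \<longrightarrow> (\<exists>w r. (G has_vector_derivative w) (at \<tau>) \<and>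
      (R has_vector_derivative r) (at \<tau>) \<and> norm w \<le> r)"
    using le G[unfolded primitive_on_def, THEN conjunct2] R[unfolded primitive_on_def, THEN conjunct2]
    by eventually_elim (use st in fastforce)
qed fact

text \<open>
  The differences \<open>Gn n - Gn m\<close> have increments bounded by those of \<open>Hn n + Hn m\<close>, so the \<open>Gn n\<close>,
  normalized at \<open>0\<close>, converge uniformly to some \<open>G\<close>, and \<open>G - Gn n\<close> has increments bounded by those of
  \<open>Hn n\<close>. At almost every \<open>t\<close> the difference quotients of \<open>G - Gn n\<close> are thus eventually not much larger
  than \<open>hn n t\<close>, which is small for large \<open>n\<close>. Bounding functions that depend on \<open>t\<close> make the lemma
  applicable to approximation in the mean.
\<close>

lemma has_primitive_limit:
  fixes g :: "real \<Rightarrow> 'a::{real_normed_vector, complete_space}"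
  assumes G: "\<And>n. primitive_on b (gn n) (Gn n)" and H: "\<And>n. primitive_on b (hn n) (Hn n)"
    and ae: "AE t in lebesgue. t \<in> {0<..<b} \<longrightarrow>
               (\<forall>n. norm (g t - gn n t) \<le> hn n t) \<and> (\<lambda>n. hn n t) \<longlonglongrightarrow> 0"
    and lim: "(\<lambda>n. Hn n b - Hn n 0) \<longlonglongrightarrow> 0"
  shows "\<exists>G. primitive_on b g G"
proof -
  define D where "D n = Hn n b - Hn n 0" for n
  have Hmono: "Hn n s \<le> Hn n t" if "0 \<le> s" "s \<le> t" "t \<le> b" for n s t
  proof -
    have "AE t in lebesgue. t \<in> {0<..<b} \<longrightarrow> norm (0::real) \<le> hn n t"
      using ae by eventually_elim (auto intro: order_trans[OF norm_ge_zero])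
    from primitive_on_increment_le[OF primitive_on_zero H this that] show ?thesis by simp
  qed
  have inc: "norm ((Gn n t - Gn m t) - (Gn n s - Gn m s)) \<le> (Hn n t + Hn m t) - (Hn n s + Hn m s)"
    if st: "0 \<le> s" "s \<le> t" "t \<le> b" for n m s t
  proof (rule primitive_on_increment_le[OF primitive_on_diff[OF G G] primitive_on_add[OF H H] _ st])
    show "AE t in lebesgue. t \<in> {0<..<b} \<longrightarrow> norm (gn n t - gn m t) \<le> hn n t + hn m t"
      using ae
    proof (eventually_elim, intro impI)
      fix t assume "t \<in> {0<..<b} \<longrightarrow> (\<forall>n. norm (g t - gn n t) \<le> hn n t) \<and> (\<lambda>n. hn n t) \<longlonglongrightarrow> 0"
        "t \<in> {0<..<b}"
      then have "norm (g t - gn n t) \<le> hn n t" "norm (g t - gn m t) \<le> hn m t" by blast+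
      moreover have "norm (gn n t - gn m t) \<le> norm (g t - gn m t) + norm (g t - gn n t)"
        using norm_triangle_ineq4[of "g t - gn m t" "g t - gn n t"] by simp
      ultimately show "norm (gn n t - gn m t) \<le> hn n t + hn m t" by linarith
    qed
  qed
  have HD: "Hn n t - Hn n s \<le> D n" if "0 \<le> s" "s \<le> t" "t \<le> b" for n s t
    using Hmono[of 0 s n] Hmono[of t b n] that by (simp add: D_def)
  define X where "X n t = Gn n t - Gn n 0" for n t
  define GG where "GG t = lim (\<lambda>n. X n t)" for t
  have X: "(\<lambda>n. X n t) \<longlonglongrightarrow> GG t" if t: "t \<in> {0..b}" for t
  proof -
    have bd: "norm (X n t - X m t) \<le> D n + D m" for n m
    proof -
      have "norm ((Gn n t - Gn m t) - (Gn n 0 - Gn m 0)) \<le> (Hn n t - Hn n 0) + (Hn m t - Hn m 0)"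
        using inc[of 0 t n m] t by simp
      also have "\<dots> \<le> D n + D m" using t by (intro add_mono HD) auto
      finally show ?thesis by (simp add: X_def algebra_simps)
    qed
    have "Cauchy (\<lambda>n. X n t)"
    proof (rule metric_CauchyI)
      fix e :: real assume "e > 0"
      then have "\<forall>\<^sub>F n in sequentially. dist (D n) 0 < e/2"
        using lim by (intro tendstoD) (auto simp: D_def)
      then obtain N where N: "\<And>n. n \<ge> N \<Longrightarrow> \<bar>D n\<bar> < e/2"
        by (auto simp: eventually_sequentially dist_real_def)
      show "\<exists>M. \<forall>m\<ge>M. \<forall>n\<ge>M. dist (X m t) (X n t) < e"
      proof (intro exI allI impI)
        fix m n assume "N \<le> m" "N \<le> n"
        then show "dist (X m t) (X n t) < e"
          using bd[of m n] N[of m] N[of n] by (simp add: dist_norm)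
      qed
    qed
    then show ?thesis
      unfolding GG_def using Cauchy_convergent_iff convergent_LIMSEQ_iff by blast
  qed
  have GH: "norm ((GG t - Gn n t) - (GG s - Gn n s)) \<le> Hn n t - Hn n s"
    if st: "0 \<le> s" "s \<le> t" "t \<le> b" for n s t
  proof (rule LIMSEQ_le)
    show "(\<lambda>m. norm ((X m t - Gn n t) - (X m s - Gn n s))) \<longlonglongrightarrow> norm ((GG t - Gn n t) - (GG s - Gn n s))"
      using st by (intro tendsto_intros X) auto
    show "(\<lambda>m. (Hn n t - Hn n s) + D m) \<longlonglongrightarrow> Hn n t - Hn n s"
      using tendsto_add[OF tendsto_const lim] by (simp add: D_def)
    have "norm ((X m t - Gn n t) - (X m s - Gn n s)) \<le> (Hn n t - Hn n s) + D m" for m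
    proof -
      have eq: "(X m t - Gn n t) - (X m s - Gn n s) = (Gn m t - Gn n t) - (Gn m s - Gn n s)"
        by (simp add: X_def)
      have "norm ((X m t - Gn n t) - (X m s - Gn n s)) \<le> (Hn m t + Hn n t) - (Hn m s + Hn n s)"
        unfolding eq by (rule inc[OF st])
      then show ?thesis using HD[OF st, of m] by linarith
    qed
    then show "\<exists>N. \<forall>m\<ge>N. norm ((X m t - Gn n t) - (X m s - Gn n s)) \<le> (Hn n t - Hn n s) + D m" by blast
  qed
  have "abs_continuous_on {0..b} GG"
  proof (rule abs_continuous_on_dominated[of _ "Gn 0" "Hn 0" 1])
    show "abs_continuous_on {0..b} (Gn 0)" "abs_continuous_on {0..b} (Hn 0)"
      using G H by (auto simp: primitive_on_def)
    fix s t :: real assume st: "s < t" "{s..t} \<subseteq> {0..b}"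
    have "norm ((GG t - Gn 0 t) - (GG s - Gn 0 s)) \<le> Hn 0 t - Hn 0 s" using st by (intro GH) auto
    moreover have "GG t - GG s = (Gn 0 t - Gn 0 s) + ((GG t - Gn 0 t) - (GG s - Gn 0 s))" by simp
    then have "norm (GG t - GG s) \<le> norm (Gn 0 t - Gn 0 s) + norm ((GG t - Gn 0 t) - (GG s - Gn 0 s))"
      by (metis norm_triangle_ineq)
    ultimately show "norm (GG t - GG s) \<le> 1 * (norm (Gn 0 t - Gn 0 s) + norm (Hn 0 t - Hn 0 s))"
      by simp
  qed simp
  moreover have "AE t in lebesgue. t \<in> {0<..<b} \<longrightarrow> (GG has_vector_derivative g t) (at t)"
  proof -
    have "AE t in lebesgue. \<forall>n. t \<in> {0<..<b} \<longrightarrow> (Gn n has_vector_derivative gn n t) (at t)"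
      "AE t in lebesgue. \<forall>n. t \<in> {0<..<b} \<longrightarrow> (Hn n has_vector_derivative hn n t) (at t)"
      using G H unfolding AE_all_countable primitive_on_def by blast+
    with ae show ?thesis
    proof eventually_elim
      case (elim t)
      show ?case
      proof
        assume "t \<in> {0<..<b}"
        with elim have t: "t \<in> {0<..<b}" "\<And>n. norm (g t - gn n t) \<le> hn n t" "(\<lambda>n. hn n t) \<longlonglongrightarrow> 0"
          "\<And>n. (Gn n has_vector_derivative gn n t) (at t)"
          "\<And>n. (Hn n has_vector_derivative hn n t) (at t)" by blast+
        show "(GG has_vector_derivative g t) (at t)"
          unfolding has_vector_derivative_at_iff_eventually
        proof (intro allI impI)
          fix \<kappa> :: real assume "\<kappa> > 0"
          define q where "q = \<kappa>/4"
          have q: "q > 0" "\<kappa> = q + q + q + q" using \<open>\<kappa> > 0\<close> by (auto simp: q_def)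
          have "\<forall>\<^sub>F n in sequentially. dist (hn n t) 0 < q" using t(3) q(1) by (rule tendstoD)
          then obtain n where n: "\<bar>hn n t\<bar> < q"
            using eventually_happens'[OF sequentially_bot] by (auto simp: dist_real_def)
          have "\<forall>\<^sub>F s in at t. norm (Gn n s - Gn n t - (s - t) *\<^sub>R gn n t) \<le> q * \<bar>s - t\<bar>"
            "\<forall>\<^sub>F s in at t. norm (Hn n s - Hn n t - (s - t) *\<^sub>R hn n t) \<le> q * \<bar>s - t\<bar>"
            using t(4,5)[of n] q unfolding has_vector_derivative_at_iff_eventually by blast+
          moreover have "\<forall>\<^sub>F s in at t. s \<in> {0<..<b}"
            using t(1) by (intro eventually_at_in_open') auto
          ultimately show "\<forall>\<^sub>F s in at t. norm (GG s - GG t - (s - t) *\<^sub>R g t) \<le> \<kappa> * \<bar>s - t\<bar>"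
          proof eventually_elim
            case (elim s)
            have 1: "norm ((GG s - Gn n s) - (GG t - Gn n t)) \<le> \<bar>Hn n s - Hn n t\<bar>"
            proof (cases "s \<le> t")
              case True
              then show ?thesis
                using GH[of s t n] elim(3) t(1)
                by (simp add: norm_minus_commute[of "GG s - Gn n s"])
            next
              case False
              then show ?thesis using GH[of t s n] elim(3) t(1) by simp
            qed
            have "\<bar>Hn n s - Hn n t\<bar> \<le> \<bar>(s - t) * hn n t\<bar> + q * \<bar>s - t\<bar>" using elim(2) by simp
            moreover have "\<bar>(s - t) * hn n t\<bar> \<le> q * \<bar>s - t\<bar>"
              unfolding abs_mult mult.commute[of q] using n by (intro mult_left_mono) auto
            moreover have "norm ((s - t) *\<^sub>R (gn n t - g t)) \<le> q * \<bar>s - t\<bar>"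
            proof -
              have "norm (gn n t - g t) \<le> q" using t(2)[of n] n by (simp add: norm_minus_commute)
              then show ?thesis unfolding norm_scaleR mult.commute[of q] by (intro mult_left_mono) auto
            qed
            moreover have "GG s - GG t - (s - t) *\<^sub>R g t
                = ((GG s - Gn n s) - (GG t - Gn n t)) + (Gn n s - Gn n t - (s - t) *\<^sub>R gn n t)
                  + (s - t) *\<^sub>R (gn n t - g t)" by (simp add: algebra_simps)
            then have "norm (GG s - GG t - (s - t) *\<^sub>R g t) \<le> norm ((GG s - Gn n s) - (GG t - Gn n t))
                + norm (Gn n s - Gn n t - (s - t) *\<^sub>R gn n t) + norm ((s - t) *\<^sub>R (gn n t - g t))"
              by (metis norm_triangle_ineq norm_triangle_le add_right_mono)
            ultimately have "norm (GG s - GG t - (s - t) *\<^sub>R g t)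
                \<le> q * \<bar>s - t\<bar> + q * \<bar>s - t\<bar> + q * \<bar>s - t\<bar> + q * \<bar>s - t\<bar>"
              using 1 elim(1) by linarith
            then show ?case unfolding q(2) by (simp only: distrib_right)
          qed
        qed
      qed
    qed
  qed
  ultimately show ?thesis unfolding primitive_on_def by blast
qed

lemma has_primitive_uniform_limit:
  fixes g :: "real \<Rightarrow> 'a::{real_normed_vector, complete_space}"
  assumes "\<And>e. e > 0 \<Longrightarrow> \<exists>g' G'. primitive_on b g' G' \<and> (\<forall>t\<in>{0<..<b}. norm (g t - g' t) \<le> e)"
  shows "\<exists>G. primitive_on b g G"
proof -
  have "\<exists>g' G'. primitive_on b g' G' \<and> (\<forall>t\<in>{0<..<b}. norm (g t - g' t) \<le> inverse (real (Suc n)))" for n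
    by (rule assms) simp
  then obtain gn Gn where *: "\<And>n. primitive_on b (gn n) (Gn n)"
    "\<And>n t. t \<in> {0<..<b} \<Longrightarrow> norm (g t - gn n t) \<le> inverse (real (Suc n))" by metis
  show ?thesis
  proof (rule has_primitive_limit[OF *(1) primitive_on_const])
    show "AE t in lebesgue. t \<in> {0<..<b} \<longrightarrow> (\<forall>n. norm (g t - gn n t) \<le> inverse (real (Suc n))) \<and>
        (\<lambda>n. inverse (real (Suc n))) \<longlonglongrightarrow> 0"
      using *(2) LIMSEQ_inverse_real_of_nat by (intro always_eventually) auto
    show "(\<lambda>n. b *\<^sub>R inverse (real (Suc n)) - 0 *\<^sub>R inverse (real (Suc n))) \<longlonglongrightarrow> 0"
      using tendsto_mult_right_zero[OF LIMSEQ_inverse_real_of_nat, of b] by simp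
  qed
qed

text \<open>
  Approximate \<open>u\<close> uniformly by step functions; for these, \<open>f t (u t)\<close> is a finite sum of
  restrictions of functions \<open>f t c\<close> with \<open>c\<close> fixed.
\<close>

lemma has_primitive_compose:
  fixes f :: "real \<Rightarrow> 'c::real_normed_vector \<Rightarrow> 'a::{real_normed_vector, complete_space}"
  assumes "b > 0"
    and prim: "\<And>c. c \<in> C \<Longrightarrow> \<exists>G. primitive_on b (\<lambda>t. f t c) G"
    and lip: "\<And>t c c'. t \<in> {0<..<b} \<Longrightarrow> c \<in> C \<Longrightarrow> c' \<in> C \<Longrightarrow> norm (f t c - f t c') \<le> norm (c - c')"
    and u: "continuous_on {0..b} u" "\<And>t. t \<in> {0..b} \<Longrightarrow> u t \<in> C"
  shows "\<exists>G. primitive_on b (\<lambda>t. f t (u t)) G"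
proof (rule has_primitive_uniform_limit)
  fix e :: real assume "e > 0"
  have "uniformly_continuous_on {0..b} u"
    using u(1) by (rule compact_uniformly_continuous) simp
  then obtain d where d: "d > 0" "\<And>s t. s \<in> {0..b} \<Longrightarrow> t \<in> {0..b} \<Longrightarrow> dist t s < d \<Longrightarrow> dist (u t) (u s) < e"
    using \<open>e > 0\<close> unfolding uniformly_continuous_on_def by blast
  obtain m :: nat where m: "b / d < real m" using reals_Archimedean2 by blast
  define N where "N = Suc m"
  define \<delta> where "\<delta> = b / real N"
  have "\<delta> > 0" using \<open>b > 0\<close> by (simp add: \<delta>_def N_def)
  have "b < d * real N" using m d(1) by (simp add: N_def field_simps)
  then have "\<delta> < d" by (simp add: \<delta>_def N_def field_simps)
  have b: "b = real N * \<delta>" by (simp add: \<delta>_def N_def)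
  define g' where "g' t = (\<Sum>k<N. if t \<in> {real k * \<delta>..<(real k + 1) * \<delta>} then f t (u (real k * \<delta>)) else 0)" for t
  have k: "0 \<le> real k * \<delta>" "real k * \<delta> \<le> (real k + 1) * \<delta>" "(real k + 1) * \<delta> \<le> b" if "k < N" for k
  proof -
    show "0 \<le> real k * \<delta>" "real k * \<delta> \<le> (real k + 1) * \<delta>" using \<open>\<delta> > 0\<close> by auto
    have "real k + 1 \<le> real N" using that by linarith
    then show "(real k + 1) * \<delta> \<le> b" unfolding b using \<open>\<delta> > 0\<close> by (intro mult_right_mono) auto
  qed
  have "\<exists>G. primitive_on b g' G"
    unfolding g'_def[abs_def]
  proof (intro has_primitive_sum)
    fix k assume "k \<in> {..<N}"
    then have "k < N" by simp
    have "u (real k * \<delta>) \<in> C" using k[OF \<open>k < N\<close>] by (intro u(2)) auto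
    then obtain G where G: "primitive_on b (\<lambda>t. f t (u (real k * \<delta>))) G" using prim by blast
    from primitive_on_restrict[OF this k[OF \<open>k < N\<close>]]
    show "\<exists>G. primitive_on b (\<lambda>t. if t \<in> {real k * \<delta>..<(real k + 1) * \<delta>} then f t (u (real k * \<delta>)) else 0) G"
      by blast
  qed simp
  moreover have "norm (f t (u t) - g' t) \<le> e" if t: "t \<in> {0<..<b}" for t
  proof -
    \<comment> \<open>the only step whose interval contains \<open>t\<close>\<close>
    define k where "k = nat \<lfloor>t / \<delta>\<rfloor>"
    have tk: "real k \<le> t / \<delta>" "t / \<delta> < real k + 1"
      using t \<open>\<delta> > 0\<close> by (auto simp: k_def)
    then have tk': "real k * \<delta> \<le> t" "t < (real k + 1) * \<delta>" using \<open>\<delta> > 0\<close> by (auto simp: field_simps)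
    have "real k * \<delta> < real N * \<delta>" using tk'(1) t b by simp
    then have "k < N" using \<open>\<delta> > 0\<close> by simp
    have iff: "t \<in> {real j * \<delta>..<(real j + 1) * \<delta>} \<longleftrightarrow> j = k" for j
    proof
      assume j: "t \<in> {real j * \<delta>..<(real j + 1) * \<delta>}"
      have "real j * \<delta> < (real k + 1) * \<delta>" "real k * \<delta> < (real j + 1) * \<delta>" using j tk' by auto
      then have "real j < real k + 1" "real k < real j + 1" using \<open>\<delta> > 0\<close> by auto
      then show "j = k" by linarith
    qed (use tk' in auto)
    have "g' t = f t (u (real k * \<delta>))"
      unfolding g'_def iff using \<open>k < N\<close> by simp
    moreover have kb: "real k * \<delta> \<in> {0..b}" using k[OF \<open>k < N\<close>] by auto
    moreover have "dist t (real k * \<delta>) < d" using tk' \<open>\<delta> < d\<close> by (simp add: dist_real_def algebra_simps)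
    then have "dist (u t) (u (real k * \<delta>)) < e" using t kb by (intro d(2)) auto
    ultimately show ?thesis
      using lip[OF t u(2) u(2), of t "real k * \<delta>"] t by (simp add: dist_norm)
  qed
  ultimately show "\<exists>g' G'. primitive_on b g' G' \<and> (\<forall>t\<in>{0<..<b}. norm (f t (u t) - g' t) \<le> e)"
    by blast
qed

lemma has_primitive_continuous:
  fixes u :: "real \<Rightarrow> 'a::{real_normed_vector, complete_space}"
  assumes "b > 0" "continuous_on {0..b} u"
  shows "\<exists>G. primitive_on b u G"
  using has_primitive_compose[OF assms(1), of UNIV "\<lambda>t c. c" u] assms(2) primitive_on_const by blast

lemma primitive_on_integral:
  fixes h :: "real \<Rightarrow> real"
  assumes "h integrable_on {0..b}" "\<And>x. x \<in> {0..b} \<Longrightarrow> 0 \<le> h x" "b \<ge> 0"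
  shows "primitive_on b h (\<lambda>x. integral {0..x} h)"
  using abs_continuous_on_primitive[OF assms] AE_primitive_has_derivative[OF assms(1)]
  by (simp add: primitive_on_def)

lemma has_primitive_simple_function:
  fixes s :: "real \<Rightarrow> 'a::{real_normed_vector, complete_space}"
  assumes s: "simple_function (lebesgue_on {0..b}) s" and "b \<ge> 0"
  shows "\<exists>G. primitive_on b s G"
proof -
  define A where "A v = s -` {v} \<inter> {0..b}" for v
  have fin: "finite (s ` {0..b})" and A: "\<And>v. v \<in> s ` {0..b} \<Longrightarrow> A v \<in> sets lebesgue"
  proof -
    show "finite (s ` {0..b})" using s by (simp add: simple_function_def space_restrict_space)
    fix v assume "v \<in> s ` {0..b}"
    then have "A v \<in> sets (lebesgue_on {0..b})"
      using s by (auto simp: simple_function_def space_restrict_space A_def)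
    then show "A v \<in> sets lebesgue" by (auto simp: sets_restrict_space intro!: sets.Int)
  qed
  have "\<exists>G. primitive_on b (\<lambda>t. \<Sum>v\<in>s ` {0..b}. indicat_real (A v) t *\<^sub>R v) G"
  proof (rule has_primitive_sum[OF fin])
    fix v assume v: "v \<in> s ` {0..b}"
    have "A v \<in> lmeasurable"
    proof (rule bounded_set_imp_lmeasurable[OF _ A[OF v]])
      show "bounded (A v)" by (rule bounded_subset[of "{0..b}"]) (auto simp: A_def)
    qed
    then have "indicat_real (A v) integrable_on {0..b}"
      by (intro integrable_on_indicator[THEN iffD2]) (auto simp: fmeasurable.Int)
    then have "primitive_on b (indicat_real (A v)) (\<lambda>x. integral {0..x} (indicat_real (A v)))"
      using \<open>b \<ge> 0\<close> by (intro primitive_on_integral) auto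
    from primitive_on_scaleR[OF this, of v]
    show "\<exists>G. primitive_on b (\<lambda>t. indicat_real (A v) t *\<^sub>R v) G" by blast
  qed
  then obtain G where "primitive_on b (\<lambda>t. \<Sum>v\<in>s ` {0..b}. indicat_real (A v) t *\<^sub>R v) G" by blast
  moreover have "(\<Sum>v\<in>s ` {0..b}. indicat_real (A v) t *\<^sub>R v) = s t" if t: "t \<in> {0<..<b}" for t
  proof -
    have "(\<Sum>v\<in>s ` {0..b}. indicat_real (A v) t *\<^sub>R v) = (\<Sum>v\<in>s ` {0..b}. if v = s t then v else 0)"
      using t by (intro sum.cong) (auto simp: A_def indicator_def)
    then show ?thesis using fin t by simp
  qed
  ultimately show ?thesis using primitive_on_cong by blast
qed

text \<open>
  The approximating simple functions \<open>s i\<close> have primitives, and the scalar functions \<open>norm (f t - s i t)\<close>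
  serve as the bounds in the limit lemma: their integrals tend to \<open>0\<close>, and so do their values at almost
  every \<open>t\<close>.
\<close>

lemma has_primitive_bochner_integrable:
  fixes f :: "real \<Rightarrow> 'a::{real_normed_vector, complete_space}"
  assumes f: "bochner_integrable (lebesgue_on {0..b}) f" and "b \<ge> 0"
  shows "\<exists>G. primitive_on b f G"
proof -
  let ?M = "lebesgue_on {0..b}"
  obtain s0 where s0: "\<And>i. Bochner_Integration.simple_bochner_integrable ?M (s0 i)"
    "AE t in ?M. (\<lambda>i. s0 i t) \<longlonglongrightarrow> f t"
    "(\<lambda>i. \<integral>\<^sup>+t. ennreal (norm (f t - s0 i t)) \<partial>?M) \<longlonglongrightarrow> 0"
    using f unfolding bochner_integrable_def by blast
  have "\<forall>\<^sub>F i in sequentially. (\<integral>\<^sup>+t. ennreal (norm (f t - s0 i t)) \<partial>?M) < 1"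
    using s0(3) by (rule order_tendstoD) simp
  then obtain i0 where i0: "\<And>i. i \<ge> i0 \<Longrightarrow> (\<integral>\<^sup>+t. ennreal (norm (f t - s0 i t)) \<partial>?M) < 1"
    by (auto simp: eventually_sequentially)
  define s where "s i = s0 (i + i0)" for i
  have simple: "simple_function ?M (s i)" for i
    using s0(1)[of "i + i0"] by (auto simp: s_def elim: Bochner_Integration.simple_bochner_integrable.cases)
  have conv: "AE t in ?M. (\<lambda>i. s i t) \<longlonglongrightarrow> f t"
    unfolding s_def using s0(2) by (rule eventually_mono) (rule LIMSEQ_ignore_initial_segment)
  have lim: "(\<lambda>i. \<integral>\<^sup>+t. ennreal (norm (f t - s i t)) \<partial>?M) \<longlonglongrightarrow> 0"
    unfolding s_def by (rule LIMSEQ_ignore_initial_segment[OF s0(3)])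
  \<comment> \<open>a measurable version of \<open>norm (f t - s i t)\<close>\<close>
  define h where "h i t = \<bar>lim (\<lambda>j. norm (s j t - s i t))\<bar>" for i t
  have hm: "h i \<in> borel_measurable ?M" for i
    unfolding h_def[abs_def]
  proof (intro borel_measurable_abs borel_measurable_lim_metric)
    fix j
    have "simple_function ?M (\<lambda>t. norm (s j t - s i t))"
      using simple_function_compose2[OF simple simple, of "\<lambda>x y. norm (x - y)"] by simp
    then show "(\<lambda>t. norm (s j t - s i t)) \<in> borel_measurable ?M"
      by (rule borel_measurable_simple_function)
  qed
  have hn: "AE t in ?M. \<forall>i. h i t = norm (f t - s i t)"
    using conv
  proof (rule eventually_mono, intro allI)
    fix t i assume "(\<lambda>j. s j t) \<longlonglongrightarrow> f t"
    then have "(\<lambda>j. norm (s j t - s i t)) \<longlonglongrightarrow> norm (f t - s i t)"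
      by (intro tendsto_intros)
    then show "h i t = norm (f t - s i t)" unfolding h_def by (simp add: limI)
  qed
  have nn: "(\<integral>\<^sup>+t. ennreal (h i t) \<partial>?M) = (\<integral>\<^sup>+t. ennreal (norm (f t - s i t)) \<partial>?M)" for i
    using hn by (intro nn_integral_cong_AE) (auto elim: eventually_mono)
  define r where "r i = enn2real (\<integral>\<^sup>+t. ennreal (h i t) \<partial>?M)" for i
  have r: "(\<integral>\<^sup>+t. ennreal (h i t) \<partial>?M) = ennreal (r i)" "r i \<ge> 0" for i
  proof -
    have "(\<integral>\<^sup>+t. ennreal (h i t) \<partial>?M) < 1" using i0[of "i + i0"] by (simp add: nn s_def)
    then have "(\<integral>\<^sup>+t. ennreal (h i t) \<partial>?M) < top" by (rule order.strict_trans) simp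
    then show "(\<integral>\<^sup>+t. ennreal (h i t) \<partial>?M) = ennreal (r i)" "r i \<ge> 0" by (simp_all add: r_def)
  qed
  have "(\<lambda>i. ennreal (r i)) \<longlonglongrightarrow> ennreal 0"
    using lim unfolding nn[symmetric] r(1) by simp
  then have rlim: "r \<longlonglongrightarrow> 0"
    by (rule tendsto_ennrealD) (auto simp: r(2))
  have hint: "(h i has_integral r i) {0..b}" for i
  proof -
    have "((\<lambda>t. if t \<in> {0..b} then h i t else 0) has_integral r i) UNIV"
    proof (subst has_integral_iff_nn_integral_lebesgue, goal_cases)
      case 2
      have "(\<lambda>t. if t \<in> {0..b} then h i t else 0) \<in> borel_measurable lebesgue"
        using hm[of i] by (subst borel_measurable_if) auto
      moreover have "(\<integral>\<^sup>+t. ennreal (if t \<in> {0..b} then h i t else 0) \<partial>lebesgue)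
          = (\<integral>\<^sup>+t. ennreal (h i t) * indicator {0..b} t \<partial>lebesgue)"
        by (intro nn_integral_cong) (auto simp: indicator_def)
      moreover have "\<dots> = (\<integral>\<^sup>+t. ennreal (h i t) \<partial>?M)"
        by (subst nn_integral_restrict_space) auto
      ultimately show ?case using r[of i] by simp
    qed (simp add: h_def)
    then show ?thesis by (simp only: has_integral_restrict_UNIV)
  qed
  have H: "primitive_on b (h i) (\<lambda>x. integral {0..x} (h i))" for i
    using hint[of i] \<open>b \<ge> 0\<close> by (intro primitive_on_integral) (auto simp: h_def)
  obtain G where G: "\<And>i. primitive_on b (s i) (G i)"
    using has_primitive_simple_function[OF simple \<open>b \<ge> 0\<close>] by metis
  show ?thesis
  proof (rule has_primitive_limit[OF G H])
    show "(\<lambda>n. integral {0..b} (h n) - integral {0..0} (h n)) \<longlonglongrightarrow> 0"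
      using rlim integral_unique[OF hint] by simp
    have "AE t in ?M. (\<forall>n. norm (f t - s n t) \<le> h n t) \<and> (\<lambda>n. h n t) \<longlonglongrightarrow> 0"
      using conv hn
    proof eventually_elim
      case (elim t)
      then have "(\<lambda>n. norm (f t - s n t)) \<longlonglongrightarrow> norm (f t - f t)" by (intro tendsto_intros)
      then show ?case using elim by simp
    qed
    then have "AE t in lebesgue. t \<in> {0..b} \<longrightarrow> (\<forall>n. norm (f t - s n t) \<le> h n t) \<and> (\<lambda>n. h n t) \<longlonglongrightarrow> 0"
      by (rule AE_restrict_space_iff[THEN iffD1, rotated]) simp
    then show "AE t in lebesgue. t \<in> {0<..<b} \<longrightarrow> (\<forall>n. norm (f t - s n t) \<le> h n t) \<and> (\<lambda>n. h n t) \<longlonglongrightarrow> 0"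
      by (rule eventually_mono) auto
  qed
qed

section \<open>Nearest points in a closed convex set\<close>

text \<open>
  Minimizing sequences are Cauchy by the parallelogram identity.
\<close>

lemma nearest_point_exists:
  fixes D :: "'a::{real_inner, complete_space} set"
  assumes "closed D" "convex D" "D \<noteq> {}"
  shows "\<exists>p\<in>D. \<forall>q\<in>D. dist u p \<le> dist u q"
proof -
  define d where "d = infdist u D"
  have d: "d \<le> dist u q" if "q \<in> D" for q using infdist_le[OF that] by (simp add: d_def)
  have d0: "d \<ge> 0" by (simp add: d_def infdist_nonneg)
  have ex: "\<exists>q\<in>D. (dist u q)\<^sup>2 < d\<^sup>2 + e" if "e > 0" for e
  proof -
    have "d < sqrt (d\<^sup>2 + e)" using that d0 by (intro real_less_rsqrt) simp
    then obtain q where "q \<in> D" "dist u q < sqrt (d\<^sup>2 + e)"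
      using assms(3) cINF_less_iff[of D "dist u"] by (auto simp: d_def infdist_def)
    then have "(dist u q)\<^sup>2 < (sqrt (d\<^sup>2 + e))\<^sup>2" by (intro power_strict_mono) auto
    then show ?thesis using \<open>q \<in> D\<close> that by auto
  qed
  then have "\<exists>q\<in>D. (dist u q)\<^sup>2 < d\<^sup>2 + inverse (real (Suc n))" for n by simp
  then obtain q where q: "\<And>n. q n \<in> D" "\<And>n. (dist u (q n))\<^sup>2 < d\<^sup>2 + inverse (real (Suc n))" by metis
  have par: "(dist (q m) (q n))\<^sup>2 \<le> 2 * inverse (real (Suc m)) + 2 * inverse (real (Suc n))" for m n
  proof -
    define c where "c = (1/2) *\<^sub>R q m + (1/2) *\<^sub>R q n"
    have "c \<in> D" unfolding c_def using q(1) by (intro convexD[OF assms(2)]) auto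
    then have "d\<^sup>2 \<le> (dist u c)\<^sup>2" using d d0 by (intro power_mono) auto
    moreover have "(dist (q m) (q n))\<^sup>2 = 2 * (dist u (q m))\<^sup>2 + 2 * (dist u (q n))\<^sup>2 - 4 * (dist u c)\<^sup>2"
      unfolding dist_norm c_def power2_norm_eq_inner
      by (simp add: inner_simps inner_commute algebra_simps)
    ultimately show ?thesis using q(2)[of m] q(2)[of n] by linarith
  qed
  have "Cauchy q"
  proof (rule metric_CauchyI)
    fix e :: real assume "e > 0"
    then obtain N where N: "inverse (real (Suc N)) < e\<^sup>2 / 4"
      using reals_Archimedean[of "e\<^sup>2/4"] by auto
    show "\<exists>M. \<forall>m\<ge>M. \<forall>n\<ge>M. dist (q m) (q n) < e"
    proof (intro exI allI impI)
      fix m n assume mn: "N \<le> m" "N \<le> n"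
      have "inverse (real (Suc m)) \<le> inverse (real (Suc N))" "inverse (real (Suc n)) \<le> inverse (real (Suc N))"
        using mn by (auto intro!: le_imp_inverse_le)
      then have "(dist (q m) (q n))\<^sup>2 < e\<^sup>2" using par[of m n] N by linarith
      then show "dist (q m) (q n) < e" using \<open>e > 0\<close> by (simp add: power_less_imp_less_base)
    qed
  qed
  then obtain p where p: "q \<longlonglongrightarrow> p" using Cauchy_convergent_iff convergent_def by blast
  have "p \<in> D" using closed_sequentially[OF assms(1) q(1) p] .
  moreover have "dist u p \<le> d"
  proof -
    have "(dist u p)\<^sup>2 \<le> d\<^sup>2 + 0"
    proof (rule LIMSEQ_le)
      show "(\<lambda>n. (dist u (q n))\<^sup>2) \<longlonglongrightarrow> (dist u p)\<^sup>2" by (intro tendsto_intros p)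
      show "(\<lambda>n. d\<^sup>2 + inverse (real (Suc n))) \<longlonglongrightarrow> d\<^sup>2 + 0"
        by (intro tendsto_intros LIMSEQ_inverse_real_of_nat)
      show "\<exists>N. \<forall>n\<ge>N. (dist u (q n))\<^sup>2 \<le> d\<^sup>2 + inverse (real (Suc n))" using q(2) by (auto intro: less_imp_le)
    qed
    then show ?thesis using d0 by (simp add: abs_le_square_iff[symmetric])
  qed
  ultimately show ?thesis using d by (intro bexI[of _ p]) (auto intro: order_trans)
qed

text \<open>
  Nonexpansiveness follows by adding the variational inequalities of the two nearest points.
\<close>

lemma nonexpansive_nearest_point_map:
  fixes D :: "'a::{real_inner, complete_space} set"
  assumes "closed D" "convex D" "D \<noteq> {}"
  obtains R where "\<And>u. R u \<in> D" "\<And>u q. q \<in> D \<Longrightarrow> norm (u - R u) \<le> norm (u - q)"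
    "\<And>u v. norm (R u - R v) \<le> norm (u - v)"
proof -
  have "\<forall>u. \<exists>p. p \<in> D \<and> (\<forall>q\<in>D. dist u p \<le> dist u q)"
    using nearest_point_exists[OF assms] by blast
  then obtain R where R: "\<And>u. R u \<in> D" "\<And>u q. q \<in> D \<Longrightarrow> dist u (R u) \<le> dist u q" by metis
  have "norm (R u - R v) \<le> norm (u - v)" for u v
  proof -
    have "inner (u - R u) (R v - R u) \<le> 0" "inner (v - R v) (R u - R v) \<le> 0"
      using R assms by (auto intro!: any_closest_point_dot[of D])
    moreover have "(norm (R u - R v))\<^sup>2
        = inner (u - v) (R u - R v) + inner (u - R u) (R v - R u) + inner (v - R v) (R u - R v)"
      unfolding power2_norm_eq_inner by (simp add: inner_simps inner_commute)
    ultimately have "(norm (R u - R v))\<^sup>2 \<le> inner (u - v) (R u - R v)" by linarith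
    also have "\<dots> \<le> norm (u - v) * norm (R u - R v)" by (rule norm_cauchy_schwarz)
    finally show ?thesis by (auto simp: power2_eq_square mult_le_cancel_right split: if_splits)
  qed
  then show ?thesis using that[of R] R by (auto simp: dist_norm)
qed

section \<open>Solutions of Lipschitz Caratheodory equations\<close>

lemma primitive_on_C1:
  fixes R r :: "real \<Rightarrow> real"
  assumes der: "\<And>t. (R has_real_derivative r t) (at t)" and cont: "continuous_on {0..b} r"
  shows "primitive_on b r R"
proof -
  have "bounded (r ` {0..b})" by (intro compact_imp_bounded compact_continuous_image cont) simp
  then obtain B where B: "\<And>t. t \<in> {0..b} \<Longrightarrow> norm (r t) \<le> B" unfolding bounded_iff by blast
  have "abs_continuous_on {0..b} R"
  proof (rule abs_continuous_on_lipschitz[of "\<bar>B\<bar>"])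
    fix s t :: real assume st: "s < t" "{s..t} \<subseteq> {0..b}"
    have "norm (R t - R s) \<le> B * norm (t - s)"
    proof (rule field_differentiable_bound[of "{s..t}" R r])
      show "(R has_field_derivative r z) (at z within {s..t})" for z
        using der by (rule has_field_derivative_at_within)
    qed (use B st in auto)
    also have "\<dots> \<le> \<bar>B\<bar> * (t - s)" using st by (auto intro!: mult_right_mono)
    finally show "norm (R t - R s) \<le> \<bar>B\<bar> * (t - s)" .
  qed simp
  then show ?thesis
    using der by (auto simp: primitive_on_def has_real_derivative_iff_has_vector_derivative)
qed

lemma primitive_on_imp_continuous_on: "primitive_on b g G \<Longrightarrow> continuous_on {0..b} G"
  unfolding primitive_on_def
  by (auto intro: abs_continuous_on_imp_continuous_on simp: is_interval_cc)

text \<open>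
  Picard iteration, with \<open>\<Phi>\<close> sending \<open>u\<close> to the primitive of \<open>F t (u t)\<close> that starts at \<open>x0\<close>. Weighting
  errors by \<open>exp (2 * L * t)\<close> makes \<open>\<Phi>\<close> contract with factor \<open>1/2\<close> on the whole interval.
\<close>

lemma caratheodory_picard:
  fixes F :: "real \<Rightarrow> 'a \<Rightarrow> 'a::{real_normed_vector, complete_space}"
  assumes b: "b > 0" and L: "L > 0"
    and prim: "\<And>u. continuous_on {0..b} u \<Longrightarrow> \<exists>G. primitive_on b (\<lambda>t. F t (u t)) G"
    and lip: "\<And>t c c'. t \<in> {0<..<b} \<Longrightarrow> norm (F t c - F t c') \<le> L * norm (c - c')"
  shows "\<exists>x. primitive_on b (\<lambda>t. F t (x t)) x \<and> x 0 = x0"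
proof -
  have "\<exists>X. primitive_on b (\<lambda>t. F t (u t)) X \<and> X 0 = x0" if u: "continuous_on {0..b} u" for u
  proof -
    obtain G where G: "primitive_on b (\<lambda>t. F t (u t)) G" using prim[OF u] by blast
    have "primitive_on b (\<lambda>t. 0) (\<lambda>t. x0 - G 0)"
      by (auto simp: primitive_on_def abs_continuous_on_const)
    from primitive_on_add[OF G this] show ?thesis by (intro exI[of _ "\<lambda>t. G t + (x0 - G 0)"]) auto
  qed
  then have "\<forall>u. \<exists>X. continuous_on {0..b} u \<longrightarrow> primitive_on b (\<lambda>t. F t (u t)) X \<and> X 0 = x0" by blast
  then obtain \<Phi> where \<Phi>: "\<And>u. continuous_on {0..b} u \<Longrightarrow> primitive_on b (\<lambda>t. F t (u t)) (\<Phi> u)"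
    "\<And>u. continuous_on {0..b} u \<Longrightarrow> \<Phi> u 0 = x0" by metis
  define X where "X n = (\<Phi> ^^ n) (\<lambda>t. x0)" for n
  have XS: "X (Suc n) = \<Phi> (X n)" for n by (simp add: X_def)
  have Xc: "continuous_on {0..b} (X n)" for n
  proof (induction n)
    case 0 then show ?case by (simp add: X_def)
  next
    case (Suc n)
    then show ?case unfolding XS by (rule primitive_on_imp_continuous_on[OF \<Phi>(1)])
  qed
  have X0: "X n 0 = x0" for n 
  proof (cases n)
    case 0 then show ?thesis by (simp add: X_def)
  next
    case (Suc m) then show ?thesis using \<Phi>(2)[OF Xc[of m]] by (simp only: XS)
  qed
  have "bounded ((\<lambda>t. X 1 t - X 0 t) ` {0..b})"
    by (intro compact_imp_bounded compact_continuous_image continuous_intros Xc) simp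
  then obtain C where C: "\<And>t. t \<in> {0..b} \<Longrightarrow> norm (X 1 t - X 0 t) \<le> C" unfolding bounded_iff by blast
  have C0: "C \<ge> 0" using C[of 0] b by (force intro: order_trans[OF norm_ge_zero])
  have step: "norm (X (Suc n) t - X n t) \<le> C * (1/2) ^ n * exp (2 * L * t)" if "t \<in> {0..b}" for n t
    using that
  proof (induction n arbitrary: t)
    case 0
    have "C * 1 \<le> C * exp (2 * L * t)" using 0 C0 L by (intro mult_left_mono) auto
    then show ?case using C[OF 0] by simp
  next
    case (Suc n)
    let ?R = "\<lambda>t. C * (1/2) ^ Suc n * exp (2 * L * t)"
    let ?r = "\<lambda>t. L * (C * (1/2) ^ n * exp (2 * L * t))"
    have "norm ((X (Suc (Suc n)) t - X (Suc n) t) - (X (Suc (Suc n)) 0 - X (Suc n) 0)) \<le> ?R t - ?R 0"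
    proof (rule primitive_on_increment_le[where b = b])
      show "primitive_on b (\<lambda>t. F t (X (Suc n) t) - F t (X n t)) (\<lambda>t. X (Suc (Suc n)) t - X (Suc n) t)"
        unfolding XS[of "Suc n"] XS[of n, symmetric]
        by (rule primitive_on_diff[OF \<Phi>(1)[OF Xc] \<Phi>(1)[OF Xc, of n, folded XS]])
      show "primitive_on b ?r ?R"
        by (rule primitive_on_C1) (auto intro!: derivative_eq_intros continuous_intros)
      show "AE t in lebesgue. t \<in> {0<..<b} \<longrightarrow> norm (F t (X (Suc n) t) - F t (X n t)) \<le> ?r t"
      proof (intro always_eventually allI impI)
        fix t assume t: "t \<in> {0<..<b}"
        have "norm (F t (X (Suc n) t) - F t (X n t)) \<le> L * norm (X (Suc n) t - X n t)"
          by (rule lip[OF t])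
        also have "\<dots> \<le> ?r t" using t L by (intro mult_left_mono Suc.IH) auto
        finally show "norm (F t (X (Suc n) t) - F t (X n t)) \<le> ?r t" .
      qed
    qed (use Suc.prems in auto)
    also have "\<dots> \<le> ?R t" using C0 by simp
    finally show ?case by (simp add: X0)
  qed
  define K where "K = C * exp (2 * L * b)"
  have "K \<ge> 0" using C0 by (simp add: K_def)
  have step': "norm (X (Suc n) t - X n t) \<le> K * (1/2) ^ n" if t: "t \<in> {0..b}" for n t
  proof -
    have "C * (1/2) ^ n * exp (2 * L * t) \<le> C * (1/2) ^ n * exp (2 * L * b)"
      using t C0 L by (intro mult_left_mono) auto
    also have "\<dots> = K * (1/2) ^ n" by (simp add: K_def)
    finally show ?thesis using step[OF t, of n] by linarith
  qed
  have tele: "norm (X (n + k) t - X n t) \<le> 2 * K * ((1/2) ^ n - (1/2) ^ (n + k))" if t: "t \<in> {0..b}" for n k t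
  proof (induction k)
    case (Suc k)
    have "norm (X (n + Suc k) t - X n t) \<le> norm (X (Suc (n + k)) t - X (n + k) t) + norm (X (n + k) t - X n t)"
      using norm_triangle_ineq[of "X (Suc (n + k)) t - X (n + k) t" "X (n + k) t - X n t"] by simp
    also have "\<dots> \<le> K * (1/2) ^ (n + k) + 2 * K * ((1/2) ^ n - (1/2) ^ (n + k))"
      by (intro add_mono step'[OF t] Suc)
    also have "\<dots> = 2 * K * ((1/2) ^ n - (1/2) ^ (n + Suc k))" by (simp add: algebra_simps)
    finally show ?case .
  qed simp
  have tele': "norm (X m t - X n t) \<le> 2 * K * (1/2) ^ n" if t: "t \<in> {0..b}" and "n \<le> m" for n m t
  proof -
    obtain k where k: "m = n + k" using \<open>n \<le> m\<close> le_Suc_ex by blast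
    have "2 * K * ((1/2) ^ n - (1/2) ^ (n + k)) \<le> 2 * K * (1/2) ^ n"
      using \<open>K \<ge> 0\<close> by (intro mult_left_mono) auto
    then show ?thesis using tele[OF t, of n k] unfolding k by linarith
  qed
  have null: "(\<lambda>n. B * (1/2) ^ n) \<longlonglongrightarrow> 0" for B :: real
    using tendsto_mult_right_zero[OF LIMSEQ_power_zero[of "1/2::real"]] by simp
  define x where "x t = lim (\<lambda>n. X n t)" for t
  have lim: "(\<lambda>n. X n t) \<longlonglongrightarrow> x t" if t: "t \<in> {0..b}" for t
  proof -
    have "Cauchy (\<lambda>n. X n t)"
    proof (rule metric_CauchyI)
      fix e :: real assume "e > 0"
      then have "\<forall>\<^sub>F n in sequentially. dist (2 * K * (1/2) ^ n) 0 < e/2" by (intro tendstoD null) simp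
      then obtain N where N: "\<bar>2 * K * (1/2) ^ N\<bar> < e/2"
        using eventually_happens'[OF sequentially_bot] by (auto simp: dist_real_def)
      show "\<exists>M. \<forall>m\<ge>M. \<forall>n\<ge>M. dist (X m t) (X n t) < e"
      proof (intro exI allI impI)
        fix m n assume "N \<le> m" "N \<le> n"
        then have "norm (X m t - X N t) < e/2" "norm (X n t - X N t) < e/2"
          using tele'[OF t, of N m] tele'[OF t, of N n] N by linarith+
        then show "dist (X m t) (X n t) < e"
          using dist_triangle_half_r[of "X N t" "X m t" e "X n t"] by (simp add: dist_norm norm_minus_commute)
      qed
    qed
    then show ?thesis
      unfolding x_def using Cauchy_convergent_iff convergent_LIMSEQ_iff by blast
  qed
  have xX: "norm (x t - X n t) \<le> 2 * K * (1/2) ^ n" if t: "t \<in> {0..b}" for n t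
  proof (rule Lim_bounded)
    show "(\<lambda>m. norm (X m t - X n t)) \<longlonglongrightarrow> norm (x t - X n t)"
      by (intro tendsto_intros lim t)
    show "\<forall>m\<ge>n. norm (X m t - X n t) \<le> 2 * K * (1/2) ^ n" using tele'[OF t] by blast
  qed
  have "uniform_limit {0..b} X x sequentially"
  proof (rule uniform_limitI)
    fix e :: real assume "e > 0"
    then have "\<forall>\<^sub>F n in sequentially. dist (2 * K * (1/2) ^ n) 0 < e" by (intro tendstoD null)
    then show "\<forall>\<^sub>F n in sequentially. \<forall>t\<in>{0..b}. dist (X n t) (x t) < e"
    proof (rule eventually_mono, intro ballI)
      fix n t assume "dist (2 * K * (1/2) ^ n) 0 < e" "t \<in> {0..b}"
      then show "dist (X n t) (x t) < e"
        using xX[of t n] by (simp add: dist_norm norm_minus_commute)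
    qed
  qed
  then have xc: "continuous_on {0..b} x"
    by (rule uniform_limit_theorem[rotated]) (use Xc in auto)
  have eq: "\<Phi> x t = x t" if t: "t \<in> {0..b}" for t
  proof -
    have "norm (\<Phi> x t - X (Suc n) t) \<le> L * (2 * K) * b * (1/2) ^ n" for n
    proof -
      let ?c = "L * (2 * K * (1/2) ^ n)"
      have "norm ((\<Phi> x t - \<Phi> (X n) t) - (\<Phi> x 0 - \<Phi> (X n) 0)) \<le> t *\<^sub>R ?c - 0 *\<^sub>R ?c"
      proof (rule primitive_on_increment_le[OF primitive_on_diff[OF \<Phi>(1)[OF xc] \<Phi>(1)[OF Xc]] primitive_on_const])
        show "AE t in lebesgue. t \<in> {0<..<b} \<longrightarrow> norm (F t (x t) - F t (X n t)) \<le> ?c"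
        proof (intro always_eventually allI impI)
          fix t assume t: "t \<in> {0<..<b}"
          have "norm (F t (x t) - F t (X n t)) \<le> L * norm (x t - X n t)" by (rule lip[OF t])
          also have "\<dots> \<le> ?c" using t L by (intro mult_left_mono xX) auto
          finally show "norm (F t (x t) - F t (X n t)) \<le> ?c" .
        qed
      qed (use t in auto)
      also have "\<dots> \<le> b * ?c" using t L \<open>K \<ge> 0\<close> by (auto intro!: mult_right_mono)
      finally show ?thesis by (simp add: \<Phi>(2) xc Xc XS mult_ac)
    qed
    then have "(\<lambda>n. X (Suc n) t) \<longlonglongrightarrow> \<Phi> x t"
      by (intro LIM_zero_cancel[of "\<lambda>n. X (Suc n) t", OF Lim_null_comparison[OF _ null[of "L * (2 * K) * b"]]])
         (auto simp: norm_minus_commute intro: always_eventually)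
    moreover have "(\<lambda>n. X (Suc n) t) \<longlonglongrightarrow> x t" using lim[OF t] by (rule LIMSEQ_Suc)
    ultimately show ?thesis by (rule LIMSEQ_unique)
  qed
  have "primitive_on b (\<lambda>t. F t (\<Phi> x t)) (\<Phi> x)"
    using \<Phi>(1)[OF xc] by (rule primitive_on_cong) (simp add: eq)
  then show ?thesis using \<Phi>(2)[OF xc] by blast
qed

section \<open>One-sided estimates for the norm\<close>

text \<open>
  An explicit Euler step. Up to \<open>o(h)\<close>, \<open>w (t + h)\<close> is
  \<open>(1 - h * (1 + e)) *\<^sub>R w t + h *\<^sub>R p + h *\<^sub>R q\<close>, and the bound on \<open>p\<close> absorbs all but \<open>h * e\<close> of the
  contraction. Working with the norm itself, not with its square or its derivative, avoids separating
  the case \<open>w t = 0\<close>.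
\<close>

lemma norm_right_dini_le:
  fixes w :: "real \<Rightarrow> 'a::real_normed_vector"
  assumes w: "(w has_vector_derivative (p - (1 + e) *\<^sub>R w t + q)) (at t)"
    and p: "norm p \<le> norm (w t)" and e: "e \<ge> 0" and \<kappa>: "\<kappa> > 0"
  shows "\<forall>\<^sub>F s in at_right t. norm (w s) \<le> (1 - (s - t) * e) * norm (w t) + (s - t) * (norm q + \<kappa>)"
proof -
  have "\<forall>\<^sub>F s in at_right t. s \<in> {t<..<t + 1 / (1 + e)}"
    using e by (intro eventually_at_right_real) simp
  with has_vector_derivative_eventually_at_right[OF w \<kappa>] show ?thesis
  proof eventually_elim
    case (elim s)
    define h where "h = s - t"
    have h: "h > 0" "h * (1 + e) \<le> 1" using elim(2) e by (auto simp: h_def field_simps)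
    let ?r = "w s - w t - h *\<^sub>R (p - (1 + e) *\<^sub>R w t + q)"
    have tri: "norm ((a + b) + (c + d)) \<le> (norm a + norm b) + (norm c + norm d)" for a b c d :: 'a
      by (intro order_trans[OF norm_triangle_ineq] add_mono norm_triangle_ineq)
    have "norm (w s) = norm (((1 - h * (1 + e)) *\<^sub>R w t + h *\<^sub>R p) + (h *\<^sub>R q + ?r))"
      by (simp add: algebra_simps)
    also have "\<dots> \<le> (norm ((1 - h * (1 + e)) *\<^sub>R w t) + norm (h *\<^sub>R p)) + (norm (h *\<^sub>R q) + norm ?r)"
      by (rule tri)
    also have "\<dots> \<le> ((1 - h * (1 + e)) * norm (w t) + h * norm (w t)) + (h * norm q + \<kappa> * h)"
      using h p elim(1) by (intro add_mono) (auto simp: h_def)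
    also have "\<dots> = (1 - h * e) * norm (w t) + h * (norm q + \<kappa>)"
      by (simp add: algebra_simps)
    finally show ?case by (simp add: h_def)
  qed
qed

lemma norm_nonincreasing_of_right_dini:
  fixes w :: "real \<Rightarrow> 'a::real_normed_vector"
  assumes ac: "abs_continuous_on {a..b} (\<lambda>t. norm (w t))" and "a \<le> b"
    and der: "AE t in lebesgue. t \<in> {a<..<b} \<longrightarrow> (\<forall>\<kappa>>0. \<forall>\<^sub>F s in at_right t.
        norm (w s) \<le> norm (w t) + (s - t) * \<kappa>)"
  shows "norm (w b) \<le> norm (w a)"
proof (rule abs_continuous_on_nonincreasing[OF ac \<open>a \<le> b\<close>])
  have iff: "norm (w s) \<le> norm (w t) + (s - t) * \<kappa> \<longleftrightarrow> norm (w s) - norm (w t) \<le> \<kappa> * (s - t)" for s t \<kappa>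
    by (simp add: algebra_simps)
  show "AE t in lebesgue. t \<in> {a<..<b} \<longrightarrow>
      (\<forall>\<kappa>>0. \<forall>\<^sub>F s in at_right t. norm (w s) - norm (w t) \<le> \<kappa> * (s - t))"
    using der unfolding iff .
qed

text \<open>
  Fix \<open>\<gamma>\<close>. After \<open>t0\<close>, an Euler step moves \<open>u\<close> towards a convex combination of \<open>u\<close> and \<open>\<gamma>\<close>, so
  \<open>max (u t) \<gamma>\<close> is nonincreasing. If \<open>u\<close> stayed above \<open>2 * \<gamma>\<close>, then \<open>u + \<gamma> * E\<close> would be nonincreasing as
  well, which is impossible because \<open>E\<close> is unbounded. Hence \<open>u\<close> drops below \<open>2 * \<gamma>\<close> and stays there.
\<close>

lemma right_dini_convergence:
  fixes u \<epsilon> E :: "real \<Rightarrow> real"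
  assumes ac: "\<And>b. abs_continuous_on {0..b} u" and u0: "\<And>t. t \<ge> 0 \<Longrightarrow> u t \<ge> 0"
    and eps: "\<And>t. t \<ge> 0 \<Longrightarrow> \<epsilon> t > 0"
    and E: "\<And>b. b \<ge> 0 \<Longrightarrow> primitive_on b \<epsilon> E" and unb: "\<And>B. \<exists>t\<ge>0. E t > B"
    and dini: "\<And>\<gamma>. \<gamma> > 0 \<Longrightarrow> \<exists>t0\<ge>0. AE t in lebesgue. t > t0 \<longrightarrow> (\<forall>\<kappa>>0. \<forall>\<^sub>F s in at_right t.
        u s \<le> (1 - (s - t) * \<epsilon> t) * u t + (s - t) * (\<gamma> * \<epsilon> t + \<kappa>))"
  shows "(u \<longlongrightarrow> 0) at_top"
proof (rule tendstoI)
  fix e :: real assume "e > 0"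
  define \<gamma> where "\<gamma> = e/3"
  have "\<gamma> > 0" using \<open>e > 0\<close> by (simp add: \<gamma>_def)
  then obtain t0 where t0: "t0 \<ge> 0" "AE t in lebesgue. t > t0 \<longrightarrow> (\<forall>\<kappa>>0. \<forall>\<^sub>F s in at_right t.
        u s \<le> (1 - (s - t) * \<epsilon> t) * u t + (s - t) * (\<gamma> * \<epsilon> t + \<kappa>))"
    using dini by blast
  have v: "max (u b) \<gamma> \<le> max (u a) \<gamma>" if ab: "t0 \<le> a" "a \<le> b" for a b
  proof (rule abs_continuous_on_nonincreasing[OF _ ab(2)])
    show "abs_continuous_on {a..b} (\<lambda>t. max (u t) \<gamma>)"
    proof (rule abs_continuous_on_dominated1[of _ u 1])
      show "abs_continuous_on {a..b} u"
        using ab t0(1) by (intro abs_continuous_on_subset[OF ac[of b]]) auto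
    qed (auto simp: max_def)
    show "AE t in lebesgue. t \<in> {a<..<b} \<longrightarrow>
        (\<forall>\<kappa>>0. \<forall>\<^sub>F s in at_right t. max (u s) \<gamma> - max (u t) \<gamma> \<le> \<kappa> * (s - t))"
      using t0(2)
    proof (rule eventually_mono, intro impI allI)
      fix t \<kappa> :: real
      assume "t > t0 \<longrightarrow> (\<forall>\<kappa>>0. \<forall>\<^sub>F s in at_right t.
          u s \<le> (1 - (s - t) * \<epsilon> t) * u t + (s - t) * (\<gamma> * \<epsilon> t + \<kappa>))" "t \<in> {a<..<b}" "\<kappa> > 0"
      then have ev: "\<forall>\<^sub>F s in at_right t. u s \<le> (1 - (s - t) * \<epsilon> t) * u t + (s - t) * (\<gamma> * \<epsilon> t + \<kappa>)"
        and "\<epsilon> t > 0" using ab t0(1) eps[of t] by auto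
      have "\<forall>\<^sub>F s in at_right t. s \<in> {t<..<t + 1 / \<epsilon> t}"
        using \<open>\<epsilon> t > 0\<close> by (intro eventually_at_right_real) simp
      with ev show "\<forall>\<^sub>F s in at_right t. max (u s) \<gamma> - max (u t) \<gamma> \<le> \<kappa> * (s - t)"
      proof eventually_elim
        case (elim s)
        define l where "l = (s - t) * \<epsilon> t"
        have l: "0 \<le> l" "l \<le> 1" using elim(2) \<open>\<epsilon> t > 0\<close> by (auto simp: l_def field_simps)
        have "(1 - l) * u t \<le> (1 - l) * max (u t) \<gamma>" "l * \<gamma> \<le> l * max (u t) \<gamma>"
          using l by (auto intro: mult_left_mono)
        moreover have "(1 - l) * max (u t) \<gamma> + l * max (u t) \<gamma> = max (u t) \<gamma>" by (simp add: algebra_simps)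
        moreover have "u s \<le> (1 - l) * u t + l * \<gamma> + \<kappa> * (s - t)"
          using elim(1) by (simp add: l_def algebra_simps)
        moreover have "0 \<le> \<kappa> * (s - t)" using elim(2) \<open>\<kappa> > 0\<close> by simp
        ultimately show ?case by linarith
      qed
    qed
  qed
  have "\<exists>t1\<ge>t0. u t1 \<le> 2 * \<gamma>"
  proof (rule ccontr)
    assume "\<not> ?thesis"
    then have big: "u t > 2 * \<gamma>" if "t \<ge> t0" for t using that by force
    have "u b + \<gamma> * E b \<le> u t0 + \<gamma> * E t0" if b: "t0 \<le> b" for b
    proof (rule abs_continuous_on_nonincreasing[OF _ b])
      have Eb: "primitive_on b \<epsilon> E" using E b t0(1) by auto
      have "abs_continuous_on {t0..b} (\<lambda>t. \<gamma> * E t)"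
      proof (rule abs_continuous_on_dominated1[of _ E \<gamma>])
        show "abs_continuous_on {t0..b} E"
          using Eb t0(1) unfolding primitive_on_def by (auto intro: abs_continuous_on_subset)
      qed (use \<open>\<gamma> > 0\<close> in \<open>auto simp: right_diff_distrib[symmetric] abs_mult\<close>)
      moreover have "abs_continuous_on {t0..b} u"
        using t0(1) by (intro abs_continuous_on_subset[OF ac[of b]]) auto
      ultimately show "abs_continuous_on {t0..b} (\<lambda>t. u t + \<gamma> * E t)"
        by (rule abs_continuous_on_add[rotated])
      show "AE t in lebesgue. t \<in> {t0<..<b} \<longrightarrow> (\<forall>\<kappa>>0. \<forall>\<^sub>F s in at_right t.
          (u s + \<gamma> * E s) - (u t + \<gamma> * E t) \<le> \<kappa> * (s - t))"
        using t0(2) Eb[unfolded primitive_on_def, THEN conjunct2]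
      proof eventually_elim
        case (elim t)
        show ?case
        proof (intro impI allI)
          fix \<kappa> :: real assume t: "t \<in> {t0<..<b}" and "\<kappa> > 0"
          define q where "q = \<kappa> / (1 + \<gamma>)"
          have "q > 0" "q * (1 + \<gamma>) = \<kappa>" using \<open>\<kappa> > 0\<close> \<open>\<gamma> > 0\<close> by (auto simp: q_def)
          then have q: "q > 0" "q + \<gamma> * q = \<kappa>" by (auto simp: algebra_simps)
          have "(E has_vector_derivative \<epsilon> t) (at t)" "\<epsilon> t > 0" using elim(2) t t0(1) eps[of t] by auto
          from has_vector_derivative_eventually_at_right[OF this(1) q(1)]
          have "\<forall>\<^sub>F s in at_right t. norm (E s - E t - (s - t) *\<^sub>R \<epsilon> t) \<le> q * (s - t)" .
          moreover have "\<forall>\<^sub>F s in at_right t. u s \<le> (1 - (s - t) * \<epsilon> t) * u t + (s - t) * (\<gamma> * \<epsilon> t + q)"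
            using elim(1) t q(1) by auto
          ultimately show "\<forall>\<^sub>F s in at_right t. (u s + \<gamma> * E s) - (u t + \<gamma> * E t) \<le> \<kappa> * (s - t)"
            using eventually_at_right_less[of t]
          proof eventually_elim
            case (elim s)
            have "E s - E t \<le> (s - t) * \<epsilon> t + q * (s - t)" using elim(1) by simp
            then have 1: "\<gamma> * (E s - E t) \<le> \<gamma> * ((s - t) * \<epsilon> t + q * (s - t))"
              using \<open>\<gamma> > 0\<close> by (intro mult_left_mono) auto
            have "(s - t) * \<epsilon> t * (2 * \<gamma>) \<le> (s - t) * \<epsilon> t * u t"
              using big[of t] t elim(3) \<open>\<epsilon> t > 0\<close> by (intro mult_left_mono) auto
            then have "(u s + \<gamma> * E s) - (u t + \<gamma> * E t) \<le> (q + \<gamma> * q) * (s - t)"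
              using 1 elim(2) by (simp add: algebra_simps)
            then show ?case using q(2) by simp
          qed
        qed
      qed
    qed
    then have bd: "\<gamma> * E b \<le> u t0 + \<gamma> * E t0" if "t0 \<le> b" for b
      using u0[of b] that t0(1) by fastforce
    have Emono: "E s \<le> E t" if "0 \<le> s" "s \<le> t" for s t
    proof -
      have "AE \<tau> in lebesgue. \<tau> \<in> {0<..<t} \<longrightarrow> norm (0::real) \<le> \<epsilon> \<tau>"
        using eps by (intro always_eventually) (auto intro: less_imp_le)
      from primitive_on_increment_le[OF primitive_on_zero E this that order_refl] that
      show ?thesis by simp
    qed
    obtain t where t: "t \<ge> 0" "E t > (u t0 + \<gamma> * E t0) / \<gamma>" using unb by blast
    have "E t \<le> E (max t t0)" using t by (intro Emono) auto
    moreover have "\<gamma> * E (max t t0) \<le> u t0 + \<gamma> * E t0" by (rule bd) simp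
    then have "E (max t t0) \<le> (u t0 + \<gamma> * E t0) / \<gamma>" using \<open>\<gamma> > 0\<close> by (simp add: field_simps)
    ultimately show False using t(2) by linarith
  qed
  then obtain t1 where t1: "t1 \<ge> t0" "u t1 \<le> 2 * \<gamma>" by blast
  have "dist (u t) 0 < e" if "t \<ge> t1" for t
  proof -
    have "max (u t) \<gamma> \<le> max (u t1) \<gamma>" using t1 that by (intro v)
    then have "u t \<le> 2 * \<gamma>" using t1(2) \<open>\<gamma> > 0\<close> by linarith
    then show ?thesis using u0[of t] t1(1) t0(1) that \<open>\<gamma> > 0\<close> by (simp add: \<gamma>_def)
  qed
  then show "\<forall>\<^sub>F t in at_top. dist (u t) 0 < e"
    unfolding eventually_at_top_linorder by blast
qed

section \<open>Existence and uniqueness for the regularized flow\<close>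

text \<open>
  The data of the equation alone, from which existence and uniqueness follow.
\<close>

locale regularized_flow =
  fixes D :: "'a::{real_inner, complete_space} set"
    and Tt :: "real \<Rightarrow> 'a \<Rightarrow> 'a" and \<epsilon> :: "real \<Rightarrow> real" and y :: "real \<Rightarrow> 'a"
  assumes D: "D \<noteq> {}" "closed D" "convex D"
    and Tt: "\<And>t. t > 0 \<Longrightarrow> nonexpansive_on D (Tt t)"
    and eps_pos: "\<And>t. t \<ge> 0 \<Longrightarrow> \<epsilon> t > 0"
    and y: "\<And>t. t \<ge> 0 \<Longrightarrow> y t \<in> D"
    and eps_cont: "\<And>b. continuous_on {0..b} \<epsilon>"
    and eps_decr: "antimono_on {0..} \<epsilon>"
    and y_cont: "\<And>b. continuous_on {0..b} y"
    and Tt_int: "\<And>x. x \<in> D \<Longrightarrow> loc_bochner_integrable (\<lambda>t. Tt t x)"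
begin

definition rhs :: "real \<Rightarrow> 'a \<Rightarrow> 'a" where
  "rhs t c = Tt t c - (1 + \<epsilon> t) *\<^sub>R c + \<epsilon> t *\<^sub>R y t"

definition solves_until :: "real \<Rightarrow> (real \<Rightarrow> 'a) \<Rightarrow> bool" where
  "solves_until b x \<longleftrightarrow> primitive_on b (\<lambda>t. rhs t (x t)) x \<and> (\<forall>t\<in>{0..b}. x t \<in> D)"

lemma Tt_in: "t > 0 \<Longrightarrow> c \<in> D \<Longrightarrow> Tt t c \<in> D"
  using Tt[of t] by (auto simp: nonexpansive_on_def)

lemma Tt_le: "t > 0 \<Longrightarrow> c \<in> D \<Longrightarrow> c' \<in> D \<Longrightarrow> norm (Tt t c - Tt t c') \<le> norm (c - c')"
  using Tt[of t] by (auto simp: nonexpansive_on_def)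

text \<open>
  The difference of two solutions satisfies the Euler step estimate with \<open>q = 0\<close>, by nonexpansiveness
  of \<open>Tt t\<close>.
\<close>

lemma solution_norm_diff_nonincreasing:
  assumes x: "solves_until b x" "solves_until b x'" and t: "0 \<le> t" "t \<le> b"
  shows "norm (x t - x' t) \<le> norm (x 0 - x' 0)"
proof (rule norm_nonincreasing_of_right_dini[OF _ t(1)])
  show "abs_continuous_on {0..t} (\<lambda>t. norm (x t - x' t))"
    using x t unfolding solves_until_def primitive_on_def
    by (auto intro!: abs_continuous_on_norm abs_continuous_on_diff intro: abs_continuous_on_subset)
  have "AE t in lebesgue. t \<in> {0<..<b} \<longrightarrow>
      ((\<lambda>t. x t - x' t) has_vector_derivative (rhs t (x t) - rhs t (x' t))) (at t)"
    using primitive_on_diff[OF x[unfolded solves_until_def, THEN conjunct1]]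
    by (simp only: primitive_on_def)
  then show "AE \<tau> in lebesgue. \<tau> \<in> {0<..<t} \<longrightarrow> (\<forall>\<kappa>>0. \<forall>\<^sub>F s in at_right \<tau>.
        norm (x s - x' s) \<le> norm (x \<tau> - x' \<tau>) + (s - \<tau>) * \<kappa>)"
  proof (rule eventually_mono, intro impI allI)
    fix \<tau> \<kappa> :: real assume *: "\<tau> \<in> {0<..<b} \<longrightarrow>
      ((\<lambda>t. x t - x' t) has_vector_derivative (rhs \<tau> (x \<tau>) - rhs \<tau> (x' \<tau>))) (at \<tau>)"
      "\<tau> \<in> {0<..<t}" "\<kappa> > 0"
    have \<tau>: "\<tau> > 0" "\<tau> < b" using * t by auto
    have inD: "x \<tau> \<in> D" "x' \<tau> \<in> D" using x \<tau> by (auto simp: solves_until_def)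
    have "rhs \<tau> (x \<tau>) - rhs \<tau> (x' \<tau>)
        = (Tt \<tau> (x \<tau>) - Tt \<tau> (x' \<tau>)) - (1 + \<epsilon> \<tau>) *\<^sub>R (x \<tau> - x' \<tau>) + 0"
      by (simp add: rhs_def algebra_simps)
    then have "((\<lambda>t. x t - x' t) has_vector_derivative
        ((Tt \<tau> (x \<tau>) - Tt \<tau> (x' \<tau>)) - (1 + \<epsilon> \<tau>) *\<^sub>R (x \<tau> - x' \<tau>) + 0)) (at \<tau>)"
      using * \<tau> by simp
    from norm_right_dini_le[OF this Tt_le[OF \<tau>(1) inD] _ \<open>\<kappa> > 0\<close>] eps_pos[of \<tau>] \<tau>
    have "\<forall>\<^sub>F s in at_right \<tau>. norm (x s - x' s) \<le> (1 - (s - \<tau>) * \<epsilon> \<tau>) * norm (x \<tau> - x' \<tau>) + (s - \<tau>) * (norm (0::'a) + \<kappa>)"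
      by simp
    then show "\<forall>\<^sub>F s in at_right \<tau>. norm (x s - x' s) \<le> norm (x \<tau> - x' \<tau>) + (s - \<tau>) * \<kappa>"
      using eventually_at_right_less[of \<tau>]
    proof eventually_elim
      case (elim s)
      have "0 \<le> (s - \<tau>) * \<epsilon> \<tau> * norm (x \<tau> - x' \<tau>)" using elim(2) eps_pos[of \<tau>] \<tau> by simp
      then show ?case using elim(1) by (simp add: algebra_simps)
    qed
  qed
qed

lemma solution_unique:
  assumes "solves_until b x" "solves_until b x'" "x 0 = x' 0" "0 \<le> t" "t \<le> b"
  shows "x t = x' t"
  using solution_norm_diff_nonincreasing[OF assms(1,2,4,5)] assms(3) by simp

text \<open>
  Composing \<open>Tt t\<close> with the projection \<open>R\<close> onto \<open>D\<close> gives a Lipschitz equation on the whole space.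
  From time \<open>t\<close> on, compare \<open>x\<close> with a convex combination of \<open>R (x t)\<close>, \<open>Tt t (R (x t))\<close> and
  \<open>y t\<close> that starts at \<open>R (x t)\<close> with velocity \<open>Tt t r - (1 + \<epsilon> t) *\<^sub>R r + \<epsilon> t *\<^sub>R y t\<close>, \<open>r = R (x t)\<close>. It lies in \<open>D\<close>,
  and \<open>x\<close> does not move away from it, so the distance from \<open>x\<close> to \<open>D\<close> is nonincreasing. A
  solution that starts in \<open>D\<close> therefore stays in \<open>D\<close>, where \<open>R\<close> is the identity.
\<close>

lemma solution_exists_until:
  assumes b: "b > 0" and x0: "x0 \<in> D"
  shows "\<exists>x. solves_until b x \<and> x 0 = x0"
proof -
  obtain R where R: "\<And>u. R u \<in> D" "\<And>u q. q \<in> D \<Longrightarrow> norm (u - R u) \<le> norm (u - q)"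
    "\<And>u v. norm (R u - R v) \<le> norm (u - v)"
    using nonexpansive_nearest_point_map[OF D(2,3,1)] by blast
  have R_id: "R u = u" if "u \<in> D" for u using R(2)[OF that, of u] by simp
  define F where "F t c = Tt t (R c) - (1 + \<epsilon> t) *\<^sub>R c + \<epsilon> t *\<^sub>R y t" for t c
  have eps_le: "\<epsilon> t \<le> \<epsilon> 0" if "t \<ge> 0" for t
    using eps_decr that unfolding monotone_on_def by auto
  have "\<exists>x. primitive_on b (\<lambda>t. F t (x t)) x \<and> x 0 = x0"
  proof (rule caratheodory_picard[OF b, of "2 + \<epsilon> 0"])
    show "2 + \<epsilon> 0 > 0" using eps_pos[of 0] by simp
  next
    fix u :: "real \<Rightarrow> 'a" assume u: "continuous_on {0..b} u"
    have "continuous_on UNIV R"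
      by (rule lipschitz_on_continuous_on[of 1]) (auto intro!: lipschitz_onI simp: dist_norm R(3))
    then have Ru: "continuous_on {0..b} (\<lambda>t. R (u t))"
      using u by (rule continuous_on_compose2) auto
    have "\<exists>G. primitive_on b (\<lambda>t. Tt t (R (u t))) G"
    proof (rule has_primitive_compose[OF b, of D Tt "\<lambda>t. R (u t)"])
      show "\<exists>G. primitive_on b (\<lambda>t. Tt t c) G" if "c \<in> D" for c
        using Tt_int[OF that] b by (intro has_primitive_bochner_integrable) (auto simp: loc_bochner_integrable_def)
    qed (use Tt_le R Ru in auto)
    moreover have "\<exists>G. primitive_on b (\<lambda>t. - (1 + \<epsilon> t) *\<^sub>R u t + \<epsilon> t *\<^sub>R y t) G"
      by (intro has_primitive_continuous[OF b] continuous_intros u eps_cont y_cont)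
    ultimately obtain G G' where "primitive_on b (\<lambda>t. Tt t (R (u t))) G"
      "primitive_on b (\<lambda>t. - (1 + \<epsilon> t) *\<^sub>R u t + \<epsilon> t *\<^sub>R y t) G'" by blast
    from primitive_on_add[OF this] show "\<exists>G. primitive_on b (\<lambda>t. F t (u t)) G"
      by (auto simp: F_def algebra_simps)
  next
    fix t c c' assume t: "t \<in> {0<..<b}"
    have "F t c - F t c' = (Tt t (R c) - Tt t (R c')) - (1 + \<epsilon> t) *\<^sub>R (c - c')"
      by (simp add: F_def algebra_simps)
    then have "norm (F t c - F t c') \<le> norm (Tt t (R c) - Tt t (R c')) + norm ((1 + \<epsilon> t) *\<^sub>R (c - c'))"
      by (metis norm_triangle_ineq4)
    also have "\<dots> \<le> norm (c - c') + (1 + \<epsilon> 0) * norm (c - c')"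
    proof (intro add_mono)
      show "norm (Tt t (R c) - Tt t (R c')) \<le> norm (c - c')"
        using Tt_le[of t "R c" "R c'"] R(1) R(3)[of c c'] t by (auto intro: order_trans)
      show "norm ((1 + \<epsilon> t) *\<^sub>R (c - c')) \<le> (1 + \<epsilon> 0) * norm (c - c')"
        unfolding norm_scaleR using eps_le[of t] eps_pos[of t] t by (intro mult_right_mono) auto
    qed
    finally show "norm (F t c - F t c') \<le> (2 + \<epsilon> 0) * norm (c - c')" by (simp add: algebra_simps)
  qed
  then obtain x where x: "primitive_on b (\<lambda>t. F t (x t)) x" "x 0 = x0" by blast
  have inv: "x t \<in> D" if t: "t \<in> {0..b}" for t
  proof -
    have "norm (x t - R (x t)) \<le> norm (x 0 - R (x 0))"
    proof (rule norm_nonincreasing_of_right_dini)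
      show "0 \<le> t" using t by simp
      show "abs_continuous_on {0..t} (\<lambda>t. norm (x t - R (x t)))"
      proof (rule abs_continuous_on_dominated1[of _ x 2])
        show "abs_continuous_on {0..t} x"
          using x(1) t by (auto simp: primitive_on_def intro: abs_continuous_on_subset)
        fix s t
        have "norm (norm (x t - R (x t)) - norm (x s - R (x s))) \<le> norm ((x t - R (x t)) - (x s - R (x s)))"
          by (simp add: norm_triangle_ineq3)
        also have "\<dots> = norm ((x t - x s) - (R (x t) - R (x s)))" by (simp add: algebra_simps)
        also have "\<dots> \<le> norm (x t - x s) + norm (R (x t) - R (x s))" by (rule norm_triangle_ineq4)
        finally show "norm (norm (x t - R (x t)) - norm (x s - R (x s))) \<le> 2 * norm (x t - x s)"
          using R(3)[of "x t" "x s"] by linarith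
      qed simp
      show "AE \<tau> in lebesgue. \<tau> \<in> {0<..<t} \<longrightarrow> (\<forall>\<kappa>>0. \<forall>\<^sub>F s in at_right \<tau>.
          norm (x s - R (x s)) \<le> norm (x \<tau> - R (x \<tau>)) + (s - \<tau>) * \<kappa>)"
        using x(1)[unfolded primitive_on_def, THEN conjunct2]
      proof (rule eventually_mono, intro impI allI)
        fix \<tau> \<kappa> :: real assume *: "\<tau> \<in> {0<..<b} \<longrightarrow> (x has_vector_derivative F \<tau> (x \<tau>)) (at \<tau>)"
          "\<tau> \<in> {0<..<t}" "\<kappa> > 0"
        have \<tau>: "\<tau> > 0" "\<tau> < b" "\<epsilon> \<tau> > 0" using * t eps_pos[of \<tau>] by auto
        let ?r = "R (x \<tau>)"
        let ?v = "Tt \<tau> ?r - (1 + \<epsilon> \<tau>) *\<^sub>R ?r + \<epsilon> \<tau> *\<^sub>R y \<tau>"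
        \<comment> \<open>a point of \<open>D\<close> for \<open>s\<close> slightly above \<open>\<tau>\<close>, used as a comparison point for the distance to \<open>D\<close>\<close>
        let ?c = "\<lambda>s. ?r + (s - \<tau>) *\<^sub>R ?v"
        have cD: "?c s \<in> D" if s: "s \<in> {\<tau><..<\<tau> + 1 / (1 + \<epsilon> \<tau>)}" for s
        proof -
          define h where "h = s - \<tau>"
          have h: "h > 0" "h * (1 + \<epsilon> \<tau>) \<le> 1" using s \<tau> by (auto simp: h_def field_simps)
          define v where "v = (1 / (1 + \<epsilon> \<tau>)) *\<^sub>R Tt \<tau> ?r + (\<epsilon> \<tau> / (1 + \<epsilon> \<tau>)) *\<^sub>R y \<tau>"
          have "v \<in> D" unfolding v_def
            using \<tau> Tt_in R(1) y by (intro convexD[OF D(3)]) (auto simp: field_simps)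
          then have "(1 - h * (1 + \<epsilon> \<tau>)) *\<^sub>R ?r + (h * (1 + \<epsilon> \<tau>)) *\<^sub>R v \<in> D"
            using h \<tau> R(1) by (intro convexD[OF D(3)]) auto
          moreover have "(h * (1 + \<epsilon> \<tau>)) *\<^sub>R v = h *\<^sub>R Tt \<tau> ?r + (h * \<epsilon> \<tau>) *\<^sub>R y \<tau>"
            using \<tau> by (simp add: v_def scaleR_add_right)
          ultimately have "(1 - h * (1 + \<epsilon> \<tau>)) *\<^sub>R ?r + (h *\<^sub>R Tt \<tau> ?r + (h * \<epsilon> \<tau>) *\<^sub>R y \<tau>) \<in> D" by simp
          also have "(1 - h * (1 + \<epsilon> \<tau>)) *\<^sub>R ?r + (h *\<^sub>R Tt \<tau> ?r + (h * \<epsilon> \<tau>) *\<^sub>R y \<tau>) = ?c s"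
            by (simp add: h_def[symmetric] algebra_simps)
          finally show ?thesis .
        qed
        have "((\<lambda>s. x s - ?c s) has_vector_derivative (F \<tau> (x \<tau>) - ?v)) (at \<tau>)"
          using * \<tau> by (auto intro!: derivative_eq_intros)
        moreover have "F \<tau> (x \<tau>) - ?v = 0 - (1 + \<epsilon> \<tau>) *\<^sub>R (x \<tau> - ?c \<tau>) + 0"
          by (simp add: F_def algebra_simps)
        ultimately have "((\<lambda>s. x s - ?c s) has_vector_derivative (0 - (1 + \<epsilon> \<tau>) *\<^sub>R (x \<tau> - ?c \<tau>) + 0)) (at \<tau>)"
          by simp
        from norm_right_dini_le[OF this _ _ \<open>\<kappa> > 0\<close>] \<tau>
        have "\<forall>\<^sub>F s in at_right \<tau>. norm (x s - ?c s) \<le> (1 - (s - \<tau>) * \<epsilon> \<tau>) * norm (x \<tau> - ?c \<tau>) + (s - \<tau>) * (norm (0::'a) + \<kappa>)"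
          by simp
        moreover have "\<forall>\<^sub>F s in at_right \<tau>. s \<in> {\<tau><..<\<tau> + 1 / (1 + \<epsilon> \<tau>)}"
          using \<tau> by (intro eventually_at_right_real) simp
        ultimately show "\<forall>\<^sub>F s in at_right \<tau>. norm (x s - R (x s)) \<le> norm (x \<tau> - ?r) + (s - \<tau>) * \<kappa>"
        proof eventually_elim
          case (elim s)
          have "0 \<le> (s - \<tau>) * \<epsilon> \<tau> * norm (x \<tau> - ?r)" using elim(2) \<tau> by simp
          moreover have "norm (x s - R (x s)) \<le> norm (x s - ?c s)" by (rule R(2)[OF cD[OF elim(2)]])
          ultimately show ?case using elim(1) by (simp add: algebra_simps)
        qed
      qed
    qed
    also have "\<dots> = 0" using x(2) R_id[OF x0] by simp
    finally show ?thesis using R(1)[of "x t"] by simp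
  qed
  have "primitive_on b (\<lambda>t. rhs t (x t)) x"
    using x(1) by (rule primitive_on_cong) (simp add: F_def rhs_def R_id inv)
  then show ?thesis using x(2) inv by (auto simp: solves_until_def)
qed

lemma solves_until_mono: "solves_until b x \<Longrightarrow> c \<le> b \<Longrightarrow> solves_until c x"
  unfolding solves_until_def primitive_on_def
  by (auto intro: abs_continuous_on_subset elim!: eventually_mono)

text \<open>
  On every bounded interval, being a solution means being a primitive of one's own right-hand side; the
  endpoints \<open>0\<close> and \<open>b\<close> are null sets.
\<close>

lemma is_solution_iff:
  "is_solution D Tt \<epsilon> y x0 x \<longleftrightarrow> (\<forall>b\<ge>0. solves_until b x) \<and> x 0 = x0"
proof
  assume *: "is_solution D Tt \<epsilon> y x0 x"
  then have ae: "AE t in lebesgue. t \<ge> 0 \<longrightarrow> x differentiable (at t) \<and>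
        - vector_derivative x (at t) = x t - Tt t (x t) + \<epsilon> t *\<^sub>R (x t - y t)"
    by (simp add: is_solution_def)
  have "AE t in lebesgue. t \<in> {0<..<b} \<longrightarrow> (x has_vector_derivative rhs t (x t)) (at t)" for b
    using ae
  proof (rule eventually_mono, intro impI)
    fix t assume "t \<ge> 0 \<longrightarrow> x differentiable (at t) \<and>
        - vector_derivative x (at t) = x t - Tt t (x t) + \<epsilon> t *\<^sub>R (x t - y t)" "t \<in> {0<..<b}"
    then have "x differentiable (at t)" and
      eq: "- vector_derivative x (at t) = x t - Tt t (x t) + \<epsilon> t *\<^sub>R (x t - y t)" by auto
    then have "(x has_vector_derivative vector_derivative x (at t)) (at t)"
      by (simp add: vector_derivative_works)
    also have "vector_derivative x (at t) = - (- vector_derivative x (at t))" by simp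
    also have "\<dots> = rhs t (x t)" unfolding eq by (simp add: rhs_def algebra_simps)
    finally show "(x has_vector_derivative rhs t (x t)) (at t)" .
  qed
  then show "(\<forall>b\<ge>0. solves_until b x) \<and> x 0 = x0"
    using * by (auto simp: is_solution_def solves_until_def primitive_on_def loc_abs_continuous_def)
next
  assume *: "(\<forall>b\<ge>0. solves_until b x) \<and> x 0 = x0"
  have "AE t in lebesgue. \<forall>n::nat. t \<in> {0<..<real n} \<longrightarrow> (x has_vector_derivative rhs t (x t)) (at t)"
    unfolding AE_all_countable using * by (auto simp: solves_until_def primitive_on_def)
  moreover have "AE t in lebesgue. t \<noteq> (0::real)" by (intro AE_completion AE_lborel_singleton)
  ultimately have "AE t in lebesgue. t \<ge> 0 \<longrightarrow> x differentiable (at t) \<and>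
        - vector_derivative x (at t) = x t - Tt t (x t) + \<epsilon> t *\<^sub>R (x t - y t)"
  proof (eventually_elim, intro impI)
    fix t :: real assume t: "\<forall>n::nat. t \<in> {0<..<real n} \<longrightarrow> (x has_vector_derivative rhs t (x t)) (at t)"
      "t \<noteq> 0" "t \<ge> 0"
    obtain n :: nat where "t < real n" using reals_Archimedean2 by blast
    then have d: "(x has_vector_derivative rhs t (x t)) (at t)" using t by auto
    then have "x differentiable (at t)" by (rule differentiableI_vector)
    moreover have "vector_derivative x (at t) = rhs t (x t)" using d by (rule vector_derivative_at)
    ultimately show "x differentiable (at t) \<and>
        - vector_derivative x (at t) = x t - Tt t (x t) + \<epsilon> t *\<^sub>R (x t - y t)"
      by (simp add: rhs_def algebra_simps)
  qed
  then show "is_solution D Tt \<epsilon> y x0 x"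
    using * by (auto simp: is_solution_def solves_until_def primitive_on_def loc_abs_continuous_def)
qed

lemma is_solution_unique:
  assumes "is_solution D Tt \<epsilon> y x0 x" "is_solution D Tt \<epsilon> y x0 x'" "t \<ge> 0"
  shows "x' t = x t"
  using assms solution_unique[of t x' x t] by (auto simp: is_solution_iff)

text \<open>
  By uniqueness, the solutions on \<open>{0..n + 1}\<close> agree where they are jointly defined.
\<close>

lemma is_solution_exists:
  assumes x0: "x0 \<in> D"
  shows "\<exists>x. is_solution D Tt \<epsilon> y x0 x"
proof -
  have "\<exists>x. solves_until (real (Suc n)) x \<and> x 0 = x0" for n
    by (rule solution_exists_until[OF _ x0]) simp
  then obtain X where X: "\<And>n. solves_until (real (Suc n)) (X n)" "\<And>n. X n 0 = x0" by metis
  define x where "x t = X (nat \<lceil>t\<rceil>) t" for t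
  have same: "X n t = X m t" if "0 \<le> t" "t \<le> real (Suc n)" "t \<le> real (Suc m)" for n m t
  proof -
    have "solves_until (min (real (Suc n)) (real (Suc m))) (X n)"
      "solves_until (min (real (Suc n)) (real (Suc m))) (X m)"
      by (rule solves_until_mono[OF X(1)], simp)+
    from solution_unique[OF this] show ?thesis using X(2) that by auto
  qed
  have eq: "x t = X n t" if "0 \<le> t" "t \<le> real (Suc n)" for n t
  proof -
    have "t \<le> real (Suc (nat \<lceil>t\<rceil>))" using that(1) by linarith
    then show ?thesis unfolding x_def using that by (intro same)
  qed
  have "solves_until b x" if "b \<ge> 0" for b
  proof -
    obtain n :: nat where n: "b \<le> real n" using real_arch_simple by blast
    then have Xb: "solves_until b (X n)" by (intro solves_until_mono[OF X(1)]) simp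
    have eqb: "x t = X n t" if "t \<in> {0..b}" for t using that n by (intro eq) auto
    have "abs_continuous_on {0..b} x"
      using Xb eqb unfolding solves_until_def primitive_on_def
      by (auto intro: abs_continuous_on_dominated1[of _ "X n" 1])
    moreover have "AE t in lebesgue. t \<in> {0<..<b} \<longrightarrow> (x has_vector_derivative rhs t (x t)) (at t)"
      using Xb[unfolded solves_until_def primitive_on_def, THEN conjunct1, THEN conjunct2]
    proof (rule eventually_mono, intro impI)
      fix t assume t: "t \<in> {0<..<b} \<longrightarrow> (X n has_vector_derivative rhs t (X n t)) (at t)" "t \<in> {0<..<b}"
      have "(X n has_vector_derivative rhs t (x t)) (at t)" using t eqb[of t] by auto
      then show "(x has_vector_derivative rhs t (x t)) (at t)"
        by (rule has_vector_derivative_transform_within_open[where S = "{0<..<b}"]) (use t eqb in auto)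
    qed
    ultimately show ?thesis using Xb eqb by (simp add: solves_until_def primitive_on_def)
  qed
  moreover have "x 0 = x0" using eq[of 0 0] X(2) by simp
  ultimately show ?thesis using is_solution_iff by blast
qed

end

section \<open>Regularized fixed points\<close>

locale nonexpansive_map =
  fixes D :: "'a::{real_inner, complete_space} set" and T :: "'a \<Rightarrow> 'a" and u :: 'a
  assumes D: "closed D" "convex D" and T: "nonexpansive_on D T"
    and Fix: "Fix D T \<noteq> {}" and u: "u \<in> D"
begin

lemma T_in: "z \<in> D \<Longrightarrow> T z \<in> D"
  using T by (auto simp: nonexpansive_on_def)

lemma T_le: "z \<in> D \<Longrightarrow> z' \<in> D \<Longrightarrow> norm (T z - T z') \<le> norm (z - z')"
  using T by (auto simp: nonexpansive_on_def)

text \<open>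
  By the Cauchy-Schwarz inequality. The estimates for the regularized fixed points are instances of this inequality
  for suitable pairs of points.
\<close>

lemma displacement_monotone:
  assumes "z \<in> D" "z' \<in> D"
  shows "inner ((z - T z) - (z' - T z')) (z - z') \<ge> 0"
proof -
  have "inner (T z - T z') (z - z') \<le> norm (T z - T z') * norm (z - z')" by (rule norm_cauchy_schwarz)
  also have "\<dots> \<le> norm (z - z') * norm (z - z')" using T_le[OF assms] by (intro mult_right_mono) auto
  also have "\<dots> = inner (z - z') (z - z')" by (simp add: power2_norm_eq_inner[symmetric] power2_eq_square)
  finally show ?thesis by (simp add: inner_simps)
qed

abbreviation reg :: "real \<Rightarrow> 'a" where "reg e \<equiv> reg_point D T e u"

text \<open>
  The equation says that \<open>z\<close> is a fixed point of the contraction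
  \<open>z \<mapsto> (T z + e *\<^sub>R u) /\<^sub>R (1 + e)\<close> of \<open>D\<close>.
\<close>

lemma reg_ex1:
  assumes e: "e > 0"
  shows "\<exists>!z. z \<in> D \<and> e *\<^sub>R z + z - T z = e *\<^sub>R u"
proof -
  define f where "f z = (1 / (1 + e)) *\<^sub>R T z + (e / (1 + e)) *\<^sub>R u" for z
  have "\<exists>!z\<in>D. f z = z"
  proof (rule Banach_fix[of D "1 / (1 + e)"])
    show "complete D" using D(1) by (simp add: complete_eq_closed)
    show "D \<noteq> {}" using u by blast
    show "f ` D \<subseteq> D"
    proof
      fix w assume "w \<in> f ` D"
      then obtain z where z: "z \<in> D" "w = f z" by blast
      have "1 / (1 + e) + e / (1 + e) = 1" using e by (simp add: add_divide_distrib[symmetric])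
      then show "w \<in> D"
        unfolding z(2) f_def using e T_in[OF z(1)] u by (intro convexD[OF D(2)]) auto
    qed
    show "dist (f z) (f z') \<le> 1 / (1 + e) * dist z z'" if "z \<in> D" "z' \<in> D" for z z'
    proof -
      have "f z - f z' = (1 / (1 + e)) *\<^sub>R (T z - T z')" by (simp add: f_def scaleR_diff_right)
      then have "dist (f z) (f z') = 1 / (1 + e) * norm (T z - T z')" using e by (simp add: dist_norm)
      also have "\<dots> \<le> 1 / (1 + e) * dist z z'"
        unfolding dist_norm using T_le[OF that] e by (intro mult_left_mono) auto
      finally show ?thesis .
    qed
  qed (use e in auto)
  moreover have "f z = z \<longleftrightarrow> e *\<^sub>R z + z - T z = e *\<^sub>R u" for z
  proof -
    have "f z = z \<longleftrightarrow> (1 + e) *\<^sub>R f z = (1 + e) *\<^sub>R z" using e by simp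
    also have "(1 + e) *\<^sub>R f z = T z + e *\<^sub>R u" using e by (simp add: f_def scaleR_add_right)
    also have "T z + e *\<^sub>R u = (1 + e) *\<^sub>R z \<longleftrightarrow> e *\<^sub>R z + z - T z = e *\<^sub>R u"
      by (auto simp: algebra_simps)
    finally show ?thesis .
  qed
  ultimately show ?thesis by simp
qed

lemma reg:
  assumes e: "e > 0"
  shows "reg e \<in> D" "reg e - T (reg e) = e *\<^sub>R (u - reg e)"
proof -
  have "reg e \<in> D \<and> e *\<^sub>R reg e + reg e - T (reg e) = e *\<^sub>R u"
    unfolding reg_point_def by (rule theI'[OF reg_ex1[OF e]])
  then show "reg e \<in> D" "reg e - T (reg e) = e *\<^sub>R (u - reg e)"
    by (auto simp: algebra_simps)
qed

lemma reg_inner_fixed_point: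
  assumes e: "e > 0" and p: "p \<in> Fix D T"
  shows "inner (u - reg e) (reg e - p) \<ge> 0"
proof -
  have "p \<in> D" "T p = p" using p by (auto simp: Fix_def)
  then have "0 \<le> e * inner (u - reg e) (reg e - p)"
    using displacement_monotone[OF reg(1)[OF e], of p] reg(2)[OF e] by simp
  then show ?thesis using e by (simp add: zero_le_mult_iff)
qed

lemma norm_reg_le:
  assumes e: "e > 0" and p: "p \<in> Fix D T"
  shows "norm (u - reg e) \<le> norm (u - p)"
proof -
  have "(norm (u - reg e))\<^sup>2 = inner (u - reg e) (u - p) - inner (u - reg e) (reg e - p)"
    by (simp add: power2_norm_eq_inner inner_simps)
  also have "\<dots> \<le> norm (u - reg e) * norm (u - p)"
    using reg_inner_fixed_point[OF assms] norm_cauchy_schwarz[of "u - reg e" "u - p"] by linarith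
  finally show ?thesis by (auto simp: power2_eq_square mult_le_cancel_left split: if_splits)
qed

lemma norm_reg_le_infdist:
  assumes e: "e > 0"
  shows "norm (u - reg e) \<le> infdist u (Fix D T)"
  unfolding infdist_def using Fix norm_reg_le[OF e] by (auto intro!: cINF_greatest simp: dist_norm)

text \<open>
  Bounds the speed of \<open>t \<mapsto> reg (\<epsilon> t)\<close> by \<open>\<bar>\<epsilon>'\<bar> / \<epsilon>\<close> times the distance of \<open>u\<close> to the fixed
  points, the term with \<open>d\<close> in \<open>\<psi>\<close>. It follows from monotonicity applied to \<open>reg e\<close> and \<open>reg e'\<close>.
\<close>

lemma reg_lipschitz:
  assumes e: "e > 0" "e' > 0"
  shows "norm (reg e' - reg e) \<le> \<bar>e' - e\<bar> / e * infdist u (Fix D T)"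
proof -
  have "0 \<le> inner (e *\<^sub>R (u - reg e) - e' *\<^sub>R (u - reg e')) (reg e - reg e')"
    using displacement_monotone[OF reg(1)[OF e(1)] reg(1)[OF e(2)]] reg(2) e by simp
  also have "\<dots> = (e - e') * inner (u - reg e') (reg e - reg e') - e * (norm (reg e' - reg e))\<^sup>2"
    by (simp add: power2_norm_eq_inner inner_simps algebra_simps inner_commute)
  finally have "e * (norm (reg e' - reg e))\<^sup>2 \<le> (e - e') * inner (u - reg e') (reg e - reg e')" by simp
  also have "\<dots> \<le> \<bar>e - e'\<bar> * \<bar>inner (u - reg e') (reg e - reg e')\<bar>"
    unfolding abs_mult[symmetric] by (rule abs_ge_self)
  also have "\<dots> \<le> \<bar>e' - e\<bar> * (infdist u (Fix D T) * norm (reg e' - reg e))"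
  proof -
    have "\<bar>inner (u - reg e') (reg e - reg e')\<bar> \<le> norm (u - reg e') * norm (reg e - reg e')"
      by (rule Cauchy_Schwarz_ineq2)
    also have "\<dots> \<le> infdist u (Fix D T) * norm (reg e' - reg e)"
      using norm_reg_le_infdist[OF e(2)] by (simp add: norm_minus_commute mult_right_mono)
    finally show ?thesis by (simp add: abs_minus_commute mult_left_mono)
  qed
  finally have "(e * norm (reg e' - reg e)) * norm (reg e' - reg e)
      \<le> (\<bar>e' - e\<bar> * infdist u (Fix D T)) * norm (reg e' - reg e)"
    by (simp add: power2_eq_square mult_ac)
  then have "e * norm (reg e' - reg e) \<le> \<bar>e' - e\<bar> * infdist u (Fix D T)"
    by (cases "reg e' = reg e") (auto simp: infdist_nonneg)
  then show ?thesis using e(1) by (simp add: field_simps)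
qed

text \<open>
  With \<open>a = u - reg e\<close> and \<open>b = u - reg e'\<close>, monotonicity gives
  \<open>(e + e') * (norm (a - b))\<^sup>2 \<le> (e' - e) * ((norm a)\<^sup>2 - (norm b)\<^sup>2)\<close>, and \<open>e' - e \<le> e + e'\<close>.
\<close>

lemma reg_dist_squared_le:
  assumes e: "0 < e" "e \<le> e'"
  shows "(norm (reg e - reg e'))\<^sup>2 \<le> (norm (u - reg e))\<^sup>2 - (norm (u - reg e'))\<^sup>2"
proof -
  have e': "e' > 0" using e by simp
  let ?a = "u - reg e" and ?b = "u - reg e'"
  have "reg e - reg e' = ?b - ?a" by simp
  then have "0 \<le> inner (e *\<^sub>R ?a - e' *\<^sub>R ?b) (?b - ?a)"
    using displacement_monotone[OF reg(1)[OF e(1)] reg(1)[OF e']]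
    unfolding reg(2)[OF e(1)] reg(2)[OF e'] by simp
  moreover have "inner (e *\<^sub>R a - e' *\<^sub>R b) (b - a) = (e + e') * inner a b - e * inner a a - e' * inner b b"
    for a b :: 'a
    by (simp add: inner_diff_left inner_diff_right inner_commute[of b a] algebra_simps)
  ultimately have m: "0 \<le> (e + e') * inner ?a ?b - e * inner ?a ?a - e' * inner ?b ?b"
    by (simp only:)
  have sq: "(norm (a - b))\<^sup>2 = inner a a + inner b b - 2 * inner a b" for a b :: 'a
    by (simp add: power2_norm_eq_inner inner_diff_left inner_diff_right inner_commute[of b a])
  have "(e + e') * (norm (?a - ?b))\<^sup>2 = (e + e') * (inner ?a ?a + inner ?b ?b) - 2 * ((e + e') * inner ?a ?b)"
    unfolding sq right_diff_distrib by simp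
  also have "\<dots> \<le> (e + e') * (inner ?a ?a + inner ?b ?b) - 2 * (e * inner ?a ?a + e' * inner ?b ?b)"
  proof -
    have "q + r \<le> p" if "0 \<le> p - q - r" for p q r :: real using that by linarith
    from this[OF m] show ?thesis by (intro diff_left_mono mult_left_mono) auto
  qed
  also have "\<dots> = (e' - e) * (inner ?a ?a - inner ?b ?b)" by (simp only: algebra_simps)
  finally have *: "(e + e') * (norm (?a - ?b))\<^sup>2 \<le> (e' - e) * ((norm ?a)\<^sup>2 - (norm ?b)\<^sup>2)"
    by (simp only: power2_norm_eq_inner)
  define N where "N = (norm ?a)\<^sup>2 - (norm ?b)\<^sup>2"
  have "N \<ge> 0 \<or> (norm (?a - ?b))\<^sup>2 = 0"
  proof (rule ccontr)
    assume "\<not> ?thesis"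
    then have "N < 0" "(norm (?a - ?b))\<^sup>2 > 0" by auto
    then have "(e' - e) * N \<le> 0" "(e + e') * (norm (?a - ?b))\<^sup>2 > 0"
      using e e' by (auto simp: mult_le_0_iff)
    then show False using * by (simp add: N_def)
  qed
  then show ?thesis
  proof
    assume "N \<ge> 0"
    then have "(e' - e) * N \<le> (e + e') * N" using e by (intro mult_right_mono) auto
    then have "(e + e') * (norm (?a - ?b))\<^sup>2 \<le> (e + e') * N" using * by (simp add: N_def)
    then have "(norm (?a - ?b))\<^sup>2 \<le> N" using e e' by simp
    then show ?thesis by (simp add: N_def norm_minus_commute)
  next
    assume "(norm (?a - ?b))\<^sup>2 = 0"
    then show ?thesis by simp
  qed
qed

text \<open>
  The squared norms of \<open>u - reg e\<close> are bounded and monotone in \<open>e\<close>, so \<open>reg\<close> satisfies the Cauchy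
  criterion at \<open>0\<close>. The displacement \<open>e *\<^sub>R (u - reg e)\<close> tends to \<open>0\<close>, hence the limit \<open>z\<close> is a
  fixed point. Passing to the limit in \<open>reg_inner_fixed_point\<close> gives the obtuse angle condition, from which \<open>z\<close>
  is the unique nearest fixed point.
\<close>

lemma reg_tendsto: "(reg \<longlongrightarrow> metric_proj (Fix D T) u) (at_right 0)"
proof -
  define N where "N e = (norm (u - reg e))\<^sup>2" for e
  define en where "en n = inverse (real (Suc n))" for n
  have en: "en n > 0" for n by (simp add: en_def)
  have en_lim: "en \<longlonglongrightarrow> 0" unfolding en_def by (rule LIMSEQ_inverse_real_of_nat)
  have en_mono: "en m \<le> en n" if "n \<le> m" for m n using that by (simp add: en_def le_imp_inverse_le)
  obtain p where p: "p \<in> Fix D T" using Fix by blast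
  have Nbd: "N e \<le> (norm (u - p))\<^sup>2" if "e > 0" for e
    unfolding N_def using norm_reg_le[OF that p] by (intro power_mono) auto
  have Nmono: "N e' \<le> N e" if "0 < e" "e \<le> e'" for e e'
    using reg_dist_squared_le[OF that] zero_le_power2[of "norm (reg e - reg e')"] unfolding N_def by linarith
  have "incseq (\<lambda>n. N (en n))" using Nmono[OF en en_mono] by (auto simp: incseq_def)
  then obtain S where S: "(\<lambda>n. N (en n)) \<longlonglongrightarrow> S" "\<And>n. N (en n) \<le> S"
    using incseq_convergent[of "\<lambda>n. N (en n)" "(norm (u - p))\<^sup>2"] Nbd en by metis
  have NS: "N e \<le> S" if "e > 0" for e
  proof -
    obtain n where "en n < e" using reals_Archimedean[OF \<open>e > 0\<close>] by (auto simp: en_def)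
    then have "N e \<le> N (en n)" by (intro Nmono en) simp
    then show ?thesis using S(2)[of n] by linarith
  qed
  have close: "norm (reg e - reg (en n)) < r" if "0 < e" "e \<le> en n" "S - N (en n) < r\<^sup>2" "r > 0" for e n r
  proof -
    have "(norm (reg e - reg (en n)))\<^sup>2 \<le> N e - N (en n)"
      unfolding N_def by (rule reg_dist_squared_le[OF that(1,2)])
    then have "(norm (reg e - reg (en n)))\<^sup>2 < r\<^sup>2" using NS[OF that(1)] that(3) by linarith
    then show ?thesis using that(4) by (simp add: power_less_imp_less_base)
  qed
  have small: "\<exists>n. S - N (en n) < r\<^sup>2" if "r > 0" for r
  proof -
    have "\<forall>\<^sub>F n in sequentially. dist (N (en n)) S < r\<^sup>2" using S(1) that by (intro tendstoD) auto
    then obtain n where "dist (N (en n)) S < r\<^sup>2"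
      using eventually_happens'[OF sequentially_bot] by blast
    then show ?thesis using S(2)[of n] by (intro exI[of _ n]) (simp add: dist_real_def)
  qed
  have "Cauchy (\<lambda>n. reg (en n))"
  proof (rule metric_CauchyI)
    fix r :: real assume "r > 0"
    then obtain n0 where n0: "S - N (en n0) < (r/2)\<^sup>2" using small[of "r/2"] by auto
    show "\<exists>M. \<forall>m\<ge>M. \<forall>n\<ge>M. dist (reg (en m)) (reg (en n)) < r"
    proof (intro exI allI impI)
      fix m n assume "n0 \<le> m" "n0 \<le> n"
      then have "norm (reg (en m) - reg (en n0)) < r/2" "norm (reg (en n) - reg (en n0)) < r/2"
        using close[OF en en_mono n0] \<open>r > 0\<close> by auto
      then show "dist (reg (en m)) (reg (en n)) < r"
        using dist_triangle_half_r[of "reg (en n0)" "reg (en m)" r "reg (en n)"]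
        by (simp add: dist_norm norm_minus_commute)
    qed
  qed
  then obtain z where z: "(\<lambda>n. reg (en n)) \<longlonglongrightarrow> z" using Cauchy_convergent_iff convergent_def by blast
  have "z \<in> D" using closed_sequentially[OF D(1) reg(1)[OF en] z] .
  have Tz: "(\<lambda>n. T (reg (en n))) \<longlonglongrightarrow> T z"
  proof (rule LIM_zero_cancel, rule Lim_null_comparison)
    show "\<forall>\<^sub>F n in sequentially. norm (T (reg (en n)) - T z) \<le> norm (reg (en n) - z)"
      using T_le[OF reg(1)[OF en] \<open>z \<in> D\<close>] by simp
    show "(\<lambda>n. norm (reg (en n) - z)) \<longlonglongrightarrow> 0" using z by (simp add: LIM_zero tendsto_norm_zero)
  qed
  have "(\<lambda>n. reg (en n) - T (reg (en n))) \<longlonglongrightarrow> 0"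
    unfolding reg(2)[OF en] using tendsto_scaleR[OF en_lim tendsto_diff[OF tendsto_const z], of u] by simp
  moreover have "(\<lambda>n. reg (en n) - T (reg (en n))) \<longlonglongrightarrow> z - T z" by (intro tendsto_diff z Tz)
  ultimately have "z - T z = 0" using LIMSEQ_unique by blast
  then have zF: "z \<in> Fix D T" using \<open>z \<in> D\<close> by (simp add: Fix_def)
  have zin: "inner (u - z) (z - q) \<ge> 0" if "q \<in> Fix D T" for q
  proof (rule LIMSEQ_le_const)
    show "(\<lambda>n. inner (u - reg (en n)) (reg (en n) - q)) \<longlonglongrightarrow> inner (u - z) (z - q)"
      by (intro tendsto_intros z)
    show "\<exists>N. \<forall>n\<ge>N. 0 \<le> inner (u - reg (en n)) (reg (en n) - q)"
      using reg_inner_fixed_point[OF en that] by blast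
  qed
  have pyth: "(dist u z)\<^sup>2 + (dist z q)\<^sup>2 \<le> (dist u q)\<^sup>2" if "q \<in> Fix D T" for q
  proof -
    have "(dist u q)\<^sup>2 = (dist u z)\<^sup>2 + (dist z q)\<^sup>2 + 2 * inner (u - z) (z - q)"
      unfolding dist_norm power2_norm_eq_inner by (simp add: inner_simps inner_commute)
    then show ?thesis using zin[OF that] by linarith
  qed
  have "metric_proj (Fix D T) u = z"
    unfolding metric_proj_def
  proof (rule the_equality)
    show "z \<in> Fix D T \<and> (\<forall>q\<in>Fix D T. dist u z \<le> dist u q)"
    proof (intro conjI zF ballI)
      fix q assume "q \<in> Fix D T"
      then have "(dist u z)\<^sup>2 \<le> (dist u q)\<^sup>2" using pyth[of q] zero_le_power2[of "dist z q"] by linarith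
      then show "dist u z \<le> dist u q" by (rule power2_le_imp_le) simp
    qed
    fix q assume q: "q \<in> Fix D T \<and> (\<forall>r\<in>Fix D T. dist u q \<le> dist u r)"
    then have "(dist u q)\<^sup>2 \<le> (dist u z)\<^sup>2" using zF by (intro power_mono) auto
    then have "(dist z q)\<^sup>2 \<le> 0" using pyth[of q] q by linarith
    then show "q = z" by simp
  qed
  moreover have "(reg \<longlongrightarrow> z) (at_right 0)"
  proof (rule tendstoI)
    fix r :: real assume "r > 0"
    obtain n0 where n0: "S - N (en n0) < (r/2)\<^sup>2" using small[of "r/2"] \<open>r > 0\<close> by auto
    have zn: "norm (z - reg (en n0)) \<le> r/2"
    proof (rule Lim_bounded)
      show "(\<lambda>n. norm (reg (en n) - reg (en n0))) \<longlonglongrightarrow> norm (z - reg (en n0))"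
        by (intro tendsto_intros z)
      show "\<forall>n\<ge>n0. norm (reg (en n) - reg (en n0)) \<le> r/2"
        using close[OF en en_mono n0] \<open>r > 0\<close> by (auto intro: less_imp_le)
    qed
    have "\<forall>\<^sub>F e in at_right 0. e \<in> {0<..<en n0}" by (rule eventually_at_right_real[OF en])
    then show "\<forall>\<^sub>F e in at_right 0. dist (reg e) z < r"
    proof eventually_elim
      case (elim e)
      then have "norm (reg e - reg (en n0)) < r/2" using close[of e n0 "r/2"] n0 \<open>r > 0\<close> by auto
      then show ?case
        using zn norm_triangle_ineq4[of "reg e - reg (en n0)" "z - reg (en n0)"] by (simp add: dist_norm)
    qed
  qed
  ultimately show ?thesis by simp
qed

end

section \<open>Convergence of the regularized flow\<close>

theorem theorem1:
  fixes D :: "'a::{real_inner, complete_space} set"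
    and T :: "'a \<Rightarrow> 'a"
    and Tt :: "real \<Rightarrow> 'a \<Rightarrow> 'a"
    and \<epsilon> :: "real \<Rightarrow> real"
    and y :: "real \<Rightarrow> 'a"
    and yinf x0 :: 'a
  assumes "D \<noteq> {}" and "closed D" and "convex D"
    and "nonexpansive_on D T" and "Fix D T \<noteq> {}"
    and "\<And>t. t > 0 \<Longrightarrow> nonexpansive_on D (Tt t)"
    and "\<And>t. t \<ge> 0 \<Longrightarrow> \<epsilon> t > 0"
    and "\<And>t. t \<ge> 0 \<Longrightarrow> y t \<in> D" and "yinf \<in> D"
    and eps_ac: "abs_continuous_on {0..} \<epsilon>"
    and eps_decr: "antimono_on {0..} \<epsilon>"
    and eps_lim: "(\<epsilon> \<longlongrightarrow> 0) at_top"
    and eps_int: "(\<integral>\<^sup>+s\<in>{0..}. ennreal (\<epsilon> s) \<partial>lebesgue) = \<infinity>"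
    and y_ac: "loc_abs_continuous y"
    and y_lim: "(y \<longlongrightarrow> yinf) at_top"
    and y_deriv: "ess_tendsto (\<lambda>t. norm (vector_derivative y (at t))) 0"
    and Tt_int: "\<And>x. x \<in> D \<Longrightarrow> loc_bochner_integrable (\<lambda>t. Tt t x)"
    and psi_lim: "ess_tendsto (\<lambda>t. psi D T Tt \<epsilon> y yinf t / \<epsilon> t) 0"
    and "x0 \<in> D"
  shows "\<exists>x. is_solution D Tt \<epsilon> y x0 x \<and>
             (\<forall>x'. is_solution D Tt \<epsilon> y x0 x' \<longrightarrow> (\<forall>t\<ge>0. x' t = x t)) \<and>
             (x \<longlongrightarrow> metric_proj (Fix D T) yinf) at_top"
proof -
  note eps_pos = assms(7)
  have eps_ac_b: "abs_continuous_on {0..b} \<epsilon>" for b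
    by (rule abs_continuous_on_subset[OF eps_ac]) auto
  have eps_cont: "continuous_on {0..b} \<epsilon>" for b
    by (rule abs_continuous_on_imp_continuous_on[OF eps_ac_b]) (simp add: is_interval_cc)
  have y_cont: "continuous_on {0..b} y" for b
  proof (cases "b \<ge> 0")
    case True
    then show ?thesis
      using y_ac by (intro abs_continuous_on_imp_continuous_on)
        (auto simp: loc_abs_continuous_def is_interval_cc)
  qed auto
  interpret flow: regularized_flow D Tt \<epsilon> y
    by unfold_locales (fact assms eps_cont y_cont)+
  interpret T: nonexpansive_map D T yinf
    by unfold_locales (fact assms)+
  obtain x where x: "is_solution D Tt \<epsilon> y x0 x"
    using flow.is_solution_exists[OF \<open>x0 \<in> D\<close>] by blast
  define d where "d = infdist yinf (Fix D T)"
  have d0: "d \<ge> 0" by (simp add: d_def infdist_nonneg)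
  define z where "z t = reg_point D T (\<epsilon> t) yinf" for t
  have zD: "z t \<in> D" and z_eq: "z t - T (z t) = \<epsilon> t *\<^sub>R (yinf - z t)" if "t \<ge> 0" for t
    unfolding z_def using T.reg[OF eps_pos[OF that]] by auto
  have z_lip: "norm (z s - z t) \<le> \<bar>\<epsilon> s - \<epsilon> t\<bar> / \<epsilon> t * d" if "s \<ge> 0" "t \<ge> 0" for s t
    unfolding z_def d_def using T.reg_lipschitz[OF eps_pos eps_pos] that by blast
  have eps_le: "\<epsilon> t \<le> \<epsilon> s" if "0 \<le> s" "s \<le> t" for s t
    using eps_decr that unfolding monotone_on_def by auto
  have z_lim: "(z \<longlongrightarrow> metric_proj (Fix D T) yinf) at_top"
  proof -
    have "filterlim \<epsilon> (at_right 0) at_top"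
      unfolding filterlim_at
    proof (intro conjI eps_lim)
      show "\<forall>\<^sub>F t in at_top. \<epsilon> t \<in> {0<..} \<and> \<epsilon> t \<noteq> 0"
        using eventually_ge_at_top[of 0] by eventually_elim (use eps_pos in force)
    qed
    from filterlim_compose[OF T.reg_tendsto this] show ?thesis by (simp add: z_def[abs_def])
  qed
  have x_D: "x t \<in> D" if "t \<ge> 0" for t using x that by (simp add: is_solution_def)
  have x_ac: "abs_continuous_on {0..b} x" if "b \<ge> 0" for b
    using x that by (simp add: is_solution_def loc_abs_continuous_def)
  have x_der: "AE t in lebesgue. t \<ge> 0 \<longrightarrow> (x has_vector_derivative flow.rhs t (x t)) (at t)"
  proof -
    have "AE t in lebesgue. t \<ge> 0 \<longrightarrow> x differentiable (at t) \<and>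
        - vector_derivative x (at t) = x t - Tt t (x t) + \<epsilon> t *\<^sub>R (x t - y t)"
      using x by (simp add: is_solution_def)
    then show ?thesis
    proof eventually_elim
      case (elim t)
      show ?case
      proof
        assume "t \<ge> 0"
      with elim have vd: "(x has_vector_derivative vector_derivative x (at t)) (at t)" and
        eq: "- vector_derivative x (at t) = x t - Tt t (x t) + \<epsilon> t *\<^sub>R (x t - y t)"
        by (auto simp: vector_derivative_works)
      have "flow.rhs t (x t) = - (- vector_derivative x (at t))"
        unfolding eq by (simp add: flow.rhs_def algebra_simps)
      then show "(x has_vector_derivative flow.rhs t (x t)) (at t)" using vd by simp
      qed
    qed
  qed
  have eps_diff: "AE t in lebesgue. t > 0 \<longrightarrow> \<epsilon> differentiable (at t)"
  proof -
    have "AE t in lebesgue. t \<in> {0<..<real (Suc n)} \<longrightarrow> (\<lambda>t. 0 - \<epsilon> t) differentiable (at t)" for n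
    proof (rule AE_differentiable_mono_abs_continuous)
      show "abs_continuous_on {0..real (Suc n)} (\<lambda>t. 0 - \<epsilon> t)"
        by (intro abs_continuous_on_diff abs_continuous_on_const eps_ac_b)
      show "mono_on {0..real (Suc n)} (\<lambda>t. 0 - \<epsilon> t)"
        using eps_le by (auto intro!: mono_onI)
    qed simp
    then have "AE t in lebesgue. \<forall>n. t \<in> {0<..<real (Suc n)} \<longrightarrow> (\<lambda>t. 0 - \<epsilon> t) differentiable (at t)"
      unfolding AE_all_countable by blast
    then show ?thesis
    proof (rule eventually_mono, intro impI)
      fix t :: real
      assume t: "\<forall>n. t \<in> {0<..<real (Suc n)} \<longrightarrow> (\<lambda>t. 0 - \<epsilon> t) differentiable (at t)" "t > 0"
      obtain n :: nat where "t < real n" using reals_Archimedean2 by blast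
      then have "t \<in> {0<..<real (Suc n)}" using t(2) by simp
      then have "(\<lambda>t. 0 - \<epsilon> t) differentiable (at t)" using t(1) by blast
      from differentiable_diff[OF differentiable_const[of 0] this]
      show "\<epsilon> differentiable (at t)" by simp
    qed
  qed
  have "((\<lambda>t. norm (x t - z t)) \<longlongrightarrow> 0) at_top"
  proof (rule right_dini_convergence)
    fix b
    show "abs_continuous_on {0..b} (\<lambda>t. norm (x t - z t))"
    proof (cases "b \<ge> 0")
      case True
      have "abs_continuous_on {0..b} z"
      proof (rule abs_continuous_on_dominated1[OF eps_ac_b])
        show "0 \<le> d / \<epsilon> b" using d0 eps_pos[OF True] by simp
        fix s t :: real assume st: "s < t" "{s..t} \<subseteq> {0..b}"
        then have st': "0 \<le> s" "0 \<le> t" "s \<le> b" "t \<le> b" by auto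
        have "norm (z t - z s) \<le> \<bar>\<epsilon> t - \<epsilon> s\<bar> / \<epsilon> s * d" using st' by (intro z_lip)
        also have "\<dots> \<le> \<bar>\<epsilon> t - \<epsilon> s\<bar> / \<epsilon> b * d"
          using st' d0 eps_pos[OF True] eps_pos[of s] eps_le
          by (intro mult_right_mono divide_left_mono) auto
        finally show "norm (z t - z s) \<le> d / \<epsilon> b * norm (\<epsilon> t - \<epsilon> s)" by (simp add: mult_ac)
      qed
      then show ?thesis
        using x_ac[OF True] by (intro abs_continuous_on_norm abs_continuous_on_diff)
    next
      case False
      then show ?thesis by (intro abs_continuous_on_lipschitz[of 0]) auto
    qed
  next
    fix b :: real assume "b \<ge> 0"
    show "primitive_on b \<epsilon> (\<lambda>x. integral {0..x} \<epsilon>)"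
      using eps_cont[of b] eps_pos \<open>b \<ge> 0\<close>
      by (intro primitive_on_integral integrable_continuous_real) (auto intro: less_imp_le)
  next
    fix B :: real
    show "\<exists>t\<ge>0. integral {0..t} \<epsilon> > B"
    proof (rule ccontr)
      assume "\<not> ?thesis"
      then have bd: "integral {0..t} \<epsilon> \<le> B" if "t \<ge> 0" for t using that by force
      \<comment> \<open>otherwise monotone convergence would make the integral of \<open>\<epsilon>\<close> at most \<open>B\<close>\<close>
      let ?f = "\<lambda>n t. if t \<in> {0..real n} then \<epsilon> t else 0"
      have "(\<epsilon> has_integral integral {0..real n} \<epsilon>) {0..real n}" for n
        using eps_cont by (intro integrable_integral integrable_continuous_real)
      then have "(?f n has_integral integral {0..real n} \<epsilon>) UNIV" for n
        by (simp only: has_integral_restrict_UNIV)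
      moreover have "0 \<le> ?f n t" for n t using eps_pos[of t] by auto
      ultimately have f: "?f n \<in> borel_measurable lebesgue"
        "(\<integral>\<^sup>+t. ennreal (?f n t) \<partial>lebesgue) = ennreal (integral {0..real n} \<epsilon>)" for n
        using has_integral_iff_nn_integral_lebesgue[of "?f n"] by blast+
      have "(\<integral>\<^sup>+s\<in>{0..}. ennreal (\<epsilon> s) \<partial>lebesgue) = (\<integral>\<^sup>+t. (SUP n. ennreal (?f n t)) \<partial>lebesgue)"
      proof (rule nn_integral_cong)
        fix t :: real
        show "ennreal (\<epsilon> t) * indicator {0..} t = (SUP n. ennreal (?f n t))"
        proof (cases "t \<ge> 0")
          case True
          obtain n :: nat where "t \<le> real n" using real_arch_simple by blast
          then have "ennreal (?f n t) = ennreal (\<epsilon> t)" using True by simp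
          moreover have "ennreal (?f m t) \<le> ennreal (\<epsilon> t)" for m using eps_pos[OF True] by simp
          then have "(SUP n. ennreal (?f n t)) \<le> ennreal (\<epsilon> t)" by (intro SUP_least)
          moreover have "ennreal (?f n t) \<le> (SUP n. ennreal (?f n t))" by (rule SUP_upper) simp
          ultimately have "(SUP n. ennreal (?f n t)) = ennreal (\<epsilon> t)" by (simp only: order_antisym)
          then show ?thesis using True by simp
        qed simp
      qed
      also have "\<dots> = (SUP n. \<integral>\<^sup>+t. ennreal (?f n t) \<partial>lebesgue)"
      proof (rule nn_integral_monotone_convergence_SUP)
        show "incseq (\<lambda>n t. ennreal (?f n t))"
          by (auto simp: incseq_def le_fun_def)
      qed (use f(1) in measurable)
      also have "\<dots> \<le> ennreal B"
        unfolding f(2) by (intro SUP_least ennreal_leI bd) simp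
      finally show False using eps_int by (simp add: top_unique)
    qed
  next
    fix \<gamma> :: real assume "\<gamma> > 0"
    \<comment> \<open>half of \<open>\<gamma>\<close> for the terms of \<open>\<psi>\<close>, half for \<open>norm (y t - yinf)\<close>\<close>
    define g where "g = \<gamma>/2"
    have g: "g > 0" "\<gamma> = g + g" using \<open>\<gamma> > 0\<close> by (auto simp: g_def)
    obtain t1 where t1: "AE t in lebesgue. t \<ge> t1 \<longrightarrow> \<bar>psi D T Tt \<epsilon> y yinf t / \<epsilon> t - 0\<bar> \<le> g"
      using psi_lim g(1) unfolding ess_tendsto_def by blast
    have "\<forall>\<^sub>F t in at_top. dist (y t) yinf < g" using y_lim g(1) by (rule tendstoD)
    then obtain t2 where t2: "\<And>t. t \<ge> t2 \<Longrightarrow> norm (y t - yinf) < g"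
      by (auto simp: eventually_at_top_linorder dist_norm)
    define t0 where "t0 = max 0 (max t1 t2)"
    have "AE t in lebesgue. t > t0 \<longrightarrow> (\<forall>\<kappa>>0. \<forall>\<^sub>F s in at_right t.
        norm (x s - z s) \<le> (1 - (s - t) * \<epsilon> t) * norm (x t - z t) + (s - t) * (\<gamma> * \<epsilon> t + \<kappa>))"
      using t1 x_der eps_diff
    proof eventually_elim
      case (elim t)
      show ?case
      proof (intro impI allI)
        fix \<kappa> :: real assume "t > t0" "\<kappa> > 0"
        then have t: "t > 0" "t \<ge> t1" "t \<ge> t2" by (auto simp: t0_def)
        have et: "\<epsilon> t > 0" using t eps_pos by simp
        define e' where "e' = vector_derivative \<epsilon> (at t)"
        have e': "(\<epsilon> has_vector_derivative e') (at t)"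
          using elim(3) t unfolding e'_def by (simp add: vector_derivative_works)
        have "e' \<le> 0"
        proof (rule field_le_epsilon)
          fix q :: real assume "q > 0"
          have "\<forall>\<^sub>F s in at_right t. e' \<le> q"
            using has_vector_derivative_eventually_at_right[OF e' \<open>q > 0\<close>] eventually_at_right_less[of t]
          proof eventually_elim
            case (elim s)
            have "\<epsilon> s \<le> \<epsilon> t" using elim(2) t by (intro eps_le) auto
            then have "(s - t) * e' \<le> (s - t) * q" using elim(1) by (simp add: mult.commute abs_le_iff)
            then show ?case using elim(2) by simp
          qed
          then show "e' \<le> 0 + q" using eventually_happens'[OF trivial_limit_at_right_real] by simp
        qed
        define w where "w = norm (Tt t (z t) - T (z t))"
        \<comment> \<open>\<open>\<psi>\<close> is a sum of nonnegative terms, so it dominates the sum of any of them\<close>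
        have psi_bound: "w + (- e' / \<epsilon> t) * d \<le> g * \<epsilon> t"
        proof -
          have "psi D T Tt \<epsilon> y yinf t \<le> g * \<epsilon> t"
            using elim(1) t(2) et by (simp add: abs_le_iff pos_divide_le_eq)
          moreover have "psi D T Tt \<epsilon> y yinf t = 2 * norm (y t - yinf) + w + norm (vector_derivative y (at t))
              + (- e' / \<epsilon> t) * (2 * norm (y t - yinf) + d)"
            by (simp add: psi_def w_def z_def e'_def d_def Let_def)
          moreover have "(- e' / \<epsilon> t) * d \<le> (- e' / \<epsilon> t) * (2 * norm (y t - yinf) + d)"
            using \<open>e' \<le> 0\<close> et by (intro mult_left_mono) (auto simp: divide_nonpos_pos)
          ultimately show ?thesis
            using norm_ge_zero[of "y t - yinf"] norm_ge_zero[of "vector_derivative y (at t)"] by linarith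
        qed
        \<comment> \<open>the defect of \<open>z t\<close> as a stationary point of the equation of \<open>x\<close> at time \<open>t\<close>\<close>
        define q where "q = (Tt t (z t) - T (z t)) + \<epsilon> t *\<^sub>R (y t - yinf)"
        have q: "norm q \<le> w + g * \<epsilon> t"
        proof -
          have "norm q \<le> w + norm (\<epsilon> t *\<^sub>R (y t - yinf))"
            unfolding q_def w_def by (rule norm_triangle_ineq)
          also have "norm (\<epsilon> t *\<^sub>R (y t - yinf)) \<le> g * \<epsilon> t"
            using t2[OF t(3)] et by (simp add: mult.commute)
          finally show ?thesis by simp
        qed
        have Tz: "T (z t) = (1 + \<epsilon> t) *\<^sub>R z t - \<epsilon> t *\<^sub>R yinf"
          using z_eq[of t] t by (simp add: algebra_simps)
        have "flow.rhs t (x t) = (Tt t (x t) - Tt t (z t)) - (1 + \<epsilon> t) *\<^sub>R (x t - z t) + q"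
          unfolding q_def Tz by (simp add: flow.rhs_def algebra_simps)
        moreover have "((\<lambda>s. x s - z t) has_vector_derivative (flow.rhs t (x t) - 0)) (at t)"
          using elim(2) t by (intro has_vector_derivative_diff has_vector_derivative_const) simp
        ultimately have der: "((\<lambda>s. x s - z t) has_vector_derivative
            ((Tt t (x t) - Tt t (z t)) - (1 + \<epsilon> t) *\<^sub>R (x t - z t) + q)) (at t)" by simp
        define \<kappa>1 where "\<kappa>1 = \<kappa>/2"
        \<comment> \<open>chosen so that an error \<open>\<kappa>2\<close> in \<open>\<epsilon>'\<close> changes the bound on the speed of \<open>z\<close> by at most \<open>\<kappa>/2\<close>\<close>
        define \<kappa>2 where "\<kappa>2 = \<kappa>/2 * \<epsilon> t / (d + 1)"
        have \<kappa>12: "\<kappa>1 > 0" "\<kappa>2 > 0" using \<open>\<kappa> > 0\<close> et d0 by (auto simp: \<kappa>1_def \<kappa>2_def)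
        have \<kappa>2: "\<kappa>2 / \<epsilon> t * d \<le> \<kappa>/2"
        proof -
          have "\<kappa>2 / \<epsilon> t * d = \<kappa>/2 * (d / (d + 1))" using et by (simp add: \<kappa>2_def)
          also have "\<dots> \<le> \<kappa>/2 * 1" using d0 \<open>\<kappa> > 0\<close> by (intro mult_left_mono) auto
          finally show ?thesis by simp
        qed
        have "\<forall>\<^sub>F s in at_right t. norm (x s - z t)
            \<le> (1 - (s - t) * \<epsilon> t) * norm (x t - z t) + (s - t) * (norm q + \<kappa>1)"
          using t x_D[of t] zD[of t] et
          by (intro norm_right_dini_le[OF der _ _ \<kappa>12(1)] flow.Tt_le) auto
        moreover have "\<forall>\<^sub>F s in at_right t. norm (\<epsilon> s - \<epsilon> t - (s - t) *\<^sub>R e') \<le> \<kappa>2 * (s - t)"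
          by (rule has_vector_derivative_eventually_at_right[OF e' \<kappa>12(2)])
        ultimately show "\<forall>\<^sub>F s in at_right t. norm (x s - z s)
            \<le> (1 - (s - t) * \<epsilon> t) * norm (x t - z t) + (s - t) * (\<gamma> * \<epsilon> t + \<kappa>)"
          using eventually_at_right_less[of t]
        proof eventually_elim
          case (elim s)
          have "\<epsilon> s \<le> \<epsilon> t" using elim(3) t by (intro eps_le) auto
          then have "\<bar>\<epsilon> s - \<epsilon> t\<bar> \<le> (s - t) * (- e' + \<kappa>2)"
            using elim(2) by (simp add: abs_le_iff algebra_simps)
          then have "\<bar>\<epsilon> s - \<epsilon> t\<bar> / \<epsilon> t * d \<le> (s - t) * (- e' + \<kappa>2) / \<epsilon> t * d"
            using et d0 by (intro mult_right_mono divide_right_mono) auto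
          also have "\<dots> = (s - t) * ((- e' / \<epsilon> t) * d + \<kappa>2 / \<epsilon> t * d)"
            using et by (simp add: field_simps)
          also have "\<dots> \<le> (s - t) * ((- e' / \<epsilon> t) * d + \<kappa>/2)"
            using \<kappa>2 elim(3) by (intro mult_left_mono) auto
          finally have zs: "norm (z t - z s) \<le> (s - t) * ((- e' / \<epsilon> t) * d + \<kappa>/2)"
            using z_lip[of s t] elim(3) t by (simp add: norm_minus_commute)
          have "norm (x s - z s) \<le> norm (x s - z t) + norm (z t - z s)"
            using norm_triangle_ineq[of "x s - z t" "z t - z s"] by simp
          also have "\<dots> \<le> (1 - (s - t) * \<epsilon> t) * norm (x t - z t)
              + ((s - t) * (norm q + \<kappa>1) + (s - t) * ((- e' / \<epsilon> t) * d + \<kappa>/2))"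
            using elim(1) zs by linarith
          also have "(s - t) * (norm q + \<kappa>1) + (s - t) * ((- e' / \<epsilon> t) * d + \<kappa>/2)
              = (s - t) * (norm q + (- e' / \<epsilon> t) * d + \<kappa>)"
            by (simp add: \<kappa>1_def algebra_simps)
          also have "\<dots> \<le> (s - t) * (\<gamma> * \<epsilon> t + \<kappa>)"
          proof (rule mult_left_mono)
            have "\<gamma> * \<epsilon> t = g * \<epsilon> t + g * \<epsilon> t" by (simp add: g(2) algebra_simps)
            then show "norm q + (- e' / \<epsilon> t) * d + \<kappa> \<le> \<gamma> * \<epsilon> t + \<kappa>"
              using q psi_bound by linarith
          qed (use elim(3) in simp)
          finally show ?case by simp
        qed
      qed
    qed
    moreover have "t0 \<ge> 0" by (simp add: t0_def)
    ultimately show "\<exists>t0\<ge>0. AE t in lebesgue. t > t0 \<longrightarrow> (\<forall>\<kappa>>0. \<forall>\<^sub>F s in at_right t.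
        norm (x s - z s) \<le> (1 - (s - t) * \<epsilon> t) * norm (x t - z t) + (s - t) * (\<gamma> * \<epsilon> t + \<kappa>))"
      by blast
  qed (use eps_pos in auto)
  then have "((\<lambda>t. (x t - z t) + z t) \<longlongrightarrow> 0 + metric_proj (Fix D T) yinf) at_top"
    by (intro tendsto_add z_lim) (simp add: tendsto_norm_zero_iff)
  then have "(x \<longlongrightarrow> metric_proj (Fix D T) yinf) at_top" by simp
  then show ?thesis using x flow.is_solution_unique[OF x] by blast
qed

end
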